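(* Let $\phi\in\mathcal O(\mathbb D^d,\mathbb D^d)\cap\mathcal C^1(\overline{\mathbb D}^d)$ and $\beta_1,\beta_2\geq-1$. Assume that $C_\phi$ maps boundedly $A^2_{\beta_1}(\mathbb D^d)$ into $A^2_{\beta_2}(\mathbb D^d)$. Then for all $\beta_1'\geq\beta_1$, $C_\phi$ maps boundedly $A^2_{\beta_1'}(\mathbb D^d)$ into $A^2_{\beta_2'}(\mathbb D^d)$, where $$\beta_2'=\frac{\beta_1'(\beta_2+2)+2(\beta_2-\beta_1)}{\beta_1+2}.$$ In particular, if $C_\phi$ is bounded on $A^2_{\beta_1}(\mathbb D^d)$, then it is bounded on $A^2_{\beta_1'}(\mathbb D^d)$ for all $\beta_1'\ge\beta_1$.
   Context: $\mathbb D$ is the open unit disc, $\mathbb T$ the unit circle, and $\mathcal O(\mathbb D^d,\mathbb D^d)$ is the set of holomorphic maps $\mathbb D^d\to\mathbb D^d$. $\phi\in\mathcal C^1(\overline{\mathbb D}^d)$ means that $\phi$ and its first-order partial derivatives extend continuously to $\overline{\mathbb D}^d$. $dA$ is the normalized area measure on $\mathbb D$; for $\beta>-1$, $dA_\beta(z)=(\beta+1)(1-|z|^2)^\beta dA(z)$, $dV_\beta(z)=dA_\beta(z_1)\cdots dA_\beta(z_d)$, and $A^2_\beta(\mathbb D^d)$ is the space of holomorphic $f:\mathbb D^d\to\mathbb C$ with $\|f\|^2=\int_{\mathbb D^d}|f|^2dV_\beta<+\infty$. By convention $A^2_{-1}(\mathbb D^d)=H^2(\mathbb D^d)$, the Hardy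 space of holomorphic $f:\mathbb D^d\to\mathbb C$ with $\|f\|^2=\sup_{0<r<1}\int_{\mathbb T^d}|f(r\zeta)|^2d\sigma_d(\zeta)<+\infty$, $\sigma_d$ the normalized measure on $\mathbb T^d$. $C_\phi(f)=f\circ\phi$. *)

theory Defs
  imports "HOL-Analysis.Analysis"
begin

definition polydisc :: "(complex ^ 'd) set" where
  "polydisc = {z. \<forall>i. norm (z $ i) < 1}"

definition closed_polydisc :: "(complex ^ 'd) set" where
  "closed_polydisc = {z. \<forall>i. norm (z $ i) \<le> 1}"

text \<open>Complex differentiability in several variables: the real Frechet derivative exists
  and is complex linear.\<close>

definition holo_on :: "(complex ^ 'd \<Rightarrow> complex) \<Rightarrow> (complex ^ 'd) set \<Rightarrow> bool"
    (infix "holo'_on" 50) where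
  "f holo_on S \<longleftrightarrow> (\<forall>z\<in>S. \<exists>f'. (f has_derivative f') (at z within S) \<and>
     (\<forall>c v. f' (c *s v) = c * f' v))"

definition holo_self_map :: "(complex ^ 'd \<Rightarrow> complex ^ 'd) \<Rightarrow> bool" where
  "holo_self_map \<phi> \<longleftrightarrow>
     (\<forall>j. (\<lambda>z. \<phi> z $ j) holo_on polydisc) \<and> \<phi> ` polydisc \<subseteq> polydisc"

definition partial_deriv :: "'d \<Rightarrow> (complex ^ 'd \<Rightarrow> complex) \<Rightarrow> complex ^ 'd \<Rightarrow> complex" where
  "partial_deriv k f z = deriv (\<lambda>w. f (\<chi> i. if i = k then w else z $ i)) (z $ k)"

definition extends_continuously :: "(complex ^ 'd \<Rightarrow> complex) \<Rightarrow> bool" where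
  "extends_continuously f \<longleftrightarrow>
     (\<exists>g. continuous_on closed_polydisc g \<and> (\<forall>z\<in>polydisc. g z = f z))"

text \<open>This is only used for holomorphic maps, for which the partial derivatives with respect to
  the conjugate variables vanish; so it suffices to consider the complex partial derivatives.\<close>

definition C1_closed_polydisc :: "(complex ^ 'd \<Rightarrow> complex ^ 'd) \<Rightarrow> bool" where
  "C1_closed_polydisc \<phi> \<longleftrightarrow>
     (\<forall>j. extends_continuously (\<lambda>z. \<phi> z $ j) \<and>
        (\<forall>k. extends_continuously (partial_deriv k (\<lambda>z. \<phi> z $ j))))"

definition vec_power_measure :: "complex measure \<Rightarrow> (complex ^ 'd) measure" where
  "vec_power_measure M = distr (Pi\<^sub>M UNIV (\<lambda>_. M)) borel vec_lambda"

definition disc_area :: "complex measure" where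
  "disc_area = density lborel (\<lambda>z. ennreal (1 / pi) * indicator (ball 0 1) z)"

definition weighted_disc_area :: "real \<Rightarrow> complex measure" where
  "weighted_disc_area \<beta> =
     density disc_area (\<lambda>z. ennreal ((\<beta> + 1) * (1 - (norm z)\<^sup>2) powr \<beta>))"

definition circle_measure :: "complex measure" where
  "circle_measure = distr (uniform_measure lborel {0..2 * pi}) borel cis"

definition bergman_norm_sq :: "real \<Rightarrow> (complex ^ 'd \<Rightarrow> complex) \<Rightarrow> ennreal" where
  "bergman_norm_sq \<beta> f =
     (\<integral>\<^sup>+ z\<in>polydisc. ennreal ((norm (f z))\<^sup>2) \<partial>vec_power_measure (weighted_disc_area \<beta>))"

definition hardy_norm_sq :: "(complex ^ 'd \<Rightarrow> complex) \<Rightarrow> ennreal" where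
  "hardy_norm_sq f =
     (SUP r\<in>{0<..<1}. \<integral>\<^sup>+ \<zeta>. ennreal ((norm (f (r *\<^sub>R \<zeta>)))\<^sup>2) \<partial>vec_power_measure circle_measure)"

text \<open>The scale of spaces is only meant for \<open>\<beta> \<ge> -1\<close>, with the Hardy space at \<open>\<beta> = -1\<close>.
  A function on the polydisc is represented by any function on the whole space extending it;
  its values outside the polydisc are never used.\<close>

definition A2_norm_sq :: "real \<Rightarrow> (complex ^ 'd \<Rightarrow> complex) \<Rightarrow> ennreal" where
  "A2_norm_sq \<beta> f = (if \<beta> = -1 then hardy_norm_sq f else bergman_norm_sq \<beta> f)"

definition A2 :: "real \<Rightarrow> (complex ^ 'd \<Rightarrow> complex) set" where
  "A2 \<beta> = {f. f holo_on polydisc \<and> A2_norm_sq \<beta> f < \<infinity>}"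

definition A2_norm :: "real \<Rightarrow> (complex ^ 'd \<Rightarrow> complex) \<Rightarrow> real" where
  "A2_norm \<beta> f = sqrt (enn2real (A2_norm_sq \<beta> f))"

definition composition_bounded ::
    "(complex ^ 'd \<Rightarrow> complex ^ 'd) \<Rightarrow> real \<Rightarrow> real \<Rightarrow> bool" where
  "composition_bounded \<phi> \<beta>\<^sub>1 \<beta>\<^sub>2 \<longleftrightarrow>
     (\<forall>f\<in>A2 \<beta>\<^sub>1. f \<circ> \<phi> \<in> A2 \<beta>\<^sub>2) \<and>
     (\<exists>C. \<forall>f\<in>A2 \<beta>\<^sub>1. A2_norm \<beta>\<^sub>2 (f \<circ> \<phi>) \<le> C * A2_norm \<beta>\<^sub>1 f)"

end

theory Submission
  imports Defs "HOL-Complex_Analysis.Complex_Analysis" "HOL-Probability.Probability"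
begin

text \<open>By orthogonality of the monomials, \<open>A\<^sup>2\<^sub>\<beta>\<close> is, up to equivalence of norms, the space of power
  series whose coefficients are square summable with weight \<open>\<Prod>\<^sub>i (n\<^sub>i + 1) powr - (\<beta> + 1)\<close>, and
  \<open>C\<^sub>\<phi>\<close> acts by the matrix whose \<open>n\<close>-th column holds the coefficients of \<open>\<phi>\<^sup>n\<close>. The reproducing
  kernel of \<open>A\<^sup>2\<^sub>\<beta>\<close> is a power with exponent \<open>\<beta> + 2\<close>, so squaring kernels (equivalently, applying
  \<open>C\<^sub>\<phi> \<otimes> C\<^sub>\<phi>\<close> and restricting to the diagonal) shows that boundedness for \<open>(\<beta>\<^sub>1 + 2, \<beta>\<^sub>2 + 2)\<close>
  implies boundedness for \<open>(2 (\<beta>\<^sub>1 + 2), 2 (\<beta>\<^sub>2 + 2))\<close>. Iterating, this gives boundedness for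
  arbitrarily large exponents on the ray through \<open>(\<beta>\<^sub>1 + 2, \<beta>\<^sub>2 + 2)\<close>; interpolating between weighted
  \<open>l\<^sup>2\<close> spaces fills in all intermediate points of the ray, which is the assertion.\<close>

section \<open>Fourier analysis on the torus\<close>

text \<open>Boundedness is encoded as one constant serving all finite sections of the matrix, so
  tensoring and interpolation take place inside finite sums and raise no question of convergence or
  density. Of the kernels one trace remains: the convolution square of the weight
  \<open>wt n powr s\<close> is comparable to \<open>wt n powr (2 * s + 1)\<close>, because the box
  of indices below m has exactly \<open>wt m\<close> points. In terms of s + 1 this is
  multiplication by 2.

  The analysis sits in the passage between functions and coefficients. The measures are invariant
  under the torus, so norms may be averaged over torus orbits; on each orbit Parseval applies, and
  only radial moments remain, whose growth is Euler's limit formula for Gamma. In the other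
  direction a matrix bound speaks of polynomials only. A general f is reached by Fatou's lemma along
  partial sums of its power series, which converge at \<phi>(z) because \<phi>(z) stays inside the
  polydisc.\<close>

definition angle_measure :: "real measure" where
  "angle_measure = uniform_measure lborel {0..2 * pi}"

definition torus_measure :: "'d set \<Rightarrow> ('d \<Rightarrow> real) measure" where
  "torus_measure I = Pi\<^sub>M I (\<lambda>_. angle_measure)"

lemma prob_space_angle: "prob_space angle_measure"
  unfolding angle_measure_def by (rule prob_space_uniform_measure) auto

interpretation angle: prob_space angle_measure by (rule prob_space_angle)

lemma sets_angle_measure [measurable_cong, simp]: "sets angle_measure = sets borel"
  by (simp add: angle_measure_def)

lemma space_angle_measure [simp]: "space angle_measure = UNIV"
  by (simp add: angle_measure_def)

lemma product_prob_space_angle: "product_prob_space (\<lambda>_. angle_measure)"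
  by unfold_locales

lemma prob_space_torus: "prob_space (torus_measure I)"
  unfolding torus_measure_def by (rule prob_space_PiM) (rule prob_space_angle)

lemma sets_torus_measure [measurable_cong]:
  "sets (torus_measure I) = sets (Pi\<^sub>M I (\<lambda>_. borel))"
  unfolding torus_measure_def by (rule sets_PiM_cong) auto

lemma borel_measurable_cis [measurable]: "cis \<in> borel_measurable borel"
  by (intro borel_measurable_continuous_onI continuous_intros)

lemma borel_measurable_cnj [measurable]: "cnj \<in> borel_measurable borel"
  by (intro borel_measurable_continuous_onI continuous_intros)

lemma integral_angle_cis:
  "(\<integral>t. cis (real_of_int k * t) \<partial>angle_measure) = of_bool (k = 0)"
proof -
  have "(\<integral>t. cis (real_of_int k * t) \<partial>angle_measure) =
     (\<integral>t. (indicator {0..2*pi} t / (2 * pi)) *\<^sub>R cis (real_of_int k * t) \<partial>lborel)"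
  proof -
    have *: "angle_measure = density lborel (\<lambda>t. ennreal (indicator {0..2*pi} t / (2 * pi)))"
      unfolding angle_measure_def uniform_measure_def
      by (intro density_cong AE_I2) (auto simp: indicator_def simp flip: divide_ennreal)
    show ?thesis
      unfolding * by (subst integral_density)
         (auto simp: indicator_def intro!: Bochner_Integration.integral_cong)
  qed
  also have "\<dots> = (\<integral>t. (1 / (2 * pi)) *\<^sub>R (indicator {0..2*pi} t *\<^sub>R cis (real_of_int k * t)) \<partial>lborel)"
    by (rule Bochner_Integration.integral_cong) simp_all
  also have "\<dots> = (1 / (2 * pi)) *\<^sub>R (\<integral>t. indicator {0..2*pi} t *\<^sub>R cis (real_of_int k * t) \<partial>lborel)"
    by (rule Bochner_Integration.integral_scaleR_right) 
  also have "\<dots> = of_bool (k = 0)"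
  proof (cases "k = 0")
    case True
    then show ?thesis by simp
  next
    case False
    have "(\<integral>t. indicator {0..2*pi} t *\<^sub>R cis (real_of_int k * t) \<partial>lborel)
       = cis (real_of_int k * (2 * pi)) / (\<i> * of_int k) - cis (real_of_int k * 0) / (\<i> * of_int k)"
    proof (rule integral_FTC_Icc)
      fix x :: real
      show "((\<lambda>t. cis (real_of_int k * t) / (\<i> * of_int k)) has_vector_derivative cis (real_of_int k * x))
              (at x within {0..2*pi})"
      proof -
        have "((\<lambda>z. exp (\<i> * (of_int k * z)) / (\<i> * of_int k)) has_field_derivative
           exp (\<i> * (of_int k * of_real x))) (at (complex_of_real x))"
          using False by (auto intro!: derivative_eq_intros simp: mult_ac)
        from has_vector_derivative_real_field[OF this] show ?thesis
          by (simp add: cis_conv_exp)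
      qed
    qed (auto intro!: continuous_intros)
    moreover have "cis (real_of_int k * (2 * pi)) = 1"
      using cis_multiple_2pi[of "of_int k"] by (simp add: mult_ac)
    ultimately show ?thesis using False by simp
  qed
  finally show ?thesis .
qed

lemma integral_angle_orthonormal:
  "(\<integral>t. cis t ^ m * cnj (cis t) ^ n \<partial>angle_measure) = of_bool (m = n)"
proof -
  have "cis t ^ m * cnj (cis t) ^ n = cis (real_of_int (int m - int n) * t)" for t
  proof -
    have "cis t ^ m * cnj (cis t) ^ n = cis (real m * t) * cis (real n * (- t))"
      by (simp only: cis_cnj Complex.DeMoivre)
    then show ?thesis unfolding cis_mult by (simp add: algebra_simps)
  qed
  then show ?thesis by (simp only: integral_angle_cis) simp
qed

lemma integrable_boundedI:
  fixes f :: "'a \<Rightarrow> complex"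
  assumes "prob_space M" "f \<in> borel_measurable M" "\<And>x. x \<in> space M \<Longrightarrow> norm (f x) \<le> B"
  shows "integrable M f"
proof -
  interpret prob_space M by fact
  show ?thesis by (rule integrable_const_bound[of _ B]) (use assms in auto)
qed

section \<open>Monomials, the torus action and Parseval's identity\<close>

definition zpow :: "complex ^ 'd \<Rightarrow> ('d \<Rightarrow> nat) \<Rightarrow> complex" where
  "zpow z n = (\<Prod>i\<in>UNIV. z $ i ^ n i)"

definition rot :: "('d::finite \<Rightarrow> real) \<Rightarrow> complex ^ 'd \<Rightarrow> complex ^ 'd" where
  "rot \<theta> z = (\<chi> i. cis (\<theta> i) * z $ i)"

definition torus_mono :: "('d::finite \<Rightarrow> nat) \<Rightarrow> ('d \<Rightarrow> real) \<Rightarrow> complex" where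
  "torus_mono n \<theta> = (\<Prod>i\<in>UNIV. cis (\<theta> i) ^ n i)"

lemma norm_torus_mono [simp]: "norm (torus_mono n \<theta>) = 1"
  by (simp add: torus_mono_def norm_power flip: prod_norm)

text \<open>Monomials are eigenvectors of the torus action. Along each orbit a power series
  therefore becomes a Fourier series, with coefficients \<open>c n * zpow z n\<close>.\<close>

lemma zpow_rot: "zpow (rot \<theta> z) n = torus_mono n \<theta> * zpow z n"
  by (simp add: zpow_def rot_def torus_mono_def power_mult_distrib prod.distrib)

lemma measurable_torus_mono [measurable]: "torus_mono n \<in> borel_measurable (torus_measure UNIV)"
  unfolding torus_mono_def[abs_def] by measurable

lemma integral_torus_orthonormal:
  "(\<integral>\<theta>. torus_mono n \<theta> * cnj (torus_mono m \<theta>) \<partial>torus_measure UNIV) = of_bool (n = m)"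
proof -
  interpret angles: product_prob_space "\<lambda>_. angle_measure" UNIV by (rule product_prob_space_angle)
  have "(\<integral>\<theta>. torus_mono n \<theta> * cnj (torus_mono m \<theta>) \<partial>torus_measure UNIV) =
    (\<integral>\<theta>. (\<Prod>i\<in>UNIV. cis (\<theta> i) ^ n i * cnj (cis (\<theta> i)) ^ m i) \<partial>Pi\<^sub>M UNIV (\<lambda>_. angle_measure))"
    by (simp add: torus_mono_def torus_measure_def prod.distrib)
  also have "\<dots> = (\<Prod>i\<in>UNIV. \<integral>t. cis t ^ n i * cnj (cis t) ^ m i \<partial>angle_measure)"
    by (rule angles.product_integral_prod)
       (auto intro!: integrable_boundedI[where B = 1] simp: prob_space_angle norm_mult norm_power)
  also have "\<dots> = of_bool (n = m)"
    unfolding integral_angle_orthonormal by (auto simp: fun_eq_iff)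
  finally show ?thesis .
qed

text \<open>Termwise integration under a Weierstrass majorant: the error of a finite partial sum is
  bounded, uniformly in x, by the corresponding tail of \<open>B\<close>. This explicit estimate
  passes directly to the limit along the net of finite index sets.\<close>

lemma has_sum_integral:
  fixes g :: "'i \<Rightarrow> 'a \<Rightarrow> complex"
  assumes "prob_space M" and [measurable]: "\<And>n. g n \<in> borel_measurable M"
    and [measurable]: "G \<in> borel_measurable M"
    and bd: "\<And>n x. x \<in> space M \<Longrightarrow> norm (g n x) \<le> B n" and B: "B summable_on UNIV"
    and hs: "\<And>x. x \<in> space M \<Longrightarrow> ((\<lambda>n. g n x) has_sum G x) UNIV"
  shows "((\<lambda>n. \<integral>x. g n x \<partial>M) has_sum (\<integral>x. G x \<partial>M)) UNIV"
proof -
  interpret prob_space M by fact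
  have int_g [simp]: "integrable M (g n)" for n
    by (rule integrable_boundedI[where B = "B n"]) (use assms in auto)
  have abs: "(\<lambda>n. norm (g n x)) summable_on A" if "x \<in> space M" for x A
    by (rule Infinite_Sum.abs_summable_on_comparison_test'[where g = B])
       (use bd that summable_on_subset[OF B] in auto)
  have "norm (G x) \<le> infsum B UNIV" if x: "x \<in> space M" for x
  proof -
    have "norm (infsum (\<lambda>n. g n x) UNIV) \<le> infsum B UNIV"
      by (rule order.trans[OF norm_infsum_bound[OF abs[OF x]] infsum_mono])
         (use abs B bd x in auto)
    then show ?thesis using infsumI[OF hs[OF x]] by simp
  qed
  then have int_G [simp]: "integrable M G"
    by (intro integrable_boundedI[where B = "infsum B UNIV"]) (use assms in auto)
  have est: "norm ((\<integral>x. G x \<partial>M) - (\<Sum>n\<in>N. \<integral>x. g n x \<partial>M)) \<le> infsum B UNIV - sum B N"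
    if N: "finite N" for N
  proof -
    have "(\<integral>x. G x \<partial>M) - (\<Sum>n\<in>N. \<integral>x. g n x \<partial>M) = (\<integral>x. G x - (\<Sum>n\<in>N. g n x) \<partial>M)"
      by (simp add: Bochner_Integration.integral_sum Bochner_Integration.integral_diff)
    also have "norm \<dots> \<le> (\<integral>x. infsum B UNIV - sum B N \<partial>M)"
    proof (rule order.trans[OF integral_norm_bound integral_mono])
      fix x assume x: "x \<in> space M"
      have eq: "G x - (\<Sum>n\<in>N. g n x) = infsum (\<lambda>n. g n x) (UNIV - N)"
        using infsum_Diff[of "\<lambda>n. g n x" UNIV N] infsumI[OF hs[OF x]] has_sum_imp_summable[OF hs[OF x]] N
        by (simp add: infsum_finite)
      have "norm (infsum (\<lambda>n. g n x) (UNIV - N)) \<le> infsum B (UNIV - N)"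
        by (rule order.trans[OF norm_infsum_bound[OF abs[OF x]] infsum_mono])
           (use abs bd x summable_on_subset[OF B] in auto)
      also have "\<dots> = infsum B UNIV - sum B N"
        using infsum_Diff[OF B, of N] N by (simp add: infsum_finite)
      finally show "norm (G x - (\<Sum>n\<in>N. g n x)) \<le> infsum B UNIV - sum B N"
        using eq by simp
    qed auto
    finally show ?thesis by (simp add: prob_space)
  qed
  have "((\<lambda>N. infsum B UNIV - sum B N) \<longlongrightarrow> infsum B UNIV - infsum B UNIV) (finite_subsets_at_top UNIV)"
    using has_sum_infsum[OF B] unfolding has_sum_def by (intro tendsto_intros)
  then have lim0: "((\<lambda>N. infsum B UNIV - sum B N) \<longlongrightarrow> 0) (finite_subsets_at_top UNIV)" by simp
  have "((\<lambda>N. (\<integral>x. G x \<partial>M) - (\<Sum>n\<in>N. \<integral>x. g n x \<partial>M)) \<longlongrightarrow> 0) (finite_subsets_at_top UNIV)"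
    by (rule Lim_null_comparison[OF _ lim0])
       (auto intro!: eventually_finite_subsets_at_top_weakI est)
  then have "((\<lambda>N. (\<integral>x. G x \<partial>M) - ((\<integral>x. G x \<partial>M) - (\<Sum>n\<in>N. \<integral>x. g n x \<partial>M))) \<longlongrightarrow> (\<integral>x. G x \<partial>M) - 0) (finite_subsets_at_top UNIV)"
    by (intro tendsto_intros)
  then show ?thesis unfolding has_sum_def by simp
qed

text \<open>The characters have modulus one, so the coefficients are absolutely summable and every
  interchange of sum and integral is uniform. Integrating the series against a conjugate character
  isolates one coefficient; integrating it against the conjugate of \<open>F\<close> itself gives
  the sum of squares.\<close>

lemma torus_parseval:
  fixes a :: "('d::finite \<Rightarrow> nat) \<Rightarrow> complex"
  assumes F: "\<And>\<theta>. ((\<lambda>n. a n * torus_mono n \<theta>) has_sum F \<theta>) UNIV"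
    and [measurable]: "F \<in> borel_measurable (torus_measure UNIV)"
  shows "((\<lambda>n. (norm (a n))\<^sup>2) has_sum (\<integral>\<theta>. (norm (F \<theta>))\<^sup>2 \<partial>torus_measure UNIV)) UNIV"
    and "integrable (torus_measure UNIV) (\<lambda>\<theta>. (norm (F \<theta>))\<^sup>2)"
    and "\<And>m. (\<integral>\<theta>. F \<theta> * cnj (torus_mono m \<theta>) \<partial>torus_measure UNIV) = a m"
proof -
  interpret prob_space "torus_measure UNIV" by (rule prob_space_torus)
  \<comment> \<open>Any single angle would do: summability over the complex numbers is absolute, and
    the norms of the terms do not depend on the angle.\<close>
  have "(\<lambda>n. a n * torus_mono n (\<lambda>_. 0)) summable_on UNIV"
    by (rule has_sum_imp_summable[OF F])
  then have sa: "(\<lambda>n. norm (a n)) summable_on UNIV"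
    by (subst (asm) summable_on_iff_abs_summable_on_complex) (simp add: norm_mult)
  have Fbd: "norm (F \<theta>) \<le> infsum (\<lambda>n. norm (a n)) UNIV" for \<theta>
    using norm_infsum_bound[of "\<lambda>n. a n * torus_mono n \<theta>" UNIV] infsumI[OF F[of \<theta>]] sa
    by (simp add: norm_mult)
  let ?K = "infsum (\<lambda>n. norm (a n)) UNIV"
  show int: "integrable (torus_measure UNIV) (\<lambda>\<theta>. (norm (F \<theta>))\<^sup>2)"
    by (rule integrable_const_bound[where B = "?K\<^sup>2"]) (auto intro!: power_mono Fbd)
  show coeff: "(\<integral>\<theta>. F \<theta> * cnj (torus_mono m \<theta>) \<partial>torus_measure UNIV) = a m" for m
  proof -
    have "((\<lambda>n. \<integral>\<theta>. a n * torus_mono n \<theta> * cnj (torus_mono m \<theta>) \<partial>torus_measure UNIV) has_sum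
       (\<integral>\<theta>. F \<theta> * cnj (torus_mono m \<theta>) \<partial>torus_measure UNIV)) UNIV"
      by (rule has_sum_integral[where B = "\<lambda>n. norm (a n)"])
         (auto simp: prob_space_torus sa norm_mult intro!: has_sum_cmult_left F)
    moreover have "(\<integral>\<theta>. a n * torus_mono n \<theta> * cnj (torus_mono m \<theta>) \<partial>torus_measure UNIV) = a n * of_bool (n = m)" for n
      by (simp add: mult.assoc integral_torus_orthonormal)
    moreover have "((\<lambda>n. a n * of_bool (n = m)) has_sum a m) UNIV"
      by (rule has_sum_finite_neutralI[where B = "{m}"]) auto
    ultimately show ?thesis using has_sum_unique by fastforce
  qed
  have "((\<lambda>n. \<integral>\<theta>. a n * torus_mono n \<theta> * cnj (F \<theta>) \<partial>torus_measure UNIV) has_sum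
       (\<integral>\<theta>. F \<theta> * cnj (F \<theta>) \<partial>torus_measure UNIV)) UNIV"
    by (rule has_sum_integral[where B = "\<lambda>n. norm (a n) * ?K"])
       (auto simp: prob_space_torus norm_mult intro!: has_sum_cmult_left F mult_left_mono Fbd summable_on_cmult_left sa)
  moreover have "(\<integral>\<theta>. a n * torus_mono n \<theta> * cnj (F \<theta>) \<partial>torus_measure UNIV) = of_real ((norm (a n))\<^sup>2)" for n
  proof -
    have "(\<integral>\<theta>. a n * torus_mono n \<theta> * cnj (F \<theta>) \<partial>torus_measure UNIV) =
        a n * (\<integral>\<theta>. cnj (F \<theta> * cnj (torus_mono n \<theta>)) \<partial>torus_measure UNIV)"
      by (simp add: mult_ac)
    also have "\<dots> = a n * cnj (a n)"
      by (subst Bochner_Integration.integral_cnj) (simp only: coeff)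
    finally show ?thesis by (simp add: complex_norm_square flip: of_real_power)
  qed
  moreover have "(\<integral>\<theta>. F \<theta> * cnj (F \<theta>) \<partial>torus_measure UNIV) = of_real (\<integral>\<theta>. (norm (F \<theta>))\<^sup>2 \<partial>torus_measure UNIV)"
    by (simp flip: complex_norm_square integral_complex_of_real)
  ultimately have "((\<lambda>n. complex_of_real ((norm (a n))\<^sup>2)) has_sum of_real (\<integral>\<theta>. (norm (F \<theta>))\<^sup>2 \<partial>torus_measure UNIV)) UNIV"
    by simp
  then show "((\<lambda>n. (norm (a n))\<^sup>2) has_sum (\<integral>\<theta>. (norm (F \<theta>))\<^sup>2 \<partial>torus_measure UNIV)) UNIV"
    by (simp only: has_sum_of_real_iff)
qed

section \<open>Power series on the polydisc\<close>

lemma borel_measurable_vecI: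
  fixes F :: "'a \<Rightarrow> complex ^ 'd"
  assumes "\<And>i. (\<lambda>x. F x $ i) \<in> borel_measurable M"
  shows "F \<in> borel_measurable M"
proof (subst borel_measurable_euclidean_space, intro ballI)
  fix b :: "complex ^ 'd" assume "b \<in> Basis"
  then obtain i u where b: "b = axis i u" by (auto simp: Basis_vec_def)
  have "(\<lambda>x. F x \<bullet> b) = (\<lambda>x. F x $ i \<bullet> u)" by (simp add: b inner_axis)
  then show "(\<lambda>x. F x \<bullet> b) \<in> borel_measurable M"
    using borel_measurable_inner[OF assms[of i], of "\<lambda>_. u"] by simp
qed

lemma borel_measurable_vec_nth' [measurable]:
  "(\<lambda>z :: complex ^ 'd. z $ i) \<in> borel_measurable borel"
  by (intro borel_measurable_continuous_onI continuous_intros)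

lemma open_polydisc: "open (polydisc :: (complex ^ 'd) set)"
proof -
  have "open (\<Inter>i\<in>UNIV. {z :: complex ^ 'd. norm (z $ i) < 1})"
    by (intro open_INT ballI finite open_Collect_less continuous_intros)
  moreover have "(polydisc :: (complex ^ 'd) set) = (\<Inter>i\<in>UNIV. {z. norm (z $ i) < 1})"
    by (auto simp: polydisc_def)
  ultimately show ?thesis by simp
qed

lemma compact_polydisc_radius: "compact {z :: complex ^ 'd. \<forall>i. norm (z $ i) \<le> \<rho>}"
proof -
  have "closed {z :: complex ^ 'd. \<forall>i. norm (z $ i) \<le> \<rho>}"
    by (intro closed_Collect_all closed_Collect_le continuous_intros)
  moreover have "bounded {z :: complex ^ 'd. \<forall>i. norm (z $ i) \<le> \<rho>}"
    unfolding bounded_iff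
  proof (intro exI ballI)
    fix z :: "complex ^ 'd" assume "z \<in> {z. \<forall>i. norm (z $ i) \<le> \<rho>}"
    then show "norm z \<le> (\<Sum>i\<in>(UNIV::'d set). \<rho>)"
      unfolding norm_vec_def by (intro order.trans[OF L2_set_le_sum sum_mono]) auto
  qed
  ultimately show ?thesis by (simp add: compact_eq_bounded_closed)
qed

lemma holo_on_imp_continuous_on: "f holo_on S \<Longrightarrow> continuous_on S f"
  unfolding holo_on_def continuous_on_eq_continuous_within
  using has_derivative_continuous by blast

text \<open>Outside the polydisc the function is arbitrary, hence possibly not measurable; cutting
  it off by zero repairs this without changing the integrals taken over the polydisc.\<close>

lemma borel_measurable_holo:
  assumes "f holo_on polydisc"
  shows "(\<lambda>z. if z \<in> polydisc then f z else 0) \<in> borel_measurable borel"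
  by (rule borel_measurable_continuous_on_if)
     (use assms in \<open>auto intro: holo_on_imp_continuous_on borel_open open_polydisc\<close>)

lemma borel_measurable_holo_compose:
  assumes "f holo_on polydisc" "g \<in> borel_measurable M" "\<And>x. x \<in> space M \<Longrightarrow> g x \<in> polydisc"
  shows "(\<lambda>x. f (g x)) \<in> borel_measurable M"
proof -
  have "(\<lambda>x. if g x \<in> polydisc then f (g x) else 0) \<in> borel_measurable M"
    using measurable_compose[OF assms(2) borel_measurable_holo[OF assms(1)]] by simp
  then show ?thesis
    by (subst measurable_cong) (use assms(3) in auto)
qed

lemma polydiscI_radius: "(\<And>i. norm (z $ i) \<le> \<rho>) \<Longrightarrow> \<rho> < 1 \<Longrightarrow> z \<in> polydisc" for z :: "complex ^ 'd"
  by (simp add: polydisc_def le_less_trans[of _ \<rho>])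

lemma holo_bounded_on_radius:
  fixes f :: "complex ^ 'd \<Rightarrow> complex"
  assumes f: "f holo_on polydisc" and \<rho>: "\<rho> < 1"
  shows "\<exists>B. \<forall>w. (\<forall>i. norm (w $ i) \<le> \<rho>) \<longrightarrow> norm (f w) \<le> B"
proof -
  have "continuous_on {z :: complex ^ 'd. \<forall>i. norm (z $ i) \<le> \<rho>} f"
    by (rule continuous_on_subset[OF holo_on_imp_continuous_on[OF f]])
       (blast intro: polydiscI_radius \<rho>)
  from compact_imp_bounded[OF compact_continuous_image[OF this compact_polydisc_radius]]
  show ?thesis unfolding bounded_iff by auto
qed

text \<open>Complex linearity of the Frechet derivative makes its restriction to a coordinate axis
  multiplication by a complex number, which is a one-variable complex derivative. Coordinate j of
  \<open>p\<close> is overwritten, so only the others are constrained.\<close>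

lemma holo_slice:
  fixes f :: "complex ^ 'd \<Rightarrow> complex" and p :: "complex ^ 'd"
  assumes f: "f holo_on polydisc" and p: "\<And>i. i \<noteq> j \<Longrightarrow> norm (p $ i) < 1"
  shows "(\<lambda>w. f (\<chi> i. if i = j then w else p $ i)) holomorphic_on ball 0 1"
proof (rule holomorphic_onI)
  fix w :: complex assume w: "w \<in> ball 0 1"
  let ?s = "\<lambda>w. (\<chi> i. if i = j then w else p $ i) :: complex ^ 'd"
  have mem: "?s w \<in> polydisc" using w p by (auto simp: polydisc_def)
  from f mem have "\<exists>f'. (f has_derivative f') (at (?s w) within polydisc) \<and> (\<forall>c v. f' (c *s v) = c * f' v)"
    unfolding holo_on_def by (rule bspec)
  then obtain f' where f': "(f has_derivative f') (at (?s w))" and lin: "\<And>c v. f' (c *s v) = c * f' v"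
    unfolding at_within_open[OF mem open_polydisc] by blast
  have s_eq: "?s = (\<lambda>w. (\<chi> i. if i = j then 0 else p $ i) + axis j w)"
    by (auto simp: fun_eq_iff vec_eq_iff axis_def)
  have "bounded_linear (axis j :: complex \<Rightarrow> complex ^ 'd)"
    by (subst linear_conv_bounded_linear[symmetric], rule linearI) (auto simp: vec_eq_iff axis_def)
  then have "((\<lambda>w. (\<chi> i. if i = j then 0 else p $ i) + axis j w) has_derivative (\<lambda>h. 0 + axis j h)) (at w)"
    by (intro has_derivative_add has_derivative_const bounded_linear_imp_has_derivative)
  then have s: "(?s has_derivative axis j) (at w)" unfolding s_eq by simp
  have "f' (axis j h) = f' (axis j 1) * h" for h
  proof -
    have "axis j h = h *s (axis j 1 :: complex ^ 'd)" by (simp add: vec_eq_iff axis_def)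
    then show ?thesis by (metis lin mult.commute)
  qed
  then have "(\<lambda>h. f' (axis j h)) = (*) (f' (axis j 1))" by (rule ext)
  with has_derivative_compose[OF s f']
  have "((\<lambda>w. f (?s w)) has_field_derivative f' (axis j 1)) (at w)"
    by (simp only: has_field_derivative_def)
  from has_field_derivative_at_within[OF this]
  show "(\<lambda>w. f (?s w)) field_differentiable at w within ball 0 1"
    unfolding field_differentiable_def by (rule exI)
qed

section \<open>Cauchy's formula on the distinguished boundary\<close>

lemma has_sum_geometric:
  fixes q :: complex
  assumes "norm q < 1"
  shows "((\<lambda>k. q ^ k) has_sum 1 / (1 - q)) UNIV"
proof (rule norm_summable_imp_has_sum)
  show "summable (\<lambda>k. norm (q ^ k))"
    unfolding norm_power by (rule summable_geometric) (use assms in simp)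
  show "(\<lambda>k. q ^ k) sums (1 / (1 - q))" by (rule geometric_sums[OF assms])
qed

text \<open>Cauchy's formula with the Szego kernel against normalized angle measure, the form suited
  to product measures. Both \<open>h\<close> and the kernel are expanded: orthonormality pairs the
  coefficient a_k \<rho>^k of \<open>h\<close> with (z / \<rho>)^k from the kernel, the powers of
  \<rho> cancel, and the Taylor series of \<open>h\<close> at z is left.\<close>

lemma cauchy_angle:
  assumes h: "h holomorphic_on ball 0 1" and \<rho>: "0 < \<rho>" "\<rho> < 1" and z: "norm z < \<rho>"
  shows "(\<integral>t. h (of_real \<rho> * cis t) * (1 / (1 - z / of_real \<rho> * cnj (cis t))) \<partial>angle_measure) = h z"
proof -
  define a where "a = (\<lambda>k. (deriv ^^ k) h 0 / fact k)"
  have sums: "(\<lambda>k. a k * w ^ k) sums h w" if "norm w < 1" for w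
    using holomorphic_power_series[OF h, of w] that unfolding a_def by simp
  have abs: "summable (\<lambda>k. norm (a k * w ^ k))" if "norm w < 1" for w
  proof -
    obtain r where r: "norm w < r" "r < 1" using dense[OF \<open>norm w < 1\<close>] by blast
    then have nr: "norm (complex_of_real r) = r" using norm_ge_zero[of w] by (simp del: norm_ge_zero)
    have "summable (\<lambda>k. a k * complex_of_real r ^ k)"
      by (rule sums_summable, rule sums) (use nr r in simp)
    then show ?thesis
      by (rule powser_insidea) (use nr r in simp)
  qed
  have hs: "((\<lambda>k. a k * w ^ k) has_sum h w) UNIV" if "norm w < 1" for w
    by (rule norm_summable_imp_has_sum[OF abs[OF that] sums[OF that]])
  let ?F = "\<lambda>t. h (of_real \<rho> * cis t)"
  have mem: "norm (of_real \<rho> * cis t) < 1" for t using \<rho> by (simp add: norm_mult)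
  have contF: "continuous_on UNIV ?F"
    by (rule continuous_on_compose2[OF holomorphic_on_imp_continuous_on[OF h]])
       (use mem in \<open>auto intro!: continuous_intros\<close>)
  have [measurable]: "?F \<in> borel_measurable angle_measure"
    using borel_measurable_continuous_onI[OF contF] by simp
  let ?B = "\<lambda>k. norm (a k * of_real \<rho> ^ k)"
  have sB: "?B summable_on UNIV"
    using abs[of "of_real \<rho>"] \<rho> by (intro summable_nonneg_imp_summable_on) auto
  have F: "((\<lambda>k. a k * of_real \<rho> ^ k * cis t ^ k) has_sum ?F t) UNIV" for t
    using hs[OF mem[of t]] by (simp add: power_mult_distrib mult_ac)
  have "norm (?F t) \<le> infsum ?B UNIV" for t
    using norm_infsum_bound[of "\<lambda>k. a k * of_real \<rho> ^ k * cis t ^ k" UNIV] infsumI[OF F[of t]] sB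
    unfolding norm_mult norm_power complex_mod_cnj norm_cis by simp
  note Fbd = this
  have coeff: "(\<integral>t. ?F t * cnj (cis t) ^ m \<partial>angle_measure) = a m * of_real \<rho> ^ m" for m
  proof -
    have "((\<lambda>k. \<integral>t. a k * of_real \<rho> ^ k * cis t ^ k * cnj (cis t) ^ m \<partial>angle_measure) has_sum
       (\<integral>t. ?F t * cnj (cis t) ^ m \<partial>angle_measure)) UNIV"
      by (rule has_sum_integral[where B = ?B])
         (use sB in \<open>auto simp: prob_space_angle norm_mult norm_power intro!: has_sum_cmult_left F\<close>)
    moreover have "(\<integral>t. a k * of_real \<rho> ^ k * cis t ^ k * cnj (cis t) ^ m \<partial>angle_measure) =
       a k * of_real \<rho> ^ k * of_bool (k = m)" for k
      by (simp add: mult.assoc integral_angle_orthonormal)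
    moreover have "((\<lambda>k. a k * of_real \<rho> ^ k * of_bool (k = m)) has_sum a m * of_real \<rho> ^ m) UNIV"
      by (rule has_sum_finite_neutralI[where B = "{m}"]) auto
    ultimately show ?thesis using has_sum_unique by fastforce
  qed
  let ?q = "z / of_real \<rho>"
  have q: "norm ?q < 1" using z \<rho> by (simp add: norm_divide)
  have ker: "((\<lambda>k. ?q ^ k * cnj (cis t) ^ k) has_sum 1 / (1 - ?q * cnj (cis t))) UNIV" for t
  proof -
    have "norm (?q * cnj (cis t)) < 1" using q by (simp only: norm_mult complex_mod_cnj norm_cis)
    from has_sum_geometric[OF this] show ?thesis unfolding power_mult_distrib .
  qed
  have "(\<lambda>t. 1 / (1 - ?q * cnj (cis t))) \<in> borel_measurable angle_measure"
    by measurable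
  note [measurable] = this
  have "((\<lambda>k. \<integral>t. ?F t * (?q ^ k * cnj (cis t) ^ k) \<partial>angle_measure) has_sum
      (\<integral>t. ?F t * (1 / (1 - ?q * cnj (cis t))) \<partial>angle_measure)) UNIV"
  proof (rule has_sum_integral[where B = "\<lambda>k. infsum ?B UNIV * norm ?q ^ k"])
    show "(\<lambda>k. infsum ?B UNIV * norm ?q ^ k) summable_on UNIV"
      using q by (intro summable_on_cmult_right summable_nonneg_imp_summable_on summable_geometric) auto
    show "norm (?F t * (?q ^ k * cnj (cis t) ^ k)) \<le> infsum ?B UNIV * norm ?q ^ k" for t k
      using Fbd[of t] by (simp only: norm_mult norm_power complex_mod_cnj norm_cis) (auto intro!: mult_right_mono)
    show "((\<lambda>k. ?F t * (?q ^ k * cnj (cis t) ^ k)) has_sum ?F t * (1 / (1 - ?q * cnj (cis t)))) UNIV" for t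
      by (rule has_sum_cmult_right[OF ker])
  qed (simp_all add: prob_space_angle)
  moreover have "(\<integral>t. ?F t * (?q ^ k * cnj (cis t) ^ k) \<partial>angle_measure) = a k * z ^ k" for k
  proof -
    have "(\<integral>t. ?F t * (?q ^ k * cnj (cis t) ^ k) \<partial>angle_measure) =
       (\<integral>t. ?q ^ k * (?F t * cnj (cis t) ^ k) \<partial>angle_measure)"
      by (simp only: mult_ac)
    also have "\<dots> = ?q ^ k * (a k * of_real \<rho> ^ k)"
      by (subst Bochner_Integration.integral_mult_right_zero) (simp only: coeff)
    finally show ?thesis using \<rho> by (simp add: power_divide)
  qed
  ultimately have "((\<lambda>k. a k * z ^ k) has_sum
      (\<integral>t. ?F t * (1 / (1 - ?q * cnj (cis t))) \<partial>angle_measure)) UNIV" by simp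
  moreover have "norm z < 1" using z \<rho> by simp
  ultimately show ?thesis using has_sum_unique hs by blast
qed

lemma norm_geometric_le:
  fixes q :: complex
  assumes "norm q \<le> r" "r < 1"
  shows "norm (1 / (1 - q)) \<le> 1 / (1 - r)"
proof -
  have "1 - r \<le> norm (1 - q)" using norm_triangle_ineq2[of 1 q] assms by simp
  then show ?thesis using assms frac_le[of 1 1 "1 - r" "norm (1 - q)"] by (simp add: norm_divide)
qed

text \<open>\<open>J\<close> collects the coordinates already moved to the circle of radius \<rho>,
  while the others stay frozen at those of z. An induction step splits off one angle by Fubini and
  applies the one-variable formula to the slice in that coordinate. Only the case
  \<open>J = UNIV\<close> is wanted in the end.\<close>

lemma cauchy_torus:
  fixes f :: "complex ^ 'd \<Rightarrow> complex"
  assumes f: "f holo_on polydisc" and \<rho>: "0 < \<rho>" "\<rho> < 1" and "finite J"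
    and z: "\<And>i. norm ((z :: complex ^ 'd) $ i) < \<rho>"
  shows "(\<integral>\<theta>. f (\<chi> i. if i \<in> J then of_real \<rho> * cis (\<theta> i) else z $ i) *
     (\<Prod>j\<in>J. 1 / (1 - z $ j / of_real \<rho> * cnj (cis (\<theta> j)))) \<partial>torus_measure J) = f z"
  using \<open>finite J\<close>
proof (induction J)
  case empty
  interpret prob_space "torus_measure ({} :: 'd set)" by (rule prob_space_torus)
  show ?case using prob_space by simp
next
  case (insert j J)
  let ?mix = "\<lambda>J \<theta>. (\<chi> i. if i \<in> J then of_real \<rho> * cis (\<theta> i) else z $ i) :: complex ^ 'd"
  let ?k = "\<lambda>j t. 1 / (1 - z $ j / of_real \<rho> * cnj (cis t))"
  interpret angles: product_prob_space "\<lambda>_. angle_measure" UNIV by (rule product_prob_space_angle)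
  have mix_le: "norm (?mix J \<theta> $ i) \<le> \<rho>" for J \<theta> i
    using z[of i] \<rho> by (auto simp: norm_mult)
  have mix_mem: "?mix J \<theta> \<in> polydisc" for J \<theta>
    by (rule polydiscI_radius[OF mix_le \<rho>(2)])
  obtain B where B: "\<And>w :: complex ^ 'd. (\<And>i. norm (w $ i) \<le> \<rho>) \<Longrightarrow> norm (f w) \<le> B"
    using holo_bounded_on_radius[OF f \<rho>(2)] by blast
  have meas: "(\<lambda>\<theta>. f (?mix J \<theta>)) \<in> borel_measurable (torus_measure J)" for J
  proof (rule borel_measurable_holo_compose[OF f _ mix_mem], rule borel_measurable_vecI)
    fix i
    show "(\<lambda>\<theta>. ?mix J \<theta> $ i) \<in> borel_measurable (torus_measure J)"
    proof (cases "i \<in> J")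
      case True
      then have [measurable]: "(\<lambda>\<theta>. \<theta> i) \<in> borel_measurable (torus_measure J)"
        using measurable_component_singleton[OF True, of "\<lambda>_. borel"]
        by (simp cong: measurable_cong_sets add: sets_torus_measure)
      show ?thesis using True by simp measurable
    qed simp
  qed
  \<comment> \<open>Fubini needs joint integrability. It holds by boundedness: f is bounded on the
    closed polydisc of radius \<rho>, and each kernel factor by a geometric series, as the
    coordinates of z have modulus below \<rho>.\<close>
  have int: "integrable (Pi\<^sub>M (insert j J) (\<lambda>_. angle_measure))
     (\<lambda>\<theta>. f (?mix (insert j J) \<theta>) * (\<Prod>i\<in>insert j J. ?k i (\<theta> i)))"
  proof (fold torus_measure_def, rule integrable_boundedI)
    have *: "(\<lambda>\<theta>. \<theta> i) \<in> borel_measurable (torus_measure (insert j J))" if "i \<in> insert j J" for i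
      using measurable_component_singleton[OF that, of "\<lambda>_. borel"]
      by (simp cong: measurable_cong_sets add: sets_torus_measure)
    have "?k i \<in> borel_measurable borel" for i by measurable
    from measurable_compose[OF * this]
    show "(\<lambda>\<theta>. f (?mix (insert j J) \<theta>) * (\<Prod>i\<in>insert j J. ?k i (\<theta> i)))
        \<in> borel_measurable (torus_measure (insert j J))"
      by (intro borel_measurable_times meas borel_measurable_prod)
    show "norm (f (?mix (insert j J) \<theta>) * (\<Prod>i\<in>insert j J. ?k i (\<theta> i)))
       \<le> B * (\<Prod>i\<in>insert j J. 1 / (1 - norm (z $ i) / \<rho>))" for \<theta>
      unfolding norm_mult prod_norm[symmetric]
    proof (intro mult_mono prod_mono conjI B mix_le)
      show "norm (?k i (\<theta> i)) \<le> 1 / (1 - norm (z $ i) / \<rho>)" for i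
        by (rule norm_geometric_le) (use z \<rho> in \<open>auto simp: norm_mult norm_divide\<close>)
      show "0 \<le> B" by (rule order.trans[OF norm_ge_zero B[OF mix_le]])
    qed (auto intro!: prod_nonneg)
  qed (rule prob_space_torus)
  have "(\<integral>\<theta>. f (?mix (insert j J) \<theta>) * (\<Prod>i\<in>insert j J. ?k i (\<theta> i)) \<partial>torus_measure (insert j J)) =
     (\<integral>x. (\<integral>y. f (?mix (insert j J) (x(j := y))) * (\<Prod>i\<in>insert j J. ?k i ((x(j := y)) i)) \<partial>angle_measure)
        \<partial>torus_measure J)"
    unfolding torus_measure_def by (rule angles.product_integral_insert[OF insert.hyps int])
  also have "\<dots> = (\<integral>x. f (?mix J x) * (\<Prod>i\<in>J. ?k i (x i)) \<partial>torus_measure J)"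
  proof (rule Bochner_Integration.integral_cong[OF refl])
    fix x :: "'d \<Rightarrow> real"
    let ?s = "\<lambda>w. f (\<chi> i. if i = j then w else ?mix J x $ i)"
    have 1: "f (?mix (insert j J) (x(j := y))) = ?s (of_real \<rho> * cis y)" for y
      by (rule arg_cong[where f = f]) (auto simp: vec_eq_iff)
    have 2: "(\<Prod>i\<in>insert j J. ?k i ((x(j := y)) i)) = ?k j y * (\<Prod>i\<in>J. ?k i (x i))" for y
    proof -
      have 3: "(\<Prod>i\<in>J. ?k i ((x(j := y)) i)) = (\<Prod>i\<in>J. ?k i (x i))"
        by (rule prod.cong[OF refl]) (use insert.hyps in \<open>metis fun_upd_apply\<close>)
      show ?thesis unfolding prod.insert[OF insert.hyps] 3 fun_upd_same ..
    qed
    have "(\<integral>y. f (?mix (insert j J) (x(j := y))) * (\<Prod>i\<in>insert j J. ?k i ((x(j := y)) i)) \<partial>angle_measure)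
       = (\<integral>y. (?s (of_real \<rho> * cis y) * ?k j y) * (\<Prod>i\<in>J. ?k i (x i)) \<partial>angle_measure)"
      unfolding 1 2 by (simp only: mult.assoc)
    also have "\<dots> = (\<integral>y. ?s (of_real \<rho> * cis y) * ?k j y \<partial>angle_measure) * (\<Prod>i\<in>J. ?k i (x i))"
      by (rule Bochner_Integration.integral_mult_left_zero)
    also have "(\<integral>y. ?s (of_real \<rho> * cis y) * ?k j y \<partial>angle_measure) = ?s (z $ j)"
      by (rule cauchy_angle[OF holo_slice[OF f]])
         (rule le_less_trans[OF mix_le \<rho>(2)] \<rho> z)+
    also have "?s (z $ j) = f (?mix J x)"
      using insert.hyps by (intro arg_cong[where f = f]) (auto simp: vec_eq_iff)
    finally show "(\<integral>y. f (?mix (insert j J) (x(j := y))) * (\<Prod>i\<in>insert j J. ?k i ((x(j := y)) i)) \<partial>angle_measure)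
      = f (?mix J x) * (\<Prod>i\<in>J. ?k i (x i))" .
  qed
  also have "\<dots> = f z" by (rule insert.IH)
  finally show ?case .
qed

lemma summable_prod_geometric:
  fixes q :: "'d::finite \<Rightarrow> real"
  assumes "\<And>i. 0 \<le> q i" "\<And>i. q i < 1"
  shows "(\<lambda>n. \<Prod>i\<in>UNIV. q i ^ n i) summable_on UNIV"
proof (rule ccontr)
  assume "\<not> ?thesis"
  \<comment> \<open>\<open>infsum\<close> is 0 by convention for a family that is not summable,
    whereas the product formula, which rests on the summability of each factor, evaluates the same
    expression to a product of positive numbers.\<close>
  then have "infsum (\<lambda>n. \<Prod>i\<in>UNIV. q i ^ n i) UNIV = 0" by (rule infsum_not_exists)
  moreover have "infsum (\<lambda>n. \<Prod>i\<in>UNIV. q i ^ n i) (PiE UNIV (\<lambda>_. UNIV)) = (\<Prod>i\<in>UNIV. infsum (\<lambda>k. q i ^ k) UNIV)"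
  proof (rule infsum_prod_PiE_abs)
    show "(\<lambda>k. norm (q i ^ k)) summable_on UNIV" for i
      unfolding norm_power using assms by (intro summable_nonneg_imp_summable_on summable_geometric) auto
  qed auto
  moreover have "infsum (\<lambda>k. q i ^ k) UNIV = 1 / (1 - q i)" for i
  proof (rule infsumI, rule norm_summable_imp_has_sum)
    show "summable (\<lambda>k. norm (q i ^ k))"
      unfolding norm_power by (rule summable_geometric) (use assms in simp)
    show "(\<lambda>k. q i ^ k) sums (1 / (1 - q i))"
      by (rule geometric_sums) (use assms in simp)
  qed
  ultimately have "(\<Prod>i\<in>UNIV. 1 / (1 - q i)) = 0" by (simp add: PiE_UNIV_domain)
  then show False using assms by (auto simp: less_imp_neq)
qed

lemma has_sum_prod_geometric:
  fixes q :: "'d::finite \<Rightarrow> complex"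
  assumes "\<And>i. norm (q i) < 1"
  shows "((\<lambda>n. \<Prod>i\<in>UNIV. q i ^ n i) has_sum (\<Prod>i\<in>UNIV. 1 / (1 - q i))) UNIV"
proof -
  have "(\<lambda>n. norm (\<Prod>i\<in>UNIV. q i ^ n i)) summable_on UNIV"
    using summable_prod_geometric[of "\<lambda>i. norm (q i)"] assms by (simp add: norm_power flip: prod_norm)
  then have "(\<lambda>n. \<Prod>i\<in>UNIV. q i ^ n i) summable_on UNIV"
    by (rule abs_summable_summable)
  moreover have "infsum (\<lambda>n. \<Prod>i\<in>UNIV. q i ^ n i) (PiE UNIV (\<lambda>_. UNIV)) = (\<Prod>i\<in>UNIV. infsum (\<lambda>k. q i ^ k) UNIV)"
  proof (rule infsum_prod_PiE_abs)
    show "(\<lambda>k. norm (q i ^ k)) summable_on UNIV" for i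
      unfolding norm_power using assms by (intro summable_nonneg_imp_summable_on summable_geometric) auto
  qed auto
  moreover have "infsum (\<lambda>k. q i ^ k) UNIV = 1 / (1 - q i)" for i
    by (rule infsumI[OF has_sum_geometric[OF assms]])
  ultimately show ?thesis by (simp add: PiE_UNIV_domain has_sum_iff)
qed

section \<open>Existence and uniqueness of power series expansions\<close>

text \<open>Summation is unordered, so convergence is absolute at each point of the polydisc and no
  enumeration of the multi-indices has to be chosen.\<close>

definition has_power_series :: "(complex ^ 'd \<Rightarrow> complex) \<Rightarrow> (('d \<Rightarrow> nat) \<Rightarrow> complex) \<Rightarrow> bool" where
  "has_power_series f c \<longleftrightarrow> (\<forall>z\<in>polydisc. ((\<lambda>n. c n * zpow z n) has_sum f z) UNIV)"

lemma measurable_rot [measurable]: "(\<lambda>\<theta>. rot \<theta> z) \<in> borel_measurable (torus_measure UNIV)"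
proof (rule borel_measurable_vecI)
  fix i
  show "(\<lambda>\<theta>. rot \<theta> z $ i) \<in> borel_measurable (torus_measure UNIV)"
    unfolding rot_def by simp measurable
qed

text \<open>The coefficients are the Fourier coefficients of f on the torus of radius \<rho>,
  divided by \<rho> to the total degree. The expansion results from inserting the geometric series
  of the Cauchy kernel and integrating termwise. So far the coefficients may depend on
  \<rho>.\<close>

lemma local_power_series:
  fixes f :: "complex ^ 'd \<Rightarrow> complex"
  assumes f: "f holo_on polydisc" and \<rho>: "0 < \<rho>" "\<rho> < 1"
  shows "\<exists>c. \<forall>z :: complex ^ 'd. (\<forall>i. norm (z $ i) < \<rho>) \<longrightarrow> ((\<lambda>n. c n * zpow z n) has_sum f z) UNIV"
proof -
  let ?w = "(\<chi> i. of_real \<rho>) :: complex ^ 'd"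
  let ?F = "\<lambda>\<theta>. f (rot \<theta> ?w)"
  define c where "c n = (\<integral>\<theta>. ?F \<theta> * cnj (torus_mono n \<theta>) \<partial>torus_measure UNIV) / of_real \<rho> ^ (\<Sum>i\<in>UNIV. n i)"
    for n :: "'d \<Rightarrow> nat"
  have mem: "rot \<theta> ?w \<in> polydisc" for \<theta>
    using \<rho> by (auto simp: polydisc_def rot_def norm_mult)
  have le: "norm (rot \<theta> ?w $ i) \<le> \<rho>" for \<theta> i
    using \<rho> by (auto simp: rot_def norm_mult)
  obtain B where B: "\<And>w :: complex ^ 'd. (\<And>i. norm (w $ i) \<le> \<rho>) \<Longrightarrow> norm (f w) \<le> B"
    using holo_bounded_on_radius[OF f \<rho>(2)] by blast
  have [measurable]: "?F \<in> borel_measurable (torus_measure UNIV)"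
    by (rule borel_measurable_holo_compose[OF f measurable_rot mem])
  have "((\<lambda>n. c n * zpow z n) has_sum f z) UNIV" if z: "\<And>i. norm (z $ i) < \<rho>" for z :: "complex ^ 'd"
  proof -
    let ?q = "\<lambda>i. z $ i / of_real \<rho>"
    have q: "norm (?q i) < 1" for i using z[of i] \<rho> by (simp add: norm_divide)
    have ker: "((\<lambda>n. (\<Prod>i\<in>UNIV. ?q i ^ n i) * cnj (torus_mono n \<theta>)) has_sum
        (\<Prod>i\<in>UNIV. 1 / (1 - ?q i * cnj (cis (\<theta> i))))) UNIV" for \<theta>
    proof -
      have "norm (?q i * cnj (cis (\<theta> i))) < 1" for i
        using q[of i] by (simp only: norm_mult complex_mod_cnj norm_cis mult_1_right)
      from has_sum_prod_geometric[of "\<lambda>i. ?q i * cnj (cis (\<theta> i))", OF this] show ?thesis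
        unfolding power_mult_distrib prod.distrib torus_mono_def complex_cnj_power[symmetric] cnj_prod .
    qed
    have "((\<lambda>n. \<integral>\<theta>. ?F \<theta> * ((\<Prod>i\<in>UNIV. ?q i ^ n i) * cnj (torus_mono n \<theta>)) \<partial>torus_measure UNIV) has_sum
       (\<integral>\<theta>. ?F \<theta> * (\<Prod>i\<in>UNIV. 1 / (1 - ?q i * cnj (cis (\<theta> i)))) \<partial>torus_measure UNIV)) UNIV"
    proof (rule has_sum_integral[where B = "\<lambda>n. B * (\<Prod>i\<in>UNIV. norm (?q i) ^ n i)"])
      show "(\<lambda>n. B * (\<Prod>i\<in>UNIV. norm (?q i) ^ n i)) summable_on UNIV"
        using q by (intro summable_on_cmult_right summable_prod_geometric) auto
      show "norm (?F \<theta> * ((\<Prod>i\<in>UNIV. ?q i ^ n i) * cnj (torus_mono n \<theta>))) \<le>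
         B * (\<Prod>i\<in>UNIV. norm (?q i) ^ n i)" for n \<theta>
        using B[of "rot \<theta> ?w"] le
        by (simp only: norm_mult norm_power complex_mod_cnj norm_torus_mono prod_norm[symmetric])
           (auto intro!: mult_right_mono prod_nonneg)
      show "((\<lambda>n. ?F \<theta> * ((\<Prod>i\<in>UNIV. ?q i ^ n i) * cnj (torus_mono n \<theta>))) has_sum
         ?F \<theta> * (\<Prod>i\<in>UNIV. 1 / (1 - ?q i * cnj (cis (\<theta> i))))) UNIV" for \<theta>
        by (rule has_sum_cmult_right[OF ker])
    qed (simp_all add: prob_space_torus)
    moreover have "(\<integral>\<theta>. ?F \<theta> * ((\<Prod>i\<in>UNIV. ?q i ^ n i) * cnj (torus_mono n \<theta>)) \<partial>torus_measure UNIV)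
        = c n * zpow z n" for n
    proof -
      have "(\<integral>\<theta>. ?F \<theta> * ((\<Prod>i\<in>UNIV. ?q i ^ n i) * cnj (torus_mono n \<theta>)) \<partial>torus_measure UNIV) =
         (\<integral>\<theta>. (\<Prod>i\<in>UNIV. ?q i ^ n i) * (?F \<theta> * cnj (torus_mono n \<theta>)) \<partial>torus_measure UNIV)"
        by (simp only: mult_ac)
      also have "\<dots> = (\<Prod>i\<in>UNIV. ?q i ^ n i) * (\<integral>\<theta>. ?F \<theta> * cnj (torus_mono n \<theta>) \<partial>torus_measure UNIV)"
        by (rule Bochner_Integration.integral_mult_right_zero)
      finally have I: "(\<integral>\<theta>. ?F \<theta> * ((\<Prod>i\<in>UNIV. ?q i ^ n i) * cnj (torus_mono n \<theta>)) \<partial>torus_measure UNIV) =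
         (\<Prod>i\<in>UNIV. ?q i ^ n i) * (\<integral>\<theta>. ?F \<theta> * cnj (torus_mono n \<theta>) \<partial>torus_measure UNIV)" .
      have zq: "(\<Prod>i\<in>UNIV. ?q i ^ n i) = zpow z n / of_real \<rho> ^ (\<Sum>i\<in>UNIV. n i)"
        by (simp add: zpow_def power_divide prod_dividef power_sum)
      show ?thesis
        unfolding I unfolding zq c_def by (simp only: times_divide_eq_left times_divide_eq_right mult.commute)
    qed
    moreover have "(\<integral>\<theta>. ?F \<theta> * (\<Prod>i\<in>UNIV. 1 / (1 - ?q i * cnj (cis (\<theta> i)))) \<partial>torus_measure UNIV) = f z"
    proof -
      have "rot \<theta> ?w = (\<chi> i. if i \<in> UNIV then of_real \<rho> * cis (\<theta> i) else z $ i)" for \<theta>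
        by (simp add: rot_def vec_eq_iff mult.commute)
      then show ?thesis by (simp only:) (rule cauchy_torus[OF f \<rho> finite z])
    qed
    ultimately show ?thesis by simp
  qed
  then show ?thesis by blast
qed

text \<open>On the torus of radius \<rho> / 2 both series are Fourier series of the same function,
  and the coefficients are recovered by integration.\<close>

lemma power_series_coeff_unique:
  fixes f :: "complex ^ 'd \<Rightarrow> complex"
  assumes \<rho>: "0 < \<rho>"
    and c: "\<And>z :: complex ^ 'd. (\<forall>i. norm (z $ i) < \<rho>) \<Longrightarrow> ((\<lambda>n. c n * zpow z n) has_sum f z) UNIV"
    and c': "\<And>z :: complex ^ 'd. (\<forall>i. norm (z $ i) < \<rho>) \<Longrightarrow> ((\<lambda>n. c' n * zpow z n) has_sum f z) UNIV"
  shows "c = c'"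
proof
  fix m
  let ?w = "(\<chi> i. of_real (\<rho> / 2)) :: complex ^ 'd"
  have zw: "zpow ?w n = of_real (\<rho> / 2) ^ (\<Sum>i\<in>UNIV. n i)" for n
    by (simp add: zpow_def power_sum)
  have w: "\<forall>i. norm (rot \<theta> ?w $ i) < \<rho>" for \<theta>
    using \<rho> by (simp add: rot_def norm_mult)
  have 1: "((\<lambda>n. (c n * zpow ?w n) * torus_mono n \<theta>) has_sum f (rot \<theta> ?w)) UNIV"
      "((\<lambda>n. (c' n * zpow ?w n) * torus_mono n \<theta>) has_sum f (rot \<theta> ?w)) UNIV" for \<theta>
    using c[OF w[of \<theta>]] c'[OF w[of \<theta>]] unfolding zpow_rot by (simp_all only: mult_ac)
  \<comment> \<open>Measurability comes from the expansion itself: enumerating the multi-indices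
    exhibits the function as the pointwise limit of a sequence of trigonometric polynomials.\<close>
  have meas: "(\<lambda>\<theta>. f (rot \<theta> ?w)) \<in> borel_measurable (torus_measure UNIV)"
  proof -
    let ?e = "from_nat_into (UNIV :: ('d \<Rightarrow> nat) set)"
    have inf: "infinite (UNIV :: ('d \<Rightarrow> nat) set)"
      by (simp add: finite_UNIV_fun)
    have bij: "bij_betw ?e UNIV UNIV" by (rule bij_betw_from_nat_into) (use inf in auto)
    have "(\<lambda>k. (c (?e k) * zpow ?w (?e k)) * torus_mono (?e k) \<theta>) sums f (rot \<theta> ?w)" for \<theta>
      by (rule has_sum_imp_sums) (rule has_sum_reindex_bij_betw[OF bij, THEN iffD2, OF 1(1)])
    then have "(\<lambda>N. \<Sum>k<N. (c (?e k) * zpow ?w (?e k)) * torus_mono (?e k) \<theta>) \<longlonglongrightarrow> f (rot \<theta> ?w)" for \<theta>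
      unfolding sums_def .
    then show ?thesis
      by (rule borel_measurable_LIMSEQ_metric[rotated]) measurable
  qed
  have "c m * zpow ?w m = c' m * zpow ?w m"
    using torus_parseval(3)[OF 1(1) meas, of m] torus_parseval(3)[OF 1(2) meas, of m] by (rule trans[OF sym])
  moreover have "zpow ?w m \<noteq> 0" unfolding zw using \<rho> by simp
  ultimately show "c m = c' m" by simp
qed

text \<open>The expansions for different radii agree, because two of them represent f on the smaller
  polydisc. Hence the coefficients for the arbitrary radius 1/2 serve everywhere: a point z is
  covered by a radius midway between its largest coordinate modulus and 1.\<close>

lemma holo_has_power_series:
  fixes f :: "complex ^ 'd \<Rightarrow> complex"
  assumes f: "f holo_on polydisc"
  shows "\<exists>c. has_power_series f c"
proof -
  define c where "c \<rho> = (SOME c. \<forall>z :: complex ^ 'd. (\<forall>i. norm (z $ i) < \<rho>) \<longrightarrow> ((\<lambda>n. c n * zpow z n) has_sum f z) UNIV)" for \<rho>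
  have c: "((\<lambda>n. c \<rho> n * zpow z n) has_sum f z) UNIV" if "0 < \<rho>" "\<rho> < 1" "\<forall>i. norm (z $ i) < \<rho>" for \<rho> and z :: "complex ^ 'd"
    using someI_ex[OF local_power_series[OF f that(1,2)]] that(3) unfolding c_def by blast
  have eq: "c \<rho> = c (1 / 2)" if "0 < \<rho>" "\<rho> < 1" for \<rho>
    by (rule power_series_coeff_unique[where f = f and \<rho> = "min \<rho> (1 / 2)"])
       (use that in \<open>auto intro!: c\<close>)
  have "((\<lambda>n. c (1 / 2) n * zpow z n) has_sum f z) UNIV" if z: "z \<in> polydisc" for z
  proof -
    let ?M = "Max (range (\<lambda>i. norm (z $ i)))"
    have "?M \<in> range (\<lambda>i. norm (z $ i))" by (rule Max_in) auto
    then obtain i where "?M = norm (z $ i)" by blast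
    then have M: "0 \<le> ?M" "?M < 1" using z by (simp_all add: polydisc_def)
    have le: "norm (z $ i) \<le> ?M" for i by (rule Max_ge) auto
    let ?\<rho> = "(?M + 1) / 2"
    have \<rho>: "0 < ?\<rho>" "?\<rho> < 1" "?M < ?\<rho>" using M by auto
    have "\<forall>i. norm (z $ i) < ?\<rho>" using le_less_trans[OF le \<rho>(3)] by blast
    from c[OF \<rho>(1,2) this] eq[OF \<rho>(1,2)] show ?thesis by simp
  qed
  then show ?thesis unfolding has_power_series_def by blast
qed

lemma has_power_series_unique:
  assumes "has_power_series f c" "has_power_series f c'"
  shows "c = c'"
  by (rule power_series_coeff_unique[where f = f and \<rho> = 1])
     (use assms in \<open>auto simp: has_power_series_def polydisc_def\<close>)

section \<open>Matrices between weighted sequence spaces\<close>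

text \<open>The coefficient type is general because the same convolution acts on complex
  coefficients and on real weights. The truncated subtraction is exact, since p lies below
  m.\<close>

definition cauchy_prod :: "(('d \<Rightarrow> nat) \<Rightarrow> 'b::comm_semiring_0) \<Rightarrow> (('d \<Rightarrow> nat) \<Rightarrow> 'b) \<Rightarrow> ('d \<Rightarrow> nat) \<Rightarrow> 'b" where
  "cauchy_prod a b m = (\<Sum>p\<in>{p. p \<le> m}. a p * b (\<lambda>i. m i - p i))"

lemma below_eq_PiE: "{p. p \<le> m} = (PiE UNIV (\<lambda>i. {..m i}) :: ('d \<Rightarrow> nat) set)"
  by (auto simp: le_fun_def PiE_UNIV_domain)

lemma finite_below: "finite {p. p \<le> (m :: 'd::finite \<Rightarrow> nat)}"
  unfolding below_eq_PiE by (rule finite_PiE) auto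

section \<open>Convolution squares of the weights\<close>

definition wt :: "('d::finite \<Rightarrow> nat) \<Rightarrow> real" where
  "wt n = (\<Prod>i\<in>UNIV. real (n i + 1))"

lemma wt_pos: "0 < wt n"
  unfolding wt_def by (intro prod_pos) auto

lemma wt_powr: "wt n powr s = (\<Prod>i\<in>UNIV. real (n i + 1) powr s)"
  unfolding wt_def by (rule prod_powr_distrib)

lemma powr_twice_plus_one: "0 < x \<Longrightarrow> x powr (2 * s + 1) = x * (x powr s * x powr s)" for x s :: real
proof -
  assume "0 < x"
  have "2 * s + 1 = 1 + (s + s)" by simp
  then show ?thesis using \<open>0 < x\<close> by (simp only: powr_add powr_one)
qed

text \<open>There are m + 1 summands, each at most (m + 1)^(2s); this count is the origin of the
  exponent 2s + 1.\<close>

lemma power_conv_upper: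
  fixes s :: real
  assumes "0 \<le> s"
  shows "(\<Sum>p\<le>m. real (p + 1) powr s * real (m - p + 1) powr s) \<le> real (m + 1) powr (2 * s + 1)"
proof -
  have "real (p + 1) powr s * real (m - p + 1) powr s \<le> real (m + 1) powr s * real (m + 1) powr s"
    if "p \<le> m" for p
    using that assms by (intro mult_mono powr_mono2) auto
  then have "(\<Sum>p\<le>m. real (p + 1) powr s * real (m - p + 1) powr s)
     \<le> (\<Sum>p\<le>m. real (m + 1) powr s * real (m + 1) powr s)"
    by (intro sum_mono) simp
  also have "\<dots> = real (m + 1) powr (2 * s + 1)"
    by (subst powr_twice_plus_one) simp_all
  finally show ?thesis .
qed

text \<open>Only the indices p between about m/4 and m/2 are kept. For them both p + 1 and m - p + 1
  are at least (m + 1)/4, and there are at least (m + 1)/4 of them, which gives ((m + 1)/4)^(2s +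
  1).\<close>

lemma power_conv_lower:
  fixes s :: real
  assumes "0 \<le> s"
  shows "(1 / 4) powr (2 * s + 1) * real (m + 1) powr (2 * s + 1)
     \<le> (\<Sum>p\<le>m. real (p + 1) powr s * real (m - p + 1) powr s)"
proof -
  define k where "k = m div 2"
  define q where "q = k div 2"
  have k: "2 * k \<le> m" "m \<le> 2 * k + 1" and q: "2 * q \<le> k" "k \<le> 2 * q + 1"
    unfolding k_def q_def by linarith+
  have "(1 / 4) powr (2 * s + 1) * real (m + 1) powr (2 * s + 1) = (real (m + 1) / 4) powr (2 * s + 1)"
    using powr_mult[of "1 / 4" "real (m + 1)" "2 * s + 1"] by simp
  also have "\<dots> = (real (m + 1) / 4) * ((real (m + 1) / 4) powr s * (real (m + 1) / 4) powr s)"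
    by (rule powr_twice_plus_one) simp
  also have "\<dots> \<le> real (card {q..k}) * ((real (m + 1) / 4) powr s * (real (m + 1) / 4) powr s)"
  proof (rule mult_right_mono)
    have "m + 1 \<le> 4 * (Suc k - q)" using k q by simp
    then show "real (m + 1) / 4 \<le> real (card {q..k})" by simp
  qed simp
  also have "\<dots> = (\<Sum>p\<in>{q..k}. (real (m + 1) / 4) powr s * (real (m + 1) / 4) powr s)"
    by simp
  also have "\<dots> \<le> (\<Sum>p\<in>{q..k}. real (p + 1) powr s * real (m - p + 1) powr s)"
  proof (intro sum_mono mult_mono powr_mono2)
    fix p assume p: "p \<in> {q..k}"
    have "m + 1 \<le> 4 * (q + 1)" using k q by simp
    then show "real (m + 1) / 4 \<le> real (p + 1)" using p by simp
    have "m + 1 \<le> 4 * (m - k + 1)" using k by simp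
    moreover have "m - k \<le> m - p" using p by (intro diff_le_mono2) simp
    then have "4 * (m - k + 1) \<le> 4 * (m - p + 1)" by (intro mult_le_mono2 add_le_mono1)
    ultimately have "m + 1 \<le> 4 * (m - p + 1)" by (rule order.trans)
    then have "real (m + 1) / 4 \<le> real (4 * (m - p + 1)) / 4"
      by (intro divide_right_mono) (simp_all only: of_nat_le_iff zero_le_numeral)
    also have "\<dots> = real (m - p + 1)" unfolding of_nat_mult by simp
    finally show "real (m + 1) / 4 \<le> real (m - p + 1)" .
  qed (use assms in auto)
  also have "\<dots> \<le> (\<Sum>p\<le>m. real (p + 1) powr s * real (m - p + 1) powr s)"
    by (rule sum_mono2) (use k in auto)
  finally show ?thesis .
qed

text \<open>The weights are products over the coordinates and the box below m is a product set, so
  the convolution factorizes into one-variable convolutions.\<close>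

lemma cauchy_prod_wt_powr:
  "cauchy_prod (\<lambda>n. wt n powr s) (\<lambda>n. wt n powr s) m =
     (\<Prod>i\<in>UNIV. \<Sum>p\<le>m i. real (p + 1) powr s * real (m i - p + 1) powr s)"
proof -
  have "(\<Prod>i\<in>UNIV. \<Sum>p\<le>m i. real (p + 1) powr s * real (m i - p + 1) powr s) =
    (\<Sum>g\<in>PiE UNIV (\<lambda>i. {..m i}). \<Prod>i\<in>UNIV. real (g i + 1) powr s * real (m i - g i + 1) powr s)"
    by (rule prod_sum_PiE) auto
  then show ?thesis
    by (simp add: cauchy_prod_def wt_powr below_eq_PiE prod.distrib)
qed

text \<open>This and the matching lower bound express in coefficients that squaring a kernel doubles
  its exponent. The upper bound will control the target of the operator, the lower bound its
  source.\<close>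

lemma cauchy_prod_wt_upper:
  assumes "0 \<le> s"
  shows "cauchy_prod (\<lambda>n. wt n powr s) (\<lambda>n. wt n powr s) m \<le> wt m powr (2 * s + 1)"
  unfolding cauchy_prod_wt_powr unfolding wt_powr
  by (intro prod_mono conjI power_conv_upper sum_nonneg assms) auto

lemma cauchy_prod_wt_lower:
  fixes m :: "'d::finite \<Rightarrow> nat"
  assumes "0 \<le> s"
  shows "((1 / 4) powr (2 * s + 1)) ^ CARD('d) * wt m powr (2 * s + 1)
     \<le> cauchy_prod (\<lambda>n. wt n powr s) (\<lambda>n. wt n powr s) m"
proof -
  have "((1 / 4) powr (2 * s + 1)) ^ CARD('d) * wt m powr (2 * s + 1) =
     (\<Prod>i\<in>(UNIV :: 'd set). (1 / 4) powr (2 * s + 1) * real (m i + 1) powr (2 * s + 1))"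
    by (simp only: wt_powr prod.distrib prod_constant)
  also have "\<dots> \<le> cauchy_prod (\<lambda>n. wt n powr s) (\<lambda>n. wt n powr s) m"
    unfolding cauchy_prod_wt_powr by (intro prod_mono conjI power_conv_lower assms) auto
  finally show ?thesis .
qed

text \<open>With the monomials as basis, the norm of \<open>A\<^sup>2\<^sub>\<beta>\<close> is equivalent to the weighted \<open>l\<^sup>2\<close> norm with
  weight \<open>wt n powr - (\<beta> + 1)\<close>, also for \<open>\<beta> = -1\<close>; the parameters \<open>s, \<sigma>\<close> below stand for
  \<open>\<beta>\<^sub>1 + 1, \<beta>\<^sub>2 + 1\<close>. The column \<open>t n\<close> is the image of the \<open>n\<close>-th monomial.\<close>

definition matrix_bounded :: "(('d::finite \<Rightarrow> nat) \<Rightarrow> ('d \<Rightarrow> nat) \<Rightarrow> complex) \<Rightarrow> real \<Rightarrow> real \<Rightarrow> bool" where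
  "matrix_bounded t s \<sigma> \<longleftrightarrow> (\<exists>C\<ge>0. \<forall>F G x. finite F \<longrightarrow> finite G \<longrightarrow>
     (\<Sum>m\<in>G. (norm (\<Sum>n\<in>F. x n * t n m))\<^sup>2 * wt m powr - \<sigma>)
       \<le> C * (\<Sum>n\<in>F. (norm (x n))\<^sup>2 * wt n powr - s))"

text \<open>Cauchy-Schwarz with a free weight. It is applied with a product of two weights, so that
  the first factor becomes a convolution.\<close>

lemma norm_sum_sq_weighted:
  fixes y :: "'a \<Rightarrow> complex" and w :: "'a \<Rightarrow> real"
  assumes w: "\<And>p. p \<in> P \<Longrightarrow> 0 < w p"
  shows "(norm (\<Sum>p\<in>P. y p))\<^sup>2 \<le> (\<Sum>p\<in>P. w p) * (\<Sum>p\<in>P. (norm (y p))\<^sup>2 / w p)"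
proof -
  have "norm (\<Sum>p\<in>P. y p) \<le> (\<Sum>p\<in>P. sqrt (w p) * (norm (y p) / sqrt (w p)))"
  proof (rule order.trans[OF norm_sum sum_mono])
    fix p assume "p \<in> P"
    from w[OF this] show "norm (y p) \<le> sqrt (w p) * (norm (y p) / sqrt (w p))" by simp
  qed
  then have "(norm (\<Sum>p\<in>P. y p))\<^sup>2 \<le> (\<Sum>p\<in>P. sqrt (w p) * (norm (y p) / sqrt (w p)))\<^sup>2"
    by (rule power_mono) simp
  also have "\<dots> \<le> (\<Sum>p\<in>P. (sqrt (w p))\<^sup>2) * (\<Sum>p\<in>P. (norm (y p) / sqrt (w p))\<^sup>2)"
    by (rule Cauchy_Schwarz_ineq_sum)
  also have "(\<Sum>p\<in>P. (sqrt (w p))\<^sup>2) = (\<Sum>p\<in>P. w p)"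
    by (rule sum.cong[OF refl]) (use w in \<open>simp add: less_imp_le\<close>)
  also have "(\<Sum>p\<in>P. (norm (y p) / sqrt (w p))\<^sup>2) = (\<Sum>p\<in>P. (norm (y p))\<^sup>2 / w p)"
    by (rule sum.cong[OF refl]) (use w in \<open>simp add: less_imp_le power_divide\<close>)
  finally show ?thesis .
qed

text \<open>The weighted space with parameter \<open>2s + 1\<close> in \<open>d\<close> variables consists of the restrictions to
  the diagonal of the functions in the space with parameter \<open>s\<close> in \<open>2d\<close> variables. The coefficients
  \<open>X\<close> are an extension off the diagonal of controlled norm, the operator acts on each of the two
  groups of variables separately, and \<open>t (a + b) = t a * t b\<close> says that this is compatible with
  restriction.\<close>

lemma matrix_bounded_double:
  fixes t :: "('d::finite \<Rightarrow> nat) \<Rightarrow> ('d \<Rightarrow> nat) \<Rightarrow> complex"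
  assumes mult: "\<And>a b. t (\<lambda>i. a i + b i) = cauchy_prod (t a) (t b)"
    and mb: "matrix_bounded t s \<sigma>" and s: "0 \<le> s" and \<sigma>: "0 \<le> \<sigma>"
  shows "matrix_bounded t (2 * s + 1) (2 * \<sigma> + 1)"
proof -
  obtain C where C: "0 \<le> C" and bound: "\<And>F G x. finite F \<Longrightarrow> finite G \<Longrightarrow>
     (\<Sum>m\<in>G. (norm (\<Sum>n\<in>F. x n * t n m))\<^sup>2 * wt m powr - \<sigma>)
       \<le> C * (\<Sum>n\<in>F. (norm (x n))\<^sup>2 * wt n powr - s)"
    using mb unfolding matrix_bounded_def by blast
  \<comment> \<open>\<open>\<kappa>\<close> is the reciprocal of the source weight, up to constants
    the coefficient sequence of the kernel; its convolution square \<open>K\<close> is that of the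
    squared kernel.\<close>
  define \<kappa> where "\<kappa> n = wt n powr s" for n :: "'d \<Rightarrow> nat"
  define K where "K = cauchy_prod \<kappa> \<kappa>"
  define c where "c = ((1 / 4) powr (2 * s + 1)) ^ CARD('d)"
  have c: "0 < c" by (simp add: c_def)
  have \<kappa>: "0 < \<kappa> n" for n using wt_pos[of n] by (simp add: \<kappa>_def)
  have K_lower: "c * wt n powr (2 * s + 1) \<le> K n" for n
    unfolding c_def K_def \<kappa>_def[abs_def] by (rule cauchy_prod_wt_lower[OF s])
  have K: "0 < K n" for n
    by (rule less_le_trans[OF _ K_lower]) (use c wt_pos[of n] in simp)
  let ?sub = "\<lambda>m p :: 'd \<Rightarrow> nat. (\<lambda>i. m i - p i)"
  let ?add = "\<lambda>p q :: 'd \<Rightarrow> nat. (\<lambda>i. p i + q i)"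
  have add_sub: "?add p (?sub m p) = m" if "p \<le> m" for m p
    using that by (auto simp: le_fun_def)
  have sub_add: "?sub (?add p q) p = q" "p \<le> ?add p q" for p q
    by (auto simp: le_fun_def)
  have sub_le: "?sub m p \<le> m" for m p by (auto simp: le_fun_def)
  show ?thesis unfolding matrix_bounded_def
  proof (intro exI[of _ "C\<^sup>2 / c"] conjI allI impI)
    show "0 \<le> C\<^sup>2 / c" using c by simp
    fix F G :: "('d \<Rightarrow> nat) set" and x :: "('d \<Rightarrow> nat) \<Rightarrow> complex"
    assume F: "finite F" and G: "finite G"
    \<comment> \<open>\<open>A\<close> and \<open>P\<close> contain every index that occurs as a
      summand of an index in \<open>F\<close> or in \<open>G\<close>. They are finite, so the
      assumed bound applies to sums over them.\<close>
    define A where "A = (\<Union>n\<in>F. {p. p \<le> n})"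
    define P where "P = (\<Union>m\<in>G. {p. p \<le> m})"
    have finA: "finite A" and finP: "finite P"
      using F G by (simp_all add: A_def P_def finite_below)
    have inA: "a \<in> A" "?sub n a \<in> A" if "n \<in> F" "a \<le> n" for n a
      using that sub_le unfolding A_def by blast+
    have inP: "a \<in> P" "?sub n a \<in> P" if "n \<in> G" "a \<le> n" for n a
      using that sub_le unfolding P_def by blast+
    \<comment> \<open>The entry x n is distributed over all pairs with a + b = n in proportion to
      \<open>\<kappa> a * \<kappa> b\<close>. The shares add up to x n by the definition of
      \<open>K\<close>, and this choice minimizes the sum of
      \<open>(norm (X a b))\<^sup>2 / (\<kappa> a * \<kappa> b)\<close>, with minimum
      \<open>(norm (x n))\<^sup>2 / K n\<close>.\<close>
    define X where "X a b = (if ?add a b \<in> F then x (?add a b) * of_real (\<kappa> a * \<kappa> b / K (?add a b)) else 0)" for a b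
    \<comment> \<open>The matrix is applied to \<open>X\<close> in both groups of variables, the
      first one innermost.\<close>
    define Y where "Y p q = (\<Sum>b\<in>A. (\<Sum>a\<in>A. X a b * t a p) * t b q)" for p q
    have reindex: "(\<Sum>n\<in>F. \<Sum>a\<in>{a. a \<le> n}. h a (?sub n a)) = (\<Sum>a\<in>A. \<Sum>b\<in>A. if ?add a b \<in> F then h a b else 0)"
      for h :: "('d \<Rightarrow> nat) \<Rightarrow> ('d \<Rightarrow> nat) \<Rightarrow> 'b::comm_monoid_add"
    proof -
      have "(\<Sum>n\<in>F. \<Sum>a\<in>{a. a \<le> n}. h a (?sub n a)) = (\<Sum>(n, a)\<in>Sigma F (\<lambda>n. {a. a \<le> n}). h a (?sub n a))"
        by (rule sum.Sigma) (auto simp: F finite_below)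
      also have "\<dots> = (\<Sum>(a, b)\<in>{(a, b)\<in>A \<times> A. ?add a b \<in> F}. h a b)"
        by (rule sum.reindex_bij_witness[where i = "\<lambda>(a, b). (?add a b, a)" and j = "\<lambda>(n, a). (a, ?sub n a)"])
           (auto simp: add_sub sub_add inA)
      also have "\<dots> = (\<Sum>(a, b)\<in>A \<times> A. if ?add a b \<in> F then h a b else 0)"
        by (rule sum.mono_neutral_cong_left) (auto simp: finA split: if_splits)
      also have "\<dots> = (\<Sum>a\<in>A. \<Sum>b\<in>A. if ?add a b \<in> F then h a b else 0)"
        by (rule sum.cartesian_product[symmetric])
      finally show ?thesis .
    qed
    \<comment> \<open>Summing \<open>Y\<close> over the pairs with sum m is restriction to the
      diagonal. That it reproduces the m-th entry of the image of \<open>x\<close> is where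
      multiplicativity of the columns enters: the column of n is the convolution of those of a and n
      - a for every a below n.\<close>
    have y_eq: "(\<Sum>n\<in>F. x n * t n m) = (\<Sum>p\<in>{p. p \<le> m}. Y p (?sub m p))" for m
    proof -
      have "x n * t n m = (\<Sum>a\<in>{a. a \<le> n}. (x n * of_real (\<kappa> a * \<kappa> (?sub n a) / K n)) * cauchy_prod (t a) (t (?sub n a)) m)" for n
      proof -
        have "(\<Sum>a\<in>{a. a \<le> n}. (x n * of_real (\<kappa> a * \<kappa> (?sub n a) / K n)) * cauchy_prod (t a) (t (?sub n a)) m)
          = (\<Sum>a\<in>{a. a \<le> n}. (x n * t n m) * of_real (\<kappa> a * \<kappa> (?sub n a) / K n))"
          by (rule sum.cong[OF refl]) (simp add: add_sub mult_ac flip: mult)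
        also have "\<dots> = (x n * t n m) * of_real ((\<Sum>a\<in>{a. a \<le> n}. \<kappa> a * \<kappa> (?sub n a)) / K n)"
          by (simp only: sum_distrib_left[symmetric] of_real_sum sum_divide_distrib)
        also have "(\<Sum>a\<in>{a. a \<le> n}. \<kappa> a * \<kappa> (?sub n a)) / K n = 1"
          using K[of n] by (simp add: K_def cauchy_prod_def)
        finally show ?thesis by simp
      qed
      then have "(\<Sum>n\<in>F. x n * t n m) =
        (\<Sum>n\<in>F. \<Sum>a\<in>{a. a \<le> n}. (\<lambda>a b. (x (?add a b) * of_real (\<kappa> a * \<kappa> b / K (?add a b))) * cauchy_prod (t a) (t b) m) a (?sub n a))"
        by (intro sum.cong refl) (simp add: add_sub)
      also have "\<dots> = (\<Sum>a\<in>A. \<Sum>b\<in>A. X a b * cauchy_prod (t a) (t b) m)"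
        unfolding reindex[of "\<lambda>a b. (x (?add a b) * of_real (\<kappa> a * \<kappa> b / K (?add a b))) * cauchy_prod (t a) (t b) m"]
        by (intro sum.cong refl) (simp add: X_def)
      also have "\<dots> = (\<Sum>a\<in>A. \<Sum>b\<in>A. \<Sum>p\<in>{p. p \<le> m}. X a b * t a p * t b (?sub m p))"
        by (simp add: cauchy_prod_def sum_distrib_left mult.assoc)
      also have "\<dots> = (\<Sum>p\<in>{p. p \<le> m}. \<Sum>a\<in>A. \<Sum>b\<in>A. X a b * t a p * t b (?sub m p))"
        by (subst sum.swap[of _ _ A], subst sum.swap, rule refl)
      also have "\<dots> = (\<Sum>p\<in>{p. p \<le> m}. Y p (?sub m p))"
        unfolding Y_def by (subst sum.swap) (simp add: sum_distrib_right)
      finally show ?thesis .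
    qed
    let ?wl = "\<lambda>p. wt p powr \<sigma>"
    have wl: "0 < ?wl p" for p :: "'d \<Rightarrow> nat" using wt_pos[of p] by simp
    have "(\<Sum>m\<in>G. (norm (\<Sum>n\<in>F. x n * t n m))\<^sup>2 * wt m powr - (2 * \<sigma> + 1))
       \<le> (\<Sum>m\<in>G. \<Sum>p\<in>{p. p \<le> m}. (norm (Y p (?sub m p)))\<^sup>2 / (?wl p * ?wl (?sub m p)))"
    proof (rule sum_mono)
      fix m
      let ?S = "\<Sum>p\<in>{p. p \<le> m}. (norm (Y p (?sub m p)))\<^sup>2 / (?wl p * ?wl (?sub m p))"
      \<comment> \<open>With the reciprocal target weights as Cauchy-Schwarz weights, the first
        factor is their convolution square, at most \<open>wt m powr (2 * \<sigma> + 1)\<close>. So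
        restriction to the diagonal is a contraction.\<close>
      have "(norm (\<Sum>n\<in>F. x n * t n m))\<^sup>2 \<le> (\<Sum>p\<in>{p. p \<le> m}. ?wl p * ?wl (?sub m p)) * ?S"
        unfolding y_eq by (rule norm_sum_sq_weighted) (intro mult_pos_pos wl)
      also have "\<dots> \<le> wt m powr (2 * \<sigma> + 1) * ?S"
        using cauchy_prod_wt_upper[OF \<sigma>, of m] unfolding cauchy_prod_def
        by (rule mult_right_mono) (intro sum_nonneg divide_nonneg_nonneg mult_nonneg_nonneg, auto)
      finally show "(norm (\<Sum>n\<in>F. x n * t n m))\<^sup>2 * wt m powr - (2 * \<sigma> + 1) \<le> ?S"
        unfolding powr_minus divide_inverse[symmetric] using wt_pos[of m]
        by (subst pos_divide_le_eq) (simp, simp only: mult.commute)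
    qed
    also have "\<dots> = (\<Sum>(m, p)\<in>Sigma G (\<lambda>m. {p. p \<le> m}). (norm (Y p (?sub m p)))\<^sup>2 / (?wl p * ?wl (?sub m p)))"
      by (rule sum.Sigma) (auto simp: G finite_below)
    also have "\<dots> = (\<Sum>(p, q)\<in>{(p, q)\<in>P \<times> P. ?add p q \<in> G}. (norm (Y p q))\<^sup>2 / (?wl p * ?wl q))"
      by (rule sum.reindex_bij_witness[where i = "\<lambda>(a, b). (?add a b, a)" and j = "\<lambda>(n, a). (a, ?sub n a)"])
         (auto simp: add_sub sub_add inP)
    also have "\<dots> \<le> (\<Sum>(p, q)\<in>P \<times> P. (norm (Y p q))\<^sup>2 / (?wl p * ?wl q))"
      by (rule sum_mono2) (auto simp: finP)
    also have "\<dots> = (\<Sum>p\<in>P. \<Sum>q\<in>P. (norm (Y p q))\<^sup>2 / (?wl p * ?wl q))"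
      by (rule sum.cartesian_product[symmetric])
    also have "\<dots> = (\<Sum>p\<in>P. (\<Sum>q\<in>P. (norm (\<Sum>b\<in>A. (\<Sum>a\<in>A. X a b * t a p) * t b q))\<^sup>2 * wt q powr - \<sigma>) * wt p powr - \<sigma>)"
    proof -
      have "r / (?wl p * ?wl q) = r * wt q powr - \<sigma> * wt p powr - \<sigma>" for r and p q :: "'d \<Rightarrow> nat"
        by (simp only: powr_minus divide_inverse inverse_mult_distrib mult_ac)
      then have "(\<Sum>p\<in>P. \<Sum>q\<in>P. (norm (Y p q))\<^sup>2 / (?wl p * ?wl q)) =
          (\<Sum>p\<in>P. (\<Sum>q\<in>P. (norm (Y p q))\<^sup>2 * wt q powr - \<sigma>) * wt p powr - \<sigma>)"
        by (simp only: sum_distrib_right)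
      then show ?thesis unfolding Y_def .
    qed
    \<comment> \<open>The assumed bound is used in the second variable with p fixed, and after
      exchanging the sums in the first variable with b fixed. Each use costs a factor
      \<open>C\<close>.\<close>
    also have "\<dots> \<le> (\<Sum>p\<in>P. (C * (\<Sum>b\<in>A. (norm (\<Sum>a\<in>A. X a b * t a p))\<^sup>2 * wt b powr - s)) * wt p powr - \<sigma>)"
      by (intro sum_mono mult_right_mono bound finA finP) auto
    also have "\<dots> = C * (\<Sum>b\<in>A. (\<Sum>p\<in>P. (norm (\<Sum>a\<in>A. X a b * t a p))\<^sup>2 * wt p powr - \<sigma>) * wt b powr - s)"
      unfolding sum_distrib_left sum_distrib_right by (subst sum.swap) (simp add: mult_ac)
    also have "\<dots> \<le> C * (\<Sum>b\<in>A. (C * (\<Sum>a\<in>A. (norm (X a b))\<^sup>2 * wt a powr - s)) * wt b powr - s)"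
      by (intro mult_left_mono sum_mono mult_right_mono bound finA finP C) auto
    also have "\<dots> = C\<^sup>2 * (\<Sum>a\<in>A. \<Sum>b\<in>A. (norm (X a b))\<^sup>2 / (\<kappa> a * \<kappa> b))"
      unfolding sum_distrib_left sum_distrib_right
      by (subst sum.swap) (simp add: \<kappa>_def powr_minus field_simps power2_eq_square)
    also have "(\<Sum>a\<in>A. \<Sum>b\<in>A. (norm (X a b))\<^sup>2 / (\<kappa> a * \<kappa> b)) =
       (\<Sum>a\<in>A. \<Sum>b\<in>A. if ?add a b \<in> F then (norm (x (?add a b)))\<^sup>2 * (\<kappa> a * \<kappa> b) / (K (?add a b))\<^sup>2 else 0)"
    proof (intro sum.cong refl)
      fix a b
      have "\<kappa> a \<noteq> 0" "\<kappa> b \<noteq> 0" using \<kappa>[of a] \<kappa>[of b] by auto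
      then show "(norm (X a b))\<^sup>2 / (\<kappa> a * \<kappa> b) =
        (if ?add a b \<in> F then (norm (x (?add a b)))\<^sup>2 * (\<kappa> a * \<kappa> b) / (K (?add a b))\<^sup>2 else 0)"
        by (simp add: X_def norm_mult norm_divide power_mult_distrib power_divide power2_eq_square abs_of_pos[OF \<kappa>])
    qed
    also have "\<dots> = (\<Sum>n\<in>F. \<Sum>a\<in>{a. a \<le> n}. (\<lambda>a b. (norm (x (?add a b)))\<^sup>2 * (\<kappa> a * \<kappa> b) / (K (?add a b))\<^sup>2) a (?sub n a))"
      by (rule reindex[symmetric])
    also have "\<dots> = (\<Sum>n\<in>F. (norm (x n))\<^sup>2 / K n)"
    proof (rule sum.cong[OF refl])
      fix n
      have "(\<Sum>a\<in>{a. a \<le> n}. (\<lambda>a b. (norm (x (?add a b)))\<^sup>2 * (\<kappa> a * \<kappa> b) / (K (?add a b))\<^sup>2) a (?sub n a))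
        = (\<Sum>a\<in>{a. a \<le> n}. (norm (x n))\<^sup>2 / (K n)\<^sup>2 * (\<kappa> a * \<kappa> (?sub n a)))"
        by (rule sum.cong[OF refl]) (simp add: add_sub)
      also have "\<dots> = (norm (x n))\<^sup>2 / (K n)\<^sup>2 * K n"
        by (simp only: sum_distrib_left[symmetric] K_def cauchy_prod_def)
      finally show "(\<Sum>a\<in>{a. a \<le> n}. (\<lambda>a b. (norm (x (?add a b)))\<^sup>2 * (\<kappa> a * \<kappa> b) / (K (?add a b))\<^sup>2) a (?sub n a))
        = (norm (x n))\<^sup>2 / K n"
        using K[of n] by (simp add: power2_eq_square)
    qed
    \<comment> \<open>Only here is the size of \<open>K\<close> needed, and it has to be bounded
      from below; this is the source of the factor 1 / c.\<close>
    also have "C\<^sup>2 * (\<Sum>n\<in>F. (norm (x n))\<^sup>2 / K n) \<le>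
        C\<^sup>2 * (\<Sum>n\<in>F. (norm (x n))\<^sup>2 / (c * wt n powr (2 * s + 1)))"
      by (intro mult_left_mono sum_mono divide_left_mono K_lower mult_pos_pos K c) (simp_all add: less_imp_neq[OF wt_pos, symmetric])
    also have "\<dots> = C\<^sup>2 / c * (\<Sum>n\<in>F. (norm (x n))\<^sup>2 * wt n powr - (2 * s + 1))"
      unfolding sum_distrib_left
      by (rule sum.cong[OF refl]) (simp only: powr_minus divide_inverse inverse_mult_distrib mult_ac)
    finally show "(\<Sum>m\<in>G. (norm (\<Sum>n\<in>F. x n * t n m))\<^sup>2 * wt m powr - (2 * \<sigma> + 1))
       \<le> C\<^sup>2 / c * (\<Sum>n\<in>F. (norm (x n))\<^sup>2 * wt n powr - (2 * s + 1))" .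
  qed
qed

section \<open>Quadratic interpolation between weighted sequence spaces\<close>

text \<open>Squared norms of optimal splittings \<open>a = a\<^sub>0 + a\<^sub>1\<close>: the minimum of
  \<open>u \<bar>a\<^sub>0\<bar>\<^sup>2 + \<tau> v \<bar>a\<^sub>1\<bar>\<^sup>2\<close> is \<open>split_weight \<tau> u v \<bar>a\<bar>\<^sup>2\<close>.\<close>

definition split_weight :: "real \<Rightarrow> real \<Rightarrow> real \<Rightarrow> real" where
  "split_weight \<tau> u v = \<tau> * u * v / (u + \<tau> * v)"

lemma split_weight_le:
  fixes a b :: complex
  assumes "0 < \<tau>" "0 < u" "0 < v"
  shows "split_weight \<tau> u v * (norm (a + b))\<^sup>2 \<le> u * (norm a)\<^sup>2 + \<tau> * (v * (norm b)\<^sup>2)"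
proof -
  have d: "0 < u + \<tau> * v" using assms by (intro add_pos_pos mult_pos_pos)
  have "(norm (a + b))\<^sup>2 \<le> (norm a + norm b)\<^sup>2"
    by (intro power_mono norm_triangle_ineq) simp
  then have "\<tau> * u * v * (norm (a + b))\<^sup>2 \<le> \<tau> * u * v * (norm a + norm b)\<^sup>2"
    using assms by (intro mult_left_mono) auto
  also have "\<dots> \<le> (u * (norm a)\<^sup>2 + \<tau> * (v * (norm b)\<^sup>2)) * (u + \<tau> * v)"
  proof -
    have "(u * (norm a)\<^sup>2 + \<tau> * (v * (norm b)\<^sup>2)) * (u + \<tau> * v) - \<tau> * u * v * (norm a + norm b)\<^sup>2
       = (u * norm a - \<tau> * v * norm b)\<^sup>2"
      by (simp add: algebra_simps power2_eq_square)
    then show ?thesis using zero_le_power2[of "u * norm a - \<tau> * v * norm b"] by linarith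
  qed
  finally show ?thesis using d by (simp add: split_weight_def divide_le_eq)
qed

text \<open>The two shares satisfy u a_0 = \<tau> v a_1. This makes the square u |a_0| - \<tau> v
  |a_1|, which measures the loss in the general inequality, vanish.\<close>

lemma split_weight_attained:
  fixes a :: complex
  assumes "0 < \<tau>" "0 < u" "0 < v"
  shows "u * (norm (of_real (\<tau> * v / (u + \<tau> * v)) * a))\<^sup>2
       + \<tau> * (v * (norm (of_real (u / (u + \<tau> * v)) * a))\<^sup>2) = split_weight \<tau> u v * (norm a)\<^sup>2"
    and "of_real (\<tau> * v / (u + \<tau> * v)) * a + of_real (u / (u + \<tau> * v)) * a = a"
proof -
  define d where "d = u + \<tau> * v"
  have d: "0 < d" unfolding d_def using assms by (intro add_pos_pos mult_pos_pos)
  have "u * (\<tau> * v / d)\<^sup>2 + \<tau> * (v * (u / d)\<^sup>2) = (\<tau> * u * v) * d / d\<^sup>2"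
    unfolding power_divide by (simp add: d_def power2_eq_square add_divide_distrib[symmetric] algebra_simps)
  also have "\<dots> = split_weight \<tau> u v"
    using d by (simp add: split_weight_def d_def[symmetric] power2_eq_square)
  finally have 1: "u * (\<tau> * v / d)\<^sup>2 + \<tau> * (v * (u / d)\<^sup>2) = split_weight \<tau> u v" .
  show "u * (norm (of_real (\<tau> * v / (u + \<tau> * v)) * a))\<^sup>2
       + \<tau> * (v * (norm (of_real (u / (u + \<tau> * v)) * a))\<^sup>2) = split_weight \<tau> u v * (norm a)\<^sup>2"
    unfolding 1[symmetric] d_def[symmetric] norm_mult norm_of_real power_mult_distrib power2_abs
    by (simp only: distrib_right mult.assoc)
  have "\<tau> * v / d + u / d = 1" using d by (simp add: d_def add_divide_distrib[symmetric] add.commute)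
  then show "of_real (\<tau> * v / (u + \<tau> * v)) * a + of_real (u / (u + \<tau> * v)) * a = a"
    unfolding d_def[symmetric] distrib_right[symmetric] of_real_add[symmetric] by simp
qed

text \<open>Up to a constant this is the geometric mean u^(1 - \<theta>) v^\<theta>. For u = v = 1
  and 0 < \<theta> < 1 it equals \<pi> / sin (\<pi> \<theta>), but only its being nonzero and finite
  matters, since it cancels from both sides of an inequality.\<close>

definition interp_integral :: "real \<Rightarrow> real \<Rightarrow> real \<Rightarrow> ennreal" where
  "interp_integral \<theta> u v = (\<integral>\<^sup>+\<tau>. ennreal (indicator {0<..} \<tau> * (\<tau> powr (- \<theta> - 1) * split_weight \<tau> u v)) \<partial>lborel)"

text \<open>The substitution of (u / v) \<tau> for \<tau> turns the split weight into u \<tau> / (1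
  + \<tau>), so u and v leave the integral as powers.\<close>

lemma interp_integral_scale:
  assumes u: "0 < u" and v: "0 < v"
  shows "interp_integral \<theta> u v = ennreal (u powr (1 - \<theta>) * v powr \<theta>) * interp_integral \<theta> 1 1"
proof -
  let ?c = "u / v"
  have c: "0 < ?c" using u v by simp
  have "interp_integral \<theta> u v = ennreal \<bar>?c\<bar> * (\<integral>\<^sup>+\<tau>. ennreal (indicator {0<..} (0 + ?c * \<tau>) *
     ((0 + ?c * \<tau>) powr (- \<theta> - 1) * split_weight (0 + ?c * \<tau>) u v)) \<partial>lborel)"
    unfolding interp_integral_def split_weight_def
    by (rule nn_integral_real_affine) (use c in auto)
  also have "\<dots> = (\<integral>\<^sup>+\<tau>. ennreal \<bar>?c\<bar> * ennreal (indicator {0<..} (0 + ?c * \<tau>) *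
     ((0 + ?c * \<tau>) powr (- \<theta> - 1) * split_weight (0 + ?c * \<tau>) u v)) \<partial>lborel)"
    unfolding split_weight_def by (rule nn_integral_cmult[symmetric]) measurable
  also have "\<dots> = (\<integral>\<^sup>+\<tau>. ennreal (u powr (1 - \<theta>) * v powr \<theta>) *
      ennreal (indicator {0<..} \<tau> * (\<tau> powr (- \<theta> - 1) * split_weight \<tau> 1 1)) \<partial>lborel)"
  proof (rule nn_integral_cong)
    fix \<tau> :: real
    show "ennreal \<bar>?c\<bar> * ennreal (indicator {0<..} (0 + ?c * \<tau>) *
       ((0 + ?c * \<tau>) powr (- \<theta> - 1) * split_weight (0 + ?c * \<tau>) u v)) =
      ennreal (u powr (1 - \<theta>) * v powr \<theta>) *
      ennreal (indicator {0<..} \<tau> * (\<tau> powr (- \<theta> - 1) * split_weight \<tau> 1 1))"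
    proof (cases "0 < \<tau>")
      case True
      have pos: "0 < ?c * \<tau>" using c True by (rule mult_pos_pos)
      have sw: "split_weight (?c * \<tau>) u v = u * split_weight \<tau> 1 1"
      proof -
        have "split_weight (?c * \<tau>) u v = (u * u * \<tau>) / (u * (1 + \<tau>))"
          unfolding split_weight_def using v by (simp add: algebra_simps)
        also have "\<dots> = u * split_weight \<tau> 1 1" using u by (simp add: split_weight_def)
        finally show ?thesis .
      qed
      have "?c * (?c * \<tau>) powr (- \<theta> - 1) * u = (?c powr 1 * ?c powr (- \<theta> - 1)) * u * \<tau> powr (- \<theta> - 1)"
        unfolding powr_mult powr_one[OF less_imp_le[OF c]] by (simp only: mult_ac)
      also have "?c powr 1 * ?c powr (- \<theta> - 1) = ?c powr - \<theta>"
        by (simp only: powr_add[symmetric]) simp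
      also have "?c powr - \<theta> * u = u powr (1 - \<theta>) * v powr \<theta>"
      proof -
        have "?c powr - \<theta> = u powr - \<theta> * v powr \<theta>"
          using u v by (simp add: powr_divide powr_minus divide_simps)
        moreover have "u powr - \<theta> * u = u powr (1 - \<theta>)"
          using u powr_add[of u "- \<theta>" 1] by simp
        ultimately show ?thesis by (simp add: mult_ac)
      qed
      finally have eq: "?c * (?c * \<tau>) powr (- \<theta> - 1) * u = u powr (1 - \<theta>) * v powr \<theta> * \<tau> powr (- \<theta> - 1)" .
      have sw0: "0 \<le> split_weight \<tau> 1 1" using True by (simp add: split_weight_def)
      have "ennreal \<bar>?c\<bar> * ennreal (indicator {0<..} (0 + ?c * \<tau>) *
         ((0 + ?c * \<tau>) powr (- \<theta> - 1) * split_weight (0 + ?c * \<tau>) u v)) =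
         ennreal ((?c * (?c * \<tau>) powr (- \<theta> - 1) * u) * split_weight \<tau> 1 1)"
      proof -
        have ind: "indicator {0<..} (?c * \<tau>) = (1::real)" using pos by simp
        have "0 \<le> (?c * \<tau>) powr (- \<theta> - 1) * (u * split_weight \<tau> 1 1)"
          using u sw0 by simp
        from ennreal_mult[OF less_imp_le[OF c] this] show ?thesis
          unfolding add_0_left ind sw mult_1_left abs_of_pos[OF c] by (simp only: mult.assoc)
      qed
      also have "\<dots> = ennreal (u powr (1 - \<theta>) * v powr \<theta>) *
        ennreal (indicator {0<..} \<tau> * (\<tau> powr (- \<theta> - 1) * split_weight \<tau> 1 1))"
        unfolding eq using True sw0 by (subst ennreal_mult[symmetric]) (simp_all add: mult_ac)
      finally show ?thesis .
    next
      case False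
      then have "\<not> 0 < ?c * \<tau>" using zero_less_mult_pos[OF _ c] by blast
      then show ?thesis using False by (simp only: greaterThan_iff indicator_simps add_0_left) simp
    qed
  qed
  also have "\<dots> = ennreal (u powr (1 - \<theta>) * v powr \<theta>) * interp_integral \<theta> 1 1"
    unfolding interp_integral_def split_weight_def by (rule nn_integral_cmult) measurable
  finally show ?thesis .
qed

lemma interp_integral_pos: "interp_integral \<theta> 1 1 \<noteq> 0"
proof
  assume "interp_integral \<theta> 1 1 = 0"
  then have "AE \<tau> in lborel. ennreal (indicator {0<..} \<tau> * (\<tau> powr (- \<theta> - 1) * split_weight \<tau> 1 1)) = 0"
    unfolding interp_integral_def split_weight_def by (subst (asm) nn_integral_0_iff_AE) measurable
  then have "AE \<tau> in lborel. (\<tau> :: real) \<notin> {0<..<1}"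
  proof eventually_elim
    case (elim \<tau>)
    show ?case
    proof
      assume "\<tau> \<in> {0<..<1}"
      then have "0 < indicator {0<..} \<tau> * (\<tau> powr (- \<theta> - 1) * split_weight \<tau> 1 1)"
        by (simp add: split_weight_def)
      with elim show False by (simp add: ennreal_eq_0_iff)
    qed
  qed
  then have "emeasure lborel {0<..<1::real} = 0"
    by (subst (asm) AE_iff_measurable[of "{0<..<1}"]) auto
  then show False by simp
qed

text \<open>The integrand is at most \<tau>^(-\<theta>) on (0, 1] and at most \<tau>^(-\<theta> - 1)
  beyond 1. The first is integrable because \<theta> < 1, the second because \<theta> > 0.\<close>

lemma interp_integral_finite:
  assumes \<theta>: "0 < \<theta>" "\<theta> < 1"
  shows "interp_integral \<theta> 1 1 < \<infinity>"
proof -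
  have "((\<lambda>x. x powr - \<theta>) has_integral (1 powr (- \<theta> + 1) / (- \<theta> + 1))) {0..1}"
    by (rule has_integral_powr_from_0) (use \<theta> in auto)
  then have 1: "(\<integral>\<^sup>+\<tau>. ennreal (\<tau> powr - \<theta>) * indicator {0..1} \<tau> \<partial>lborel) = ennreal (1 powr (- \<theta> + 1) / (- \<theta> + 1))"
    by (intro nn_integral_has_integral_lebesgue') auto
  have "((\<lambda>x. x powr (- \<theta> - 1)) has_integral - (1 powr (- \<theta> - 1 + 1)) / (- \<theta> - 1 + 1)) {1..}"
    by (rule has_integral_powr_to_inf) (use \<theta> in auto)
  then have 2: "(\<integral>\<^sup>+\<tau>. ennreal (\<tau> powr (- \<theta> - 1)) * indicator {1..} \<tau> \<partial>lborel)
      = ennreal (- (1 powr (- \<theta> - 1 + 1)) / (- \<theta> - 1 + 1))"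
    by (intro nn_integral_has_integral_lebesgue') auto
  have "interp_integral \<theta> 1 1 \<le> (\<integral>\<^sup>+\<tau>. ennreal (\<tau> powr - \<theta>) * indicator {0..1} \<tau>
       + ennreal (\<tau> powr (- \<theta> - 1)) * indicator {1..} \<tau> \<partial>lborel)"
    unfolding interp_integral_def
  proof (rule nn_integral_mono)
    fix \<tau> :: real
    consider "\<tau> \<le> 0" | "0 < \<tau>" "\<tau> \<le> 1" | "1 < \<tau>" by linarith
    then show "ennreal (indicator {0<..} \<tau> * (\<tau> powr (- \<theta> - 1) * split_weight \<tau> 1 1)) \<le>
       ennreal (\<tau> powr - \<theta>) * indicator {0..1} \<tau> + ennreal (\<tau> powr (- \<theta> - 1)) * indicator {1..} \<tau>"
    proof cases
      case 2
      have "\<tau> powr - \<theta> = \<tau> powr (- \<theta> - 1) * \<tau>"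
        using 2 powr_add[of \<tau> "- \<theta> - 1" 1] by simp
      moreover have "split_weight \<tau> 1 1 \<le> \<tau>"
        using 2 by (simp add: split_weight_def divide_le_eq)
      ultimately have "\<tau> powr (- \<theta> - 1) * split_weight \<tau> 1 1 \<le> \<tau> powr - \<theta>"
        by (simp add: mult_left_mono)
      then have "ennreal (indicator {0<..} \<tau> * (\<tau> powr (- \<theta> - 1) * split_weight \<tau> 1 1)) \<le> ennreal (\<tau> powr - \<theta>) * indicator {0..1} \<tau>"
        using 2 by (simp add: ennreal_leI)
      then show ?thesis by (rule order.trans) simp
    next
      case 3
      have "split_weight \<tau> 1 1 \<le> 1"
        using 3 by (simp add: split_weight_def)
      then have "\<tau> powr (- \<theta> - 1) * split_weight \<tau> 1 1 \<le> \<tau> powr (- \<theta> - 1) * 1"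
        by (rule mult_left_mono) simp
      then have "ennreal (indicator {0<..} \<tau> * (\<tau> powr (- \<theta> - 1) * split_weight \<tau> 1 1)) \<le> ennreal (\<tau> powr (- \<theta> - 1)) * indicator {1..} \<tau>"
        using 3 by (simp add: ennreal_leI)
      then show ?thesis by (rule order.trans) simp
    qed simp
  qed
  also have "\<dots> = (\<integral>\<^sup>+\<tau>. ennreal (\<tau> powr - \<theta>) * indicator {0..1} \<tau> \<partial>lborel) +
      (\<integral>\<^sup>+\<tau>. ennreal (\<tau> powr (- \<theta> - 1)) * indicator {1..} \<tau> \<partial>lborel)"
    by (rule nn_integral_add) measurable
  also have "\<dots> < \<infinity>" unfolding 1 2 by simp
  finally show ?thesis .
qed

lemma interp_integral_sum:
  assumes "finite G" "\<And>m. m \<in> G \<Longrightarrow> 0 < u m" "\<And>m. m \<in> G \<Longrightarrow> 0 < v m" "\<And>m. m \<in> G \<Longrightarrow> 0 \<le> a m"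
  shows "(\<integral>\<^sup>+\<tau>. ennreal (indicator {0<..} \<tau> * (\<tau> powr (- \<theta> - 1) * (\<Sum>m\<in>G. split_weight \<tau> (u m) (v m) * a m))) \<partial>lborel)
     = ennreal (\<Sum>m\<in>G. a m * (u m powr (1 - \<theta>) * v m powr \<theta>)) * interp_integral \<theta> 1 1"
proof -
  have sw: "0 \<le> indicator {0<..} \<tau> * (\<tau> powr (- \<theta> - 1) * split_weight \<tau> (u m) (v m))" if "m \<in> G" for \<tau> :: real and m
    using assms(2,3)[OF that] by (cases "0 < \<tau>") (auto simp: split_weight_def)
  have "(\<integral>\<^sup>+\<tau>. ennreal (indicator {0<..} \<tau> * (\<tau> powr (- \<theta> - 1) * (\<Sum>m\<in>G. split_weight \<tau> (u m) (v m) * a m))) \<partial>lborel)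
    = (\<integral>\<^sup>+\<tau>. (\<Sum>m\<in>G. ennreal (a m) * ennreal (indicator {0<..} \<tau> * (\<tau> powr (- \<theta> - 1) * split_weight \<tau> (u m) (v m)))) \<partial>lborel)"
  proof (rule nn_integral_cong)
    fix \<tau> :: real
    have "ennreal (indicator {0<..} \<tau> * (\<tau> powr (- \<theta> - 1) * (\<Sum>m\<in>G. split_weight \<tau> (u m) (v m) * a m))) =
       ennreal (\<Sum>m\<in>G. a m * (indicator {0<..} \<tau> * (\<tau> powr (- \<theta> - 1) * split_weight \<tau> (u m) (v m))))"
      by (simp only: sum_distrib_left mult_ac)
    also have "\<dots> = (\<Sum>m\<in>G. ennreal (a m * (indicator {0<..} \<tau> * (\<tau> powr (- \<theta> - 1) * split_weight \<tau> (u m) (v m)))))"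
      by (rule sum_ennreal[symmetric]) (intro mult_nonneg_nonneg assms(4) sw, assumption+)
    also have "\<dots> = (\<Sum>m\<in>G. ennreal (a m) * ennreal (indicator {0<..} \<tau> * (\<tau> powr (- \<theta> - 1) * split_weight \<tau> (u m) (v m))))"
      by (intro sum.cong refl ennreal_mult assms(4) sw)
    finally show "ennreal (indicator {0<..} \<tau> * (\<tau> powr (- \<theta> - 1) * (\<Sum>m\<in>G. split_weight \<tau> (u m) (v m) * a m))) =
      (\<Sum>m\<in>G. ennreal (a m) * ennreal (indicator {0<..} \<tau> * (\<tau> powr (- \<theta> - 1) * split_weight \<tau> (u m) (v m))))" .
  qed
  also have "\<dots> = (\<Sum>m\<in>G. \<integral>\<^sup>+\<tau>. ennreal (a m) * ennreal (indicator {0<..} \<tau> * (\<tau> powr (- \<theta> - 1) * split_weight \<tau> (u m) (v m))) \<partial>lborel)"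
    unfolding split_weight_def by (rule nn_integral_sum) measurable
  also have "\<dots> = (\<Sum>m\<in>G. ennreal (a m) * interp_integral \<theta> (u m) (v m))"
    unfolding interp_integral_def split_weight_def by (intro sum.cong refl nn_integral_cmult) measurable
  also have "\<dots> = (\<Sum>m\<in>G. ennreal (a m * (u m powr (1 - \<theta>) * v m powr \<theta>)) * interp_integral \<theta> 1 1)"
  proof (rule sum.cong[OF refl])
    fix m assume m: "m \<in> G"
    have "0 \<le> u m powr (1 - \<theta>) * v m powr \<theta>" by simp
    from ennreal_mult[OF assms(4)[OF m] this]
    show "ennreal (a m) * interp_integral \<theta> (u m) (v m) =
        ennreal (a m * (u m powr (1 - \<theta>) * v m powr \<theta>)) * interp_integral \<theta> 1 1"
      unfolding interp_integral_scale[OF assms(2,3)[OF m]] by (simp only: mult.assoc)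
  qed
  also have "\<dots> = ennreal (\<Sum>m\<in>G. a m * (u m powr (1 - \<theta>) * v m powr \<theta>)) * interp_integral \<theta> 1 1"
    unfolding sum_distrib_right[symmetric] by (subst sum_ennreal) (use assms(4) in auto)
  finally show ?thesis .
qed

text \<open>Interpolation by the quadratic K-method: for each \<open>\<tau>\<close> split the source optimally between the
  two endpoint spaces, then integrate the resulting inequality over \<open>\<tau>\<close>.\<close>

lemma matrix_bounded_interpolate:
  fixes t :: "('d::finite \<Rightarrow> nat) \<Rightarrow> ('d \<Rightarrow> nat) \<Rightarrow> complex"
  assumes "matrix_bounded t s0 \<sigma>0" "matrix_bounded t s1 \<sigma>1" and \<theta>: "0 < \<theta>" "\<theta> < 1"
  shows "matrix_bounded t ((1 - \<theta>) * s0 + \<theta> * s1) ((1 - \<theta>) * \<sigma>0 + \<theta> * \<sigma>1)"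
proof -
  obtain C0 where C0: "0 \<le> C0" and b0: "\<And>F G x. finite F \<Longrightarrow> finite G \<Longrightarrow>
     (\<Sum>m\<in>G. (norm (\<Sum>n\<in>F. x n * t n m))\<^sup>2 * wt m powr - \<sigma>0)
       \<le> C0 * (\<Sum>n\<in>F. (norm (x n))\<^sup>2 * wt n powr - s0)"
    using assms(1) unfolding matrix_bounded_def by blast
  obtain C1 where C1: "0 \<le> C1" and b1: "\<And>F G x. finite F \<Longrightarrow> finite G \<Longrightarrow>
     (\<Sum>m\<in>G. (norm (\<Sum>n\<in>F. x n * t n m))\<^sup>2 * wt m powr - \<sigma>1)
       \<le> C1 * (\<Sum>n\<in>F. (norm (x n))\<^sup>2 * wt n powr - s1)"
    using assms(2) unfolding matrix_bounded_def by blast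
  define C where "C = max C0 C1"
  have C: "0 \<le> C" "C0 \<le> C" "C1 \<le> C" using C0 by (auto simp: C_def)
  show ?thesis unfolding matrix_bounded_def
  proof (intro exI[of _ C] conjI allI impI C(1))
    fix F G :: "('d \<Rightarrow> nat) set" and x :: "('d \<Rightarrow> nat) \<Rightarrow> complex"
    assume F: "finite F" and G: "finite G"
    let ?y = "\<lambda>x m. \<Sum>n\<in>F. x n * t n m"
    let ?u0 = "\<lambda>n :: 'd \<Rightarrow> nat. wt n powr - s0" and ?u1 = "\<lambda>n :: 'd \<Rightarrow> nat. wt n powr - s1"
    let ?v0 = "\<lambda>n :: 'd \<Rightarrow> nat. wt n powr - \<sigma>0" and ?v1 = "\<lambda>n :: 'd \<Rightarrow> nat. wt n powr - \<sigma>1"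
    have pos: "0 < wt n powr r" for n :: "'d \<Rightarrow> nat" and r using wt_pos[of n] by simp
    have key: "(\<Sum>m\<in>G. split_weight \<tau> (?v0 m) (?v1 m) * (norm (?y x m))\<^sup>2)
        \<le> C * (\<Sum>n\<in>F. split_weight \<tau> (?u0 n) (?u1 n) * (norm (x n))\<^sup>2)" if \<tau>: "0 < \<tau>" for \<tau>
    proof -
      \<comment> \<open>The source is split optimally, entry by entry. The induced splitting of the
        image need not be optimal, which is harmless because the target side only needs an upper
        bound.\<close>
      define x0 where "x0 n = of_real (\<tau> * ?u1 n / (?u0 n + \<tau> * ?u1 n)) * x n" for n
      define x1 where "x1 n = of_real (?u0 n / (?u0 n + \<tau> * ?u1 n)) * x n" for n
      have x: "x0 n + x1 n = x n" for n
        unfolding x0_def x1_def by (rule split_weight_attained(2)[OF \<tau> pos pos])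
      have "?y x m = ?y x0 m + ?y x1 m" for m
        unfolding sum.distrib[symmetric] distrib_right[symmetric] x ..
      then have "(\<Sum>m\<in>G. split_weight \<tau> (?v0 m) (?v1 m) * (norm (?y x m))\<^sup>2) \<le>
         (\<Sum>m\<in>G. ?v0 m * (norm (?y x0 m))\<^sup>2 + \<tau> * (?v1 m * (norm (?y x1 m))\<^sup>2))"
        by (simp only:) (intro sum_mono split_weight_le \<tau> pos)
      also have "\<dots> = (\<Sum>m\<in>G. (norm (?y x0 m))\<^sup>2 * ?v0 m) + \<tau> * (\<Sum>m\<in>G. (norm (?y x1 m))\<^sup>2 * ?v1 m)"
        by (simp only: sum.distrib sum_distrib_left mult_ac)
      also have "\<dots> \<le> C0 * (\<Sum>n\<in>F. (norm (x0 n))\<^sup>2 * ?u0 n) + \<tau> * (C1 * (\<Sum>n\<in>F. (norm (x1 n))\<^sup>2 * ?u1 n))"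
        by (intro add_mono mult_left_mono b0 b1 F G less_imp_le[OF \<tau>])
      also have "\<dots> \<le> C * (\<Sum>n\<in>F. (norm (x0 n))\<^sup>2 * ?u0 n) + \<tau> * (C * (\<Sum>n\<in>F. (norm (x1 n))\<^sup>2 * ?u1 n))"
        by (intro add_mono mult_left_mono mult_right_mono C sum_nonneg mult_nonneg_nonneg less_imp_le[OF \<tau>] less_imp_le[OF pos] zero_le_power2)
      also have "\<dots> = C * (\<Sum>n\<in>F. ?u0 n * (norm (x0 n))\<^sup>2 + \<tau> * (?u1 n * (norm (x1 n))\<^sup>2))"
        by (simp only: sum.distrib sum_distrib_left distrib_left mult_ac)
      also have "(\<Sum>n\<in>F. ?u0 n * (norm (x0 n))\<^sup>2 + \<tau> * (?u1 n * (norm (x1 n))\<^sup>2)) =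
          (\<Sum>n\<in>F. split_weight \<tau> (?u0 n) (?u1 n) * (norm (x n))\<^sup>2)"
        unfolding x0_def x1_def by (intro sum.cong refl split_weight_attained(1) \<tau> pos)
      finally show ?thesis .
    qed
    have pp: "(wt n powr - a) powr (1 - \<theta>) * (wt n powr - b) powr \<theta> = wt n powr - ((1 - \<theta>) * a + \<theta> * b)"
      for n :: "'d \<Rightarrow> nat" and a b
      by (simp add: powr_powr powr_add[symmetric] algebra_simps)
    let ?I = "interp_integral \<theta> 1 1"
    let ?L = "\<Sum>m\<in>G. (norm (?y x m))\<^sup>2 * wt m powr - ((1 - \<theta>) * \<sigma>0 + \<theta> * \<sigma>1)"
    let ?R = "\<Sum>n\<in>F. (norm (x n))\<^sup>2 * wt n powr - ((1 - \<theta>) * s0 + \<theta> * s1)"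
    have "ennreal ?L * ?I = (\<integral>\<^sup>+\<tau>. ennreal (indicator {0<..} \<tau> * (\<tau> powr (- \<theta> - 1) *
         (\<Sum>m\<in>G. split_weight \<tau> (?v0 m) (?v1 m) * (norm (?y x m))\<^sup>2))) \<partial>lborel)"
      by (subst interp_integral_sum) (simp_all only: G pos pp zero_le_power2)
    also have "\<dots> \<le> (\<integral>\<^sup>+\<tau>. ennreal (C * (indicator {0<..} \<tau> * (\<tau> powr (- \<theta> - 1) *
         (\<Sum>n\<in>F. split_weight \<tau> (?u0 n) (?u1 n) * (norm (x n))\<^sup>2)))) \<partial>lborel)"
    proof (rule nn_integral_mono, rule ennreal_leI)
      fix \<tau> :: real
      show "indicator {0<..} \<tau> * (\<tau> powr (- \<theta> - 1) * (\<Sum>m\<in>G. split_weight \<tau> (?v0 m) (?v1 m) * (norm (?y x m))\<^sup>2))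
        \<le> C * (indicator {0<..} \<tau> * (\<tau> powr (- \<theta> - 1) * (\<Sum>n\<in>F. split_weight \<tau> (?u0 n) (?u1 n) * (norm (x n))\<^sup>2)))"
      proof (cases "0 < \<tau>")
        case True
        from mult_left_mono[OF key[OF this] powr_ge_zero[of \<tau> "- \<theta> - 1"]] True
        show ?thesis by (simp add: mult.left_commute)
      qed simp
    qed
    also have "\<dots> = (\<integral>\<^sup>+\<tau>. ennreal C * ennreal (indicator {0<..} \<tau> * (\<tau> powr (- \<theta> - 1) *
         (\<Sum>n\<in>F. split_weight \<tau> (?u0 n) (?u1 n) * (norm (x n))\<^sup>2))) \<partial>lborel)"
      by (simp only: ennreal_mult'[OF C(1)])
    also have "\<dots> = ennreal C * (\<integral>\<^sup>+\<tau>. ennreal (indicator {0<..} \<tau> * (\<tau> powr (- \<theta> - 1) *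
         (\<Sum>n\<in>F. split_weight \<tau> (?u0 n) (?u1 n) * (norm (x n))\<^sup>2))) \<partial>lborel)"
      unfolding split_weight_def by (rule nn_integral_cmult) measurable
    also have "\<dots> = ennreal C * (ennreal ?R * ?I)"
      by (subst interp_integral_sum) (simp_all only: F pos pp zero_le_power2)
    also have "\<dots> = ennreal (C * ?R) * ?I"
      by (simp only: ennreal_mult'[OF C(1)] mult.assoc)
    finally have le: "?I * ennreal ?L \<le> ?I * ennreal (C * ?R)" by (simp only: mult.commute)
    \<comment> \<open>Cancelling the common factor in the extended reals requires it to be neither
      zero nor infinite.\<close>
    have "ennreal ?L \<le> ennreal (C * ?R)"
      using le interp_integral_pos interp_integral_finite[OF \<theta>]
      by (subst (asm) ennreal_mult_le_mult_iff) (auto simp: less_top)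
    moreover have "0 \<le> C * ?R"
      by (intro mult_nonneg_nonneg sum_nonneg C(1)) auto
    ultimately show "?L \<le> C * ?R" by (simp only: ennreal_le_iff)
  qed
qed

theorem matrix_bounded_extrapolate:
  fixes t :: "('d::finite \<Rightarrow> nat) \<Rightarrow> ('d \<Rightarrow> nat) \<Rightarrow> complex"
  assumes mult: "\<And>a b. t (\<lambda>i. a i + b i) = cauchy_prod (t a) (t b)"
    and mb: "matrix_bounded t s \<sigma>" and s: "0 \<le> s" "0 \<le> \<sigma>" and s': "s < s'"
  shows "matrix_bounded t s' ((\<sigma> + 1) / (s + 1) * (s' + 1) - 1)"
proof -
  have iter: "matrix_bounded t (2 ^ k * (s + 1) - 1) (2 ^ k * (\<sigma> + 1) - 1)" for k :: nat
  proof (induction k)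
    case 0
    then show ?case using mb by simp
  next
    case (Suc k)
    \<comment> \<open>Doubling asks for nonnegative exponents, and these persist along the iteration
      because s + 1 and \<sigma> + 1 are at least 1.\<close>
    have "1 \<le> (2::real) ^ k" by simp
    then have "1 * 1 \<le> 2 ^ k * (r + 1)" if "0 \<le> r" for r :: real
      using that by (intro mult_mono) auto
    from this[OF s(1)] this[OF s(2)]
    have "matrix_bounded t (2 * (2 ^ k * (s + 1) - 1) + 1) (2 * (2 ^ k * (\<sigma> + 1) - 1) + 1)"
      by (intro matrix_bounded_double[OF mult Suc.IH]) auto
    then show ?case by (simp add: algebra_simps)
  qed
  \<comment> \<open>Since s + 1 is at least 1, this k takes the iteration beyond s', so that s'
    becomes a proper convex combination of the start and the k-th point.\<close>
  obtain k :: nat where k: "s' + 1 < 2 ^ k"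
    using real_arch_pow[of 2 "s' + 1"] by auto
  define S where "S = 2 ^ k * (s + 1) - 1"
  have "2 ^ k * 1 \<le> 2 ^ k * (s + 1)" using s by (intro mult_left_mono) auto
  then have S: "s' < S" unfolding S_def using k by linarith
  define \<theta> where "\<theta> = (s' - s) / (S - s)"
  have \<theta>: "0 < \<theta>" "\<theta> < 1" using s' S by (auto simp: \<theta>_def)
  have \<theta>eq: "\<theta> * (S - s) = s' - s" using s' S by (simp add: \<theta>_def)
  have e1: "(1 - \<theta>) * s + \<theta> * S = s'" using \<theta>eq by (simp add: algebra_simps)
  \<comment> \<open>\<open>\<gamma>\<close> is the slope of the ray. Both end points satisfy
    \<sigma> + 1 = \<gamma> (s + 1), an affine relation that convex combinations preserve.\<close>
  define \<gamma> where "\<gamma> = (\<sigma> + 1) / (s + 1)"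
  have g: "\<sigma> = \<gamma> * (s + 1) - 1" using s by (simp add: \<gamma>_def)
  have g2: "2 ^ k * (\<sigma> + 1) - 1 = \<gamma> * (S + 1) - 1" using g by (simp add: S_def)
  have "(1 - \<theta>) * \<sigma> + \<theta> * (2 ^ k * (\<sigma> + 1) - 1) = \<gamma> * (((1 - \<theta>) * s + \<theta> * S) + 1) - 1"
    unfolding g2 by (subst g) (simp add: algebra_simps)
  then have e2: "(1 - \<theta>) * \<sigma> + \<theta> * (2 ^ k * (\<sigma> + 1) - 1) = \<gamma> * (s' + 1) - 1" unfolding e1 .
  from matrix_bounded_interpolate[OF mb iter[of k] \<theta>] show ?thesis
    unfolding S_def[symmetric] e1 e2 \<gamma>_def .
qed

section \<open>Products and finite sums of power series\<close>

lemma zpow_add: "zpow z (\<lambda>i. a i + b i) = zpow z a * zpow z b"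
  by (simp add: zpow_def power_add prod.distrib)

text \<open>The double family of products is absolutely summable over pairs (p, q). Re-indexed by (p
  + q, p), it can be summed over the fibre of each m first; that fibre is the finite box below m and
  yields the Cauchy product.\<close>

lemma has_power_series_mult:
  fixes f g :: "complex ^ 'd \<Rightarrow> complex"
  assumes f: "has_power_series f a" and g: "has_power_series g b"
  shows "has_power_series (\<lambda>z. f z * g z) (cauchy_prod a b)"
  unfolding has_power_series_def
proof
  fix z :: "complex ^ 'd" assume z: "z \<in> polydisc"
  let ?A = "\<lambda>n. a n * zpow z n" and ?B = "\<lambda>n. b n * zpow z n"
  have A: "(?A has_sum f z) UNIV" and B: "(?B has_sum g z) UNIV"
    using f g z unfolding has_power_series_def by blast+
  have absA: "(\<lambda>n. norm (?A n)) summable_on UNIV" and absB: "(\<lambda>n. norm (?B n)) summable_on UNIV"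
    using has_sum_imp_summable[OF A] has_sum_imp_summable[OF B]
    by (simp_all only: summable_on_iff_abs_summable_on_complex)
  let ?h = "\<lambda>(p, q). ?A p * ?B q"
  have "(\<lambda>x. norm (?h x)) summable_on (UNIV \<times> UNIV)"
  proof (subst Infinite_Sum.abs_summable_on_Sigma_iff, intro conjI ballI)
    show "(\<lambda>q. norm (?h (p, q))) summable_on UNIV" for p
      unfolding prod.case norm_mult[of "?A p"] by (rule summable_on_cmult_right[OF absB])
    have "(\<lambda>p. norm (?A p) * infsum (\<lambda>q. norm (?B q)) UNIV) summable_on UNIV"
      by (rule summable_on_cmult_left[OF absA])
    moreover have "infsum (\<lambda>q. norm (?h (p, q))) UNIV = norm (?A p) * infsum (\<lambda>q. norm (?B q)) UNIV" for p
      unfolding prod.case norm_mult[of "?A p"] by (rule infsum_cmult_right') 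
    moreover have "0 \<le> infsum (\<lambda>q. norm (?B q)) UNIV" by (rule infsum_nonneg) simp
    ultimately show "(\<lambda>p. norm (infsum (\<lambda>q. norm (?h (p, q))) UNIV)) summable_on UNIV"
      by (simp only: real_norm_def abs_mult abs_norm_cancel abs_of_nonneg)
  qed
  then have "?h summable_on (UNIV \<times> UNIV)" by (rule abs_summable_summable)
  then have h: "(?h has_sum (f z * g z)) (UNIV \<times> UNIV)"
    by (intro has_sum_SigmaI[where g = "\<lambda>p. ?A p * g z"])
       (simp_all only: prod.case has_sum_cmult_right[OF B] has_sum_cmult_left[OF A])
  have "((\<lambda>(m, p). (a p * b (\<lambda>i. m i - p i)) * zpow z m) has_sum (f z * g z)) (Sigma UNIV (\<lambda>m. {p. p \<le> m}))"
  proof (rule has_sum_reindex_bij_witness[where j = "\<lambda>(m, p). (p, \<lambda>i. m i - p i)" and i = "\<lambda>(p, q). (\<lambda>i. p i + q i, p)", THEN iffD2, OF _ _ _ _ _ refl h])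
    fix x :: "('d \<Rightarrow> nat) \<times> ('d \<Rightarrow> nat)" assume "x \<in> Sigma UNIV (\<lambda>m. {p. p \<le> m})"
    then obtain m p where x: "x = (m, p)" "p \<le> m" by blast
    then have m: "(\<lambda>i. p i + (m i - p i)) = m" by (auto simp: le_fun_def)
    then show "(case (case x of (m, p) \<Rightarrow> (p, \<lambda>i. m i - p i)) of (p, q) \<Rightarrow> (\<lambda>i. p i + q i, p)) = x"
      using x by simp
    show "?h (case x of (m, p) \<Rightarrow> (p, \<lambda>i. m i - p i)) =
        (case x of (m, p) \<Rightarrow> (a p * b (\<lambda>i. m i - p i)) * zpow z m)"
      unfolding x(1) prod.case using zpow_add[of z p "\<lambda>i. m i - p i"] unfolding m by (simp add: mult_ac)
  qed (auto simp: le_fun_def)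
  then show "((\<lambda>m. cauchy_prod a b m * zpow z m) has_sum f z * g z) UNIV"
    by (rule has_sum_SigmaD) (simp add: cauchy_prod_def sum_distrib_right has_sum_finiteI finite_below)
qed

lemma has_power_series_sum:
  fixes g :: "'i \<Rightarrow> complex ^ 'd \<Rightarrow> complex"
  assumes "finite F" "\<And>n. n \<in> F \<Longrightarrow> has_power_series (g n) (c n)"
  shows "has_power_series (\<lambda>z. \<Sum>n\<in>F. x n * g n z) (\<lambda>m. \<Sum>n\<in>F. x n * c n m)"
  using assms
proof (induction F rule: finite_induct)
  case empty
  then show ?case by (simp add: has_power_series_def)
next
  case (insert n F)
  show ?case unfolding has_power_series_def
  proof
    fix z :: "complex ^ 'd" assume z: "z \<in> polydisc"
    have "((\<lambda>m. c n m * zpow z m) has_sum g n z) UNIV"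
      using insert.prems[of n] z by (simp add: has_power_series_def)
    then have 1: "((\<lambda>m. x n * (c n m * zpow z m)) has_sum x n * g n z) UNIV"
      by (rule has_sum_cmult_right)
    have "has_power_series (\<lambda>z. \<Sum>n\<in>F. x n * g n z) (\<lambda>m. \<Sum>n\<in>F. x n * c n m)"
      by (rule insert.IH) (use insert.prems in simp)
    then have 2: "((\<lambda>m. (\<Sum>n\<in>F. x n * c n m) * zpow z m) has_sum (\<Sum>n\<in>F. x n * g n z)) UNIV"
      using z by (simp add: has_power_series_def)
    from has_sum_add[OF 1 2] insert.hyps
    show "((\<lambda>m. (\<Sum>n\<in>insert n F. x n * c n m) * zpow z m) has_sum (\<Sum>n\<in>insert n F. x n * g n z)) UNIV"
      by (simp add: distrib_right mult.assoc)
  qed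
qed

lemma has_power_series_polynomial:
  fixes x :: "('d::finite \<Rightarrow> nat) \<Rightarrow> complex"
  assumes "finite F"
  shows "has_power_series (\<lambda>z. \<Sum>n\<in>F. x n * zpow z n) (\<lambda>n. if n \<in> F then x n else 0)"
  unfolding has_power_series_def
  by (intro ballI has_sum_finite_neutralI[OF assms]) auto

section \<open>Closure properties of holomorphic functions and the matrix of a composition
  operator\<close>

lemma holo_onD:
  assumes "f holo_on S" "z \<in> S"
  obtains f' where "(f has_derivative f') (at z within S)" "\<And>c v. f' (c *s v) = c * f' v"
  using assms unfolding holo_on_def by blast

lemma holo_onI:
  assumes "\<And>z. z \<in> S \<Longrightarrow> \<exists>f'. (f has_derivative f') (at z within S) \<and> (\<forall>c v. f' (c *s v) = c * f' v)"
  shows "f holo_on S"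
  using assms unfolding holo_on_def by blast

lemma holo_on_const: "(\<lambda>z. c) holo_on S"
  by (rule holo_onI) (intro exI[of _ "\<lambda>_. 0"] conjI has_derivative_const, simp)

lemma holo_on_mult:
  assumes "f holo_on S" "g holo_on S"
  shows "(\<lambda>z. f z * g z) holo_on S"
proof (rule holo_onI)
  fix z assume z: "z \<in> S"
  obtain f' where f': "(f has_derivative f') (at z within S)" and fl: "\<And>c v. f' (c *s v) = c * f' v"
    using holo_onD[OF assms(1) z] by blast
  obtain g' where g': "(g has_derivative g') (at z within S)" and gl: "\<And>c v. g' (c *s v) = c * g' v"
    using holo_onD[OF assms(2) z] by blast
  show "\<exists>h'. ((\<lambda>z. f z * g z) has_derivative h') (at z within S) \<and> (\<forall>c v. h' (c *s v) = c * h' v)"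
    by (rule exI, rule conjI, rule has_derivative_mult[OF f' g']) (simp add: fl gl algebra_simps)
qed

lemma holo_on_add:
  assumes "f holo_on S" "g holo_on S"
  shows "(\<lambda>z. f z + g z) holo_on S"
proof (rule holo_onI)
  fix z assume z: "z \<in> S"
  obtain f' where f': "(f has_derivative f') (at z within S)" and fl: "\<And>c v. f' (c *s v) = c * f' v"
    using holo_onD[OF assms(1) z] by blast
  obtain g' where g': "(g has_derivative g') (at z within S)" and gl: "\<And>c v. g' (c *s v) = c * g' v"
    using holo_onD[OF assms(2) z] by blast
  show "\<exists>h'. ((\<lambda>z. f z + g z) has_derivative h') (at z within S) \<and> (\<forall>c v. h' (c *s v) = c * h' v)"
    by (rule exI, rule conjI, rule has_derivative_add[OF f' g']) (simp add: fl gl algebra_simps)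
qed

lemma holo_on_power: "f holo_on S \<Longrightarrow> (\<lambda>z. f z ^ k) holo_on S"
  by (induction k) (simp_all add: holo_on_const holo_on_mult)

lemma holo_on_prod:
  "finite I \<Longrightarrow> (\<And>i. i \<in> I \<Longrightarrow> f i holo_on S) \<Longrightarrow> (\<lambda>z. \<Prod>i\<in>I. f i z) holo_on S"
  by (induction I rule: finite_induct) (simp_all add: holo_on_const holo_on_mult)

lemma holo_on_sum:
  "finite I \<Longrightarrow> (\<And>i. i \<in> I \<Longrightarrow> f i holo_on S) \<Longrightarrow> (\<lambda>z. \<Sum>i\<in>I. f i z) holo_on S"
  by (induction I rule: finite_induct) (simp_all add: holo_on_const holo_on_add)

lemma holo_on_nth: "(\<lambda>z :: complex ^ 'd. z $ i) holo_on S"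
  by (rule holo_onI)
     (intro exI[of _ "\<lambda>v. v $ i"] conjI bounded_linear_imp_has_derivative bounded_linear_vec_nth, simp)

lemma holo_on_zpow:
  fixes \<phi> :: "complex ^ 'd \<Rightarrow> complex ^ 'd"
  shows "(\<And>i. (\<lambda>z. \<phi> z $ i) holo_on S) \<Longrightarrow> (\<lambda>z. zpow (\<phi> z) n) holo_on S"
  unfolding zpow_def by (intro holo_on_prod finite holo_on_power)

lemma holo_on_polynomial:
  fixes \<phi> :: "complex ^ 'd \<Rightarrow> complex ^ 'd"
  assumes "finite F" "\<And>i. (\<lambda>z. \<phi> z $ i) holo_on S"
  shows "(\<lambda>z. \<Sum>n\<in>F. x n * zpow (\<phi> z) n) holo_on S"
  by (intro holo_on_sum assms holo_on_mult holo_on_const holo_on_zpow)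

lemma holo_on_compose:
  fixes \<phi> :: "complex ^ 'd \<Rightarrow> complex ^ 'd"
  assumes f: "f holo_on polydisc" and \<phi>: "holo_self_map \<phi>"
  shows "(f \<circ> \<phi>) holo_on polydisc"
proof (rule holo_onI)
  fix z :: "complex ^ 'd" assume z: "z \<in> polydisc"
  have hol: "(\<lambda>z. \<phi> z $ j) holo_on polydisc" for j using \<phi> unfolding holo_self_map_def by blast
  have maps: "\<phi> ` polydisc \<subseteq> polydisc" using \<phi> unfolding holo_self_map_def by blast
  have "\<forall>j. \<exists>f'. ((\<lambda>z. \<phi> z $ j) has_derivative f') (at z within polydisc) \<and> (\<forall>c v. f' (c *s v) = c * f' v)"
    using hol z unfolding holo_on_def by blast
  then obtain D where D: "\<And>j. ((\<lambda>z. \<phi> z $ j) has_derivative D j) (at z within polydisc)"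
    and Dl: "\<And>j c v. D j (c *s v) = c * D j v" by metis
  let ?D = "\<lambda>v. (\<chi> j. D j v) :: complex ^ 'd"
  have d\<phi>: "(\<phi> has_derivative ?D) (at z within polydisc)"
  proof (subst has_derivative_componentwise_within, rule ballI)
    fix b :: "complex ^ 'd" assume "b \<in> Basis"
    then obtain j u where b: "b = axis j u" by (auto simp: Basis_vec_def)
    show "((\<lambda>z. \<phi> z \<bullet> b) has_derivative (\<lambda>v. ?D v \<bullet> b)) (at z within polydisc)"
      unfolding b inner_axis using has_derivative_inner_left[OF D[of j], of u] by simp
  qed
  have "\<phi> z \<in> polydisc" using maps z by blast
  from holo_onD[OF f this] obtain f' where f': "(f has_derivative f') (at (\<phi> z) within polydisc)"
    and fl: "\<And>c v. f' (c *s v) = c * f' v" by blast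
  have "(f has_derivative f') (at (\<phi> z) within \<phi> ` polydisc)"
    by (rule has_derivative_subset[OF f' maps])
  from has_derivative_in_compose[OF d\<phi> this]
  have "((f \<circ> \<phi>) has_derivative (\<lambda>v. f' (?D v))) (at z within polydisc)" by (simp only: comp_def)
  moreover have "f' (?D (c *s v)) = c * f' (?D v)" for c v
  proof -
    have "?D (c *s v) = c *s ?D v" by (simp add: vec_eq_iff Dl)
    then show ?thesis by (simp only: fl)
  qed
  ultimately show "\<exists>h'. ((f \<circ> \<phi>) has_derivative h') (at z within polydisc) \<and> (\<forall>c v. h' (c *s v) = c * h' v)"
    by blast
qed

text \<open>Multiplicativity of the columns follows from uniqueness of expansions, as \<phi>^(a + b)
  = \<phi>^a \<phi>^b. It is the property that distinguishes composition operators from arbitrary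
  matrices and on which doubling rests.\<close>

lemma composition_matrix:
  fixes \<phi> :: "complex ^ 'd \<Rightarrow> complex ^ 'd"
  assumes \<phi>: "holo_self_map \<phi>"
  obtains t where "\<And>n. has_power_series (\<lambda>z. zpow (\<phi> z) n) (t n)"
    and "\<And>a b. t (\<lambda>i. a i + b i) = cauchy_prod (t a) (t b)"
proof -
  have hol: "(\<lambda>z. \<phi> z $ j) holo_on polydisc" for j using \<phi> unfolding holo_self_map_def by blast
  have "\<forall>n. \<exists>c. has_power_series (\<lambda>z. zpow (\<phi> z) n) c"
    by (intro allI holo_has_power_series holo_on_zpow hol)
  then obtain t where t: "\<And>n. has_power_series (\<lambda>z. zpow (\<phi> z) n) (t n)" by metis
  moreover have "t (\<lambda>i. a i + b i) = cauchy_prod (t a) (t b)" for a b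
    using t[of "\<lambda>i. a i + b i"] has_power_series_mult[OF t[of a] t[of b]]
    unfolding zpow_add by (rule has_power_series_unique)
  ultimately show ?thesis by (rule that)
qed

section \<open>Hardy and Bergman norms in terms of coefficients\<close>

lemma nn_integral_distr':
  "T \<in> measurable M N \<Longrightarrow> f \<in> borel_measurable N \<Longrightarrow>
     (\<integral>\<^sup>+y. f y \<partial>distr M N T) = (\<integral>\<^sup>+x. f (T x) \<partial>M)"
  by (rule nn_integral_distr) (simp_all only: measurable_distr_eq1)

lemma circle_measure_eq: "circle_measure = distr angle_measure borel cis"
  by (simp add: circle_measure_def angle_measure_def)

text \<open>The image of a product measure under a coordinatewise map is the product of the images.
  Hardy integrals thereby become integrals over angles.\<close>

lemma vec_power_circle_eq:
  "(vec_power_measure circle_measure :: (complex ^ 'd) measure) =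
     distr (torus_measure UNIV) borel (\<lambda>\<theta>. \<chi> i. cis (\<theta> i))"
proof -
  have pa: "product_prob_space (\<lambda>_::'d. angle_measure)" by (rule product_prob_space_angle)
  have circ: "prob_space circle_measure"
    unfolding circle_measure_eq by (rule prob_space.prob_space_distr[OF prob_space_angle]) simp
  then have pc: "product_prob_space (\<lambda>_::'d. circle_measure)" by (rule product_prob_spaceI)
  have sc [measurable_cong]: "sets circle_measure = sets borel" by (simp add: circle_measure_eq)
  have cis_m: "cis \<in> measurable angle_measure circle_measure"
    by measurable
  have "distr (Pi\<^sub>M UNIV (\<lambda>_::'d. angle_measure)) (Pi\<^sub>M UNIV (\<lambda>_::'d. circle_measure)) (compose UNIV cis)
     = Pi\<^sub>M UNIV (\<lambda>_::'d. distr angle_measure circle_measure cis)"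
    by (rule distr_PiM_finite_prob_space[OF finite pa pc cis_m])
  also have "distr angle_measure circle_measure cis = circle_measure"
    by (subst (2) circle_measure_eq) (rule distr_cong, simp_all add: sc)
  finally have "vec_power_measure circle_measure = distr (distr (Pi\<^sub>M UNIV (\<lambda>_::'d. angle_measure))
     (Pi\<^sub>M UNIV (\<lambda>_::'d. circle_measure)) (compose UNIV cis)) borel vec_lambda"
    by (simp add: vec_power_measure_def)
  also have "\<dots> = distr (Pi\<^sub>M UNIV (\<lambda>_::'d. angle_measure)) borel (vec_lambda \<circ> compose UNIV cis)"
  proof (rule distr_distr)
    show "(vec_lambda :: _ \<Rightarrow> complex ^ 'd) \<in> measurable (Pi\<^sub>M UNIV (\<lambda>_::'d. circle_measure)) borel"
    proof (rule borel_measurable_vecI)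
      fix i :: 'd
      have "(\<lambda>x. x i) \<in> measurable (Pi\<^sub>M UNIV (\<lambda>_::'d. circle_measure)) circle_measure"
        by (rule measurable_component_singleton) simp
      then show "(\<lambda>x. (vec_lambda x :: complex ^ 'd) $ i) \<in> borel_measurable (Pi\<^sub>M UNIV (\<lambda>_::'d. circle_measure))"
        unfolding vec_lambda_inverse[OF UNIV_I] by (simp cong: measurable_cong_sets add: sc)
    qed
    show "compose UNIV cis \<in> measurable (Pi\<^sub>M UNIV (\<lambda>_::'d. angle_measure)) (Pi\<^sub>M UNIV (\<lambda>_::'d. circle_measure))"
      unfolding compose_def using cis_m by measurable
  qed
  also have "vec_lambda \<circ> compose UNIV cis = (\<lambda>\<theta>. (\<chi> i. cis (\<theta> i)) :: complex ^ 'd)"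
    by (auto simp: fun_eq_iff compose_def vec_eq_iff)
  finally show ?thesis by (simp add: torus_measure_def)
qed

text \<open>Apart from the change to angles there is a measurability issue: r \<zeta> lies in the
  polydisc only for almost every \<zeta>, as the measure is carried by the torus. So f is first
  replaced by its cut-off.\<close>

lemma hardy_norm_sq_eq:
  fixes f :: "complex ^ 'd \<Rightarrow> complex"
  assumes f: "f holo_on polydisc"
  shows "hardy_norm_sq f = (SUP r\<in>{0<..<1}. \<integral>\<^sup>+\<theta>. ennreal ((norm (f (rot \<theta> (\<chi> i. of_real r))))\<^sup>2) \<partial>torus_measure UNIV)"
  unfolding hardy_norm_sq_def
proof (rule SUP_cong[OF refl])
  fix r :: real assume r: "r \<in> {0<..<1}"
  let ?f0 = "\<lambda>z. if z \<in> polydisc then f z else 0"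
  have emb [measurable]: "(\<lambda>\<theta>. (\<chi> i. cis (\<theta> i)) :: complex ^ 'd) \<in> borel_measurable (torus_measure UNIV)"
    using measurable_rot[of "1 :: complex ^ 'd"] by (simp add: rot_def)
  have scale [measurable]: "(\<lambda>\<zeta> :: complex ^ 'd. r *\<^sub>R \<zeta>) \<in> borel_measurable borel"
    by (intro borel_measurable_continuous_onI continuous_intros)
  have rot_eq: "rot \<theta> (\<chi> i. of_real r) = r *\<^sub>R ((\<chi> i. cis (\<theta> i)) :: complex ^ 'd)" for \<theta>
    unfolding rot_def vec_eq_iff by (simp add: scaleR_conv_of_real[where 'a = complex] mult.commute)
  have mem: "r *\<^sub>R ((\<chi> i. cis (\<theta> i)) :: complex ^ 'd) \<in> polydisc" for \<theta>
    using r by (simp add: polydisc_def)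
  have [measurable]: "{\<zeta> :: complex ^ 'd. r *\<^sub>R \<zeta> \<in> polydisc} \<in> sets borel"
    using measurable_sets[OF scale borel_open[OF open_polydisc]] by (simp add: vimage_def)
  have ae: "AE \<zeta> in (vec_power_measure circle_measure :: (complex ^ 'd) measure). r *\<^sub>R \<zeta> \<in> polydisc"
    unfolding vec_power_circle_eq by (subst AE_distr_iff) (simp_all add: mem)
  have "(\<integral>\<^sup>+ \<zeta>. ennreal ((norm (f (r *\<^sub>R \<zeta>)))\<^sup>2) \<partial>vec_power_measure circle_measure) =
     (\<integral>\<^sup>+ \<zeta>. ennreal ((norm (?f0 (r *\<^sub>R \<zeta>)))\<^sup>2) \<partial>vec_power_measure circle_measure)"
    by (rule nn_integral_cong_AE) (rule eventually_mono[OF ae], simp)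
  also have "\<dots> = (\<integral>\<^sup>+\<theta>. ennreal ((norm (?f0 (r *\<^sub>R (\<chi> i. cis (\<theta> i)))))\<^sup>2) \<partial>torus_measure UNIV)"
    unfolding vec_power_circle_eq
  proof (rule nn_integral_distr'[OF emb])
    have "(\<lambda>\<zeta>. ?f0 (r *\<^sub>R \<zeta>)) \<in> borel_measurable borel"
      by (rule measurable_compose[OF scale borel_measurable_holo[OF f]])
    then show "(\<lambda>\<zeta>. ennreal ((norm (?f0 (r *\<^sub>R \<zeta>)))\<^sup>2)) \<in> borel_measurable borel" by measurable
  qed
  also have "\<dots> = (\<integral>\<^sup>+\<theta>. ennreal ((norm (f (rot \<theta> (\<chi> i. of_real r))))\<^sup>2) \<partial>torus_measure UNIV)"
    by (simp only: mem if_True rot_eq)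
  finally show "(\<integral>\<^sup>+ \<zeta>. ennreal ((norm (f (r *\<^sub>R \<zeta>)))\<^sup>2) \<partial>vec_power_measure circle_measure) =
     (\<integral>\<^sup>+\<theta>. ennreal ((norm (f (rot \<theta> (\<chi> i. of_real r))))\<^sup>2) \<partial>torus_measure UNIV)" .
qed

section \<open>Coefficient sums as integrals for counting measure, and the Hardy norm\<close>

lemma multi_index_enumeration: "bij_betw (from_nat_into (UNIV :: ('d::finite \<Rightarrow> nat) set)) UNIV UNIV"
proof (rule bij_betw_from_nat_into)
  show "infinite (UNIV :: ('d \<Rightarrow> nat) set)" by (simp add: finite_UNIV_fun)
qed simp

lemma nn_integral_count_has_sum:
  fixes h :: "('d::finite \<Rightarrow> nat) \<Rightarrow> real"
  assumes "(h has_sum S) UNIV" "\<And>n. 0 \<le> h n"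
  shows "(\<integral>\<^sup>+n. ennreal (h n) \<partial>count_space UNIV) = ennreal S"
proof -
  let ?e = "from_nat_into (UNIV :: ('d \<Rightarrow> nat) set)"
  have "(\<lambda>k. h (?e k)) sums S"
    by (rule has_sum_imp_sums, rule has_sum_reindex_bij_betw[OF multi_index_enumeration, THEN iffD2], rule assms(1))
  then have "(\<Sum>k. ennreal (h (?e k))) = ennreal S" by (intro suminf_ennreal_eq assms(2))
  then show ?thesis
    by (subst nn_integral_bij_count_space[OF multi_index_enumeration, symmetric])
       (simp add: nn_integral_count_space_nat)
qed

lemma nn_integral_count_le:
  fixes h :: "('d::finite \<Rightarrow> nat) \<Rightarrow> ennreal"
  assumes "\<And>G. finite G \<Longrightarrow> (\<Sum>n\<in>G. h n) \<le> C"
  shows "(\<integral>\<^sup>+n. h n \<partial>count_space UNIV) \<le> C"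
proof -
  let ?e = "from_nat_into (UNIV :: ('d \<Rightarrow> nat) set)"
  have "(\<integral>\<^sup>+n. h n \<partial>count_space UNIV) = (\<Sum>k. h (?e k))"
    by (subst nn_integral_bij_count_space[OF multi_index_enumeration, symmetric])
       (simp add: nn_integral_count_space_nat)
  also have "\<dots> = (SUP N. \<Sum>k<N. h (?e k))" by (rule suminf_eq_SUP)
  also have "\<dots> \<le> C"
  proof (rule SUP_least)
    fix N
    have "inj_on ?e {..<N}"
      using multi_index_enumeration by (rule bij_betw_imp_inj_on[THEN inj_on_subset]) simp
    then have "(\<Sum>k<N. h (?e k)) = (\<Sum>n\<in>?e ` {..<N}. h n)" by (simp add: sum.reindex)
    also have "\<dots> \<le> C" by (rule assms) simp
    finally show "(\<Sum>k<N. h (?e k)) \<le> C" .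
  qed
  finally show ?thesis .
qed

lemma sum_le_nn_integral_count:
  assumes "finite G"
  shows "(\<Sum>n\<in>G. h n) \<le> (\<integral>\<^sup>+n. h n \<partial>count_space UNIV)"
proof -
  have "(\<Sum>n\<in>G. h n) = (\<integral>\<^sup>+n. h n \<partial>count_space G)"
    by (rule nn_integral_count_space_finite[OF assms, symmetric])
  also have "\<dots> = (\<integral>\<^sup>+n. h n * indicator G n \<partial>count_space UNIV)"
    by (rule nn_integral_count_space_indicator) simp
  also have "\<dots> \<le> (\<integral>\<^sup>+n. h n \<partial>count_space UNIV)"
    by (rule nn_integral_mono) (simp add: indicator_def)
  finally show ?thesis .
qed

text \<open>Parseval on the torus orbit of z. It serves the Hardy norm, where z has equal
  coordinates r, and the Bergman norm, where z is integrated afterwards.\<close>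

lemma nn_integral_torus_power_series:
  fixes f :: "complex ^ 'd \<Rightarrow> complex"
  assumes f: "f holo_on polydisc" and c: "has_power_series f c" and z: "z \<in> polydisc"
  shows "(\<integral>\<^sup>+\<theta>. ennreal ((norm (f (rot \<theta> z)))\<^sup>2) \<partial>torus_measure UNIV) =
     (\<integral>\<^sup>+n. ennreal ((norm (c n))\<^sup>2 * (norm (zpow z n))\<^sup>2) \<partial>count_space UNIV)"
proof -
  have mem: "rot \<theta> z \<in> polydisc" for \<theta>
    using z unfolding polydisc_def by (simp add: rot_def norm_mult)
  have hs: "((\<lambda>n. (c n * zpow z n) * torus_mono n \<theta>) has_sum f (rot \<theta> z)) UNIV" for \<theta>
  proof -
    have "((\<lambda>n. c n * zpow (rot \<theta> z) n) has_sum f (rot \<theta> z)) UNIV"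
      using c mem unfolding has_power_series_def by blast
    then show ?thesis unfolding zpow_rot by (simp only: mult_ac)
  qed
  have meas: "(\<lambda>\<theta>. f (rot \<theta> z)) \<in> borel_measurable (torus_measure UNIV)"
    by (rule borel_measurable_holo_compose[OF f measurable_rot mem])
  have "(\<integral>\<^sup>+\<theta>. ennreal ((norm (f (rot \<theta> z)))\<^sup>2) \<partial>torus_measure UNIV) =
      ennreal (\<integral>\<theta>. (norm (f (rot \<theta> z)))\<^sup>2 \<partial>torus_measure UNIV)"
    by (rule nn_integral_eq_integral[OF torus_parseval(2)[OF hs meas]]) simp
  also have "\<dots> = (\<integral>\<^sup>+n. ennreal ((norm (c n * zpow z n))\<^sup>2) \<partial>count_space UNIV)"
    by (rule nn_integral_count_has_sum[symmetric, OF torus_parseval(1)[OF hs meas]]) simp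
  finally show ?thesis by (simp only: norm_mult power_mult_distrib)
qed

lemma norm_zpow_sq: "(norm (zpow z n))\<^sup>2 = (\<Prod>i\<in>UNIV. norm (z $ i) ^ (2 * n i))"
  by (simp add: zpow_def norm_power power_mult prod_power_distrib flip: prod_norm power_even_eq)

text \<open>The mean at radius r is the sum of |c_n|^2 r^(2|n|). It never exceeds the full sum, and
  Fatou's lemma along radii tending to 1 gives the reverse inequality.\<close>

lemma hardy_norm_sq_power_series:
  fixes f :: "complex ^ 'd \<Rightarrow> complex"
  assumes f: "f holo_on polydisc" and c: "has_power_series f c"
  shows "hardy_norm_sq f = (\<integral>\<^sup>+n. ennreal ((norm (c n))\<^sup>2) \<partial>count_space UNIV)"
proof -
  let ?N = "\<lambda>n :: 'd \<Rightarrow> nat. \<Sum>i\<in>UNIV. 2 * n i"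
  let ?I = "\<lambda>r. \<integral>\<^sup>+n. ennreal ((norm (c n))\<^sup>2 * r ^ ?N n) \<partial>count_space UNIV"
  have eq: "(\<integral>\<^sup>+\<theta>. ennreal ((norm (f (rot \<theta> (\<chi> i. of_real r))))\<^sup>2) \<partial>torus_measure UNIV) = ?I r"
    if r: "r \<in> {0<..<1}" for r
  proof -
    have mem: "((\<chi> i. of_real r) :: complex ^ 'd) \<in> polydisc" using r by (simp add: polydisc_def)
    show ?thesis
      unfolding nn_integral_torus_power_series[OF f c mem] norm_zpow_sq power_sum
      using r by simp
  qed
  have H: "hardy_norm_sq f = (SUP r\<in>{0<..<1}. ?I r)"
    unfolding hardy_norm_sq_eq[OF f] by (rule SUP_cong[OF refl eq])
  show ?thesis
  proof (rule antisym)
    show "hardy_norm_sq f \<le> (\<integral>\<^sup>+n. ennreal ((norm (c n))\<^sup>2) \<partial>count_space UNIV)"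
      unfolding H
    proof (rule SUP_least, rule nn_integral_mono, rule ennreal_leI)
      fix r :: real and n assume r: "r \<in> {0<..<1}"
      then have "r ^ ?N n \<le> 1" by (intro power_le_one) auto
      then show "(norm (c n))\<^sup>2 * r ^ ?N n \<le> (norm (c n))\<^sup>2"
        by (rule mult_left_le) simp
    qed
    \<comment> \<open>The shift by 2 keeps the radius positive at k = 0.\<close>
    define \<rho> where "\<rho> k = 1 - 1 / (real k + 2)" for k :: nat
    have \<rho>: "\<rho> k \<in> {0<..<1}" for k by (auto simp: \<rho>_def field_simps)
    have \<rho>_lim: "\<rho> \<longlonglongrightarrow> 1"
      unfolding \<rho>_def[abs_def] by real_asymp
    have "(\<lambda>k. ennreal ((norm (c n))\<^sup>2 * \<rho> k ^ ?N n)) \<longlonglongrightarrow> ennreal ((norm (c n))\<^sup>2 * 1 ^ ?N n)" for n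
      by (intro tendsto_ennrealI tendsto_intros \<rho>_lim)
    then have lim: "liminf (\<lambda>k. ennreal ((norm (c n))\<^sup>2 * \<rho> k ^ ?N n)) = ennreal ((norm (c n))\<^sup>2)" for n
      using lim_imp_Liminf[OF sequentially_bot] by fastforce
    have "(\<integral>\<^sup>+n. liminf (\<lambda>k. ennreal ((norm (c n))\<^sup>2 * \<rho> k ^ ?N n)) \<partial>count_space UNIV)
        \<le> liminf (\<lambda>k. ?I (\<rho> k))"
      by (rule nn_integral_liminf) simp
    also have "\<dots> \<le> liminf (\<lambda>k. hardy_norm_sq f)"
      by (intro Liminf_mono always_eventually allI) (unfold H, rule SUP_upper[OF \<rho>])
    also have "\<dots> = hardy_norm_sq f" by (rule Liminf_const) simp
    finally show "(\<integral>\<^sup>+n. ennreal ((norm (c n))\<^sup>2) \<partial>count_space UNIV) \<le> hardy_norm_sq f"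
      unfolding lim .
  qed
qed

section \<open>Rotation invariance of planar Lebesgue measure\<close>

lemma borel_measurable_Complex_pair:
  "(\<lambda>(x, y). Complex x y) \<in> borel_measurable (lborel \<Otimes>\<^sub>M lborel)"
  unfolding Complex_eq by measurable

text \<open>Lebesgue measure is determined by its values on boxes. The product form allows iterated
  integration over real and imaginary part in either order, as the two kinds of shear
  require.\<close>

lemma lborel_complex_eq:
  "(lborel :: complex measure) = distr (lborel \<Otimes>\<^sub>M lborel) borel (\<lambda>(x, y). Complex x y)"
proof (rule lborel_eqI)
  note C [measurable] = borel_measurable_Complex_pair
  fix l u :: complex assume le: "\<And>b. b \<in> Basis \<Longrightarrow> l \<bullet> b \<le> u \<bullet> b"
  have lu: "Re l \<le> Re u" "Im l \<le> Im u" using le[of 1] le[of \<i>] by (auto simp: Basis_complex_def)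
  have "(\<lambda>(x, y). Complex x y) -` box l u = {Re l<..<Re u} \<times> {Im l<..<Im u}"
    by (auto simp: box_def Basis_complex_def)
  then have "emeasure (distr (lborel \<Otimes>\<^sub>M lborel) borel (\<lambda>(x, y). Complex x y)) (box l u) =
    emeasure (lborel \<Otimes>\<^sub>M lborel) ({Re l<..<Re u} \<times> {Im l<..<Im u})"
    by (subst emeasure_distr) (simp_all add: space_pair_measure)
  also have "\<dots> = ennreal (Re u - Re l) * ennreal (Im u - Im l)"
    by (subst lborel.emeasure_pair_measure_Times) (simp_all add: lu)
  also have "\<dots> = ennreal ((Re u - Re l) * (Im u - Im l))"
    using lu by (simp add: ennreal_mult)
  also have "(Re u - Re l) * (Im u - Im l) = (\<Prod>b\<in>Basis. (u - l) \<bullet> b)"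
    by (simp add: Basis_complex_def)
  finally show "emeasure (distr (lborel \<Otimes>\<^sub>M lborel) borel (\<lambda>(x, y). Complex x y)) (box l u) =
     ennreal (\<Prod>b\<in>Basis. (u - l) \<bullet> b)" .
qed simp

lemma nn_integral_lborel_complex:
  assumes [measurable]: "F \<in> borel_measurable borel"
  shows "(\<integral>\<^sup>+z. F z \<partial>(lborel :: complex measure)) = (\<integral>\<^sup>+x. \<integral>\<^sup>+y. F (Complex x y) \<partial>lborel \<partial>lborel)"
    and "(\<integral>\<^sup>+z. F z \<partial>(lborel :: complex measure)) = (\<integral>\<^sup>+y. \<integral>\<^sup>+x. F (Complex x y) \<partial>lborel \<partial>lborel)"
proof -
  note C [measurable] = borel_measurable_Complex_pair
  have meas: "(\<lambda>p. F (case p of (x, y) \<Rightarrow> Complex x y)) \<in> borel_measurable (lborel \<Otimes>\<^sub>M lborel)"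
    by measurable
  have "(\<integral>\<^sup>+z. F z \<partial>(lborel :: complex measure)) =
      (\<integral>\<^sup>+p. F (case p of (x, y) \<Rightarrow> Complex x y) \<partial>(lborel \<Otimes>\<^sub>M lborel))"
    by (subst lborel_complex_eq, rule nn_integral_distr[OF C]) simp
  then show "(\<integral>\<^sup>+z. F z \<partial>(lborel :: complex measure)) = (\<integral>\<^sup>+x. \<integral>\<^sup>+y. F (Complex x y) \<partial>lborel \<partial>lborel)"
    and "(\<integral>\<^sup>+z. F z \<partial>(lborel :: complex measure)) = (\<integral>\<^sup>+y. \<integral>\<^sup>+x. F (Complex x y) \<partial>lborel \<partial>lborel)"
    using lborel.nn_integral_fst[OF meas] lborel_pair.nn_integral_snd[OF meas] by simp_all
qed

text \<open>With the imaginary part fixed, the shear is a translation of the real line.\<close>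

lemma nn_integral_shear_Re:
  assumes [measurable]: "F \<in> borel_measurable borel"
  shows "(\<integral>\<^sup>+z. F (Complex (Re z + a * Im z) (Im z)) \<partial>lborel) = (\<integral>\<^sup>+z. F z \<partial>(lborel :: complex measure))"
proof -
  have cont: "continuous_on UNIV (\<lambda>z. Complex (Re z + a * Im z) (Im z))"
    by (intro continuous_on_Complex continuous_intros)
  have [measurable]: "(\<lambda>z. F (Complex (Re z + a * Im z) (Im z))) \<in> borel_measurable borel"
    by (rule measurable_compose[OF borel_measurable_continuous_onI[OF cont] assms])
  have "(\<integral>\<^sup>+x. F (Complex (x + a * y) y) \<partial>lborel) = (\<integral>\<^sup>+x. F (Complex x y) \<partial>lborel)" for y
  proof -
    have cont: "continuous_on UNIV (\<lambda>x. Complex x y)"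
      by (intro continuous_on_Complex continuous_intros)
    have "(\<lambda>x. F (Complex x y)) \<in> borel_measurable borel"
      by (rule measurable_compose[OF borel_measurable_continuous_onI[OF cont] assms])
    from nn_integral_real_affine[OF this, of 1 "a * y"] show ?thesis
      by (simp add: add.commute)
  qed
  then show ?thesis by (simp add: nn_integral_lborel_complex(2))
qed

lemma nn_integral_shear_Im:
  assumes [measurable]: "F \<in> borel_measurable borel"
  shows "(\<integral>\<^sup>+z. F (Complex (Re z) (Im z + a * Re z)) \<partial>lborel) = (\<integral>\<^sup>+z. F z \<partial>(lborel :: complex measure))"
proof -
  have cont: "continuous_on UNIV (\<lambda>z. Complex (Re z) (Im z + a * Re z))"
    by (intro continuous_on_Complex continuous_intros)
  have [measurable]: "(\<lambda>z. F (Complex (Re z) (Im z + a * Re z))) \<in> borel_measurable borel"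
    by (rule measurable_compose[OF borel_measurable_continuous_onI[OF cont] assms])
  have "(\<integral>\<^sup>+y. F (Complex x (y + a * x)) \<partial>lborel) = (\<integral>\<^sup>+y. F (Complex x y) \<partial>lborel)" for x
  proof -
    have cont: "continuous_on UNIV (\<lambda>y. Complex x y)"
      by (intro continuous_on_Complex continuous_intros)
    have "(\<lambda>y. F (Complex x y)) \<in> borel_measurable borel"
      by (rule measurable_compose[OF borel_measurable_continuous_onI[OF cont] assms])
    from nn_integral_real_affine[OF this, of 1 "a * x"] show ?thesis
      by (simp add: add.commute)
  qed
  then show ?thesis by (simp add: nn_integral_lborel_complex(1))
qed

text \<open>A rotation other than \<open>z \<mapsto> - z\<close> is a product of three shears.\<close>

lemma nn_integral_rotate_aux:
  assumes F [measurable]: "F \<in> borel_measurable borel" and t: "cos t \<noteq> - 1"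
  shows "(\<integral>\<^sup>+z. F (cis t * z) \<partial>lborel) = (\<integral>\<^sup>+z. F z \<partial>(lborel :: complex measure))"
proof -
  \<comment> \<open>This is - tan (t / 2). A horizontal shear by a, a vertical one by sin t and
    again the horizontal one multiply to the rotation by t; comparing entries gives the conditions
    \<open>a1\<close> and \<open>a2\<close>.\<close>
  define a where "a = - sin t / (1 + cos t)"
  have t': "1 + cos t \<noteq> 0" using t by (simp add: add_eq_0_iff)
  have a1: "a * (1 + cos t) = - sin t" using t' by (simp add: a_def)
  have "(a * sin t) * (1 + cos t) = - (sin t * sin t)" using a1 by (metis mult.assoc mult.commute mult_minus_left)
  also have "\<dots> = (cos t - 1) * (1 + cos t)"
    using sin_cos_squared_add3[of t] by (simp add: algebra_simps)
  finally have a2: "1 + a * sin t = cos t" using t' by simp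
  let ?R = "\<lambda>z. Complex (Re z + a * Im z) (Im z)"
  let ?S = "\<lambda>z. Complex (Re z) (Im z + sin t * Re z)"
  have contR: "continuous_on UNIV ?R" and contS: "continuous_on UNIV ?S"
    by (intro continuous_on_Complex continuous_intros)+
  have [measurable]: "?R \<in> borel_measurable borel" "?S \<in> borel_measurable borel"
    using borel_measurable_continuous_onI[OF contR] borel_measurable_continuous_onI[OF contS] by simp_all
  have comp: "?R (?S (?R z)) = cis t * z" for z
  proof (rule complex_eqI)
    have "Re (?R (?S (?R z))) = (1 + a * sin t) * Re z + a * (1 + (1 + a * sin t)) * Im z"
      by (simp add: algebra_simps)
    then show "Re (?R (?S (?R z))) = Re (cis t * z)"
      unfolding a2 a1 by simp
    have "Im (?R (?S (?R z))) = (1 + a * sin t) * Im z + sin t * Re z"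
      by (simp add: algebra_simps)
    then show "Im (?R (?S (?R z))) = Im (cis t * z)"
      unfolding a2 by simp
  qed
  have "(\<integral>\<^sup>+z. F (cis t * z) \<partial>lborel) = (\<integral>\<^sup>+z. F (?R (?S (?R z))) \<partial>lborel)"
    by (simp only: comp)
  also have "\<dots> = (\<integral>\<^sup>+z. F (?R (?S z)) \<partial>lborel)"
    by (rule nn_integral_shear_Re[where F = "\<lambda>z. F (?R (?S z))"]) measurable
  also have "\<dots> = (\<integral>\<^sup>+z. F (?R z) \<partial>lborel)"
    by (rule nn_integral_shear_Im[where F = "\<lambda>z. F (?R z)"]) measurable
  also have "\<dots> = (\<integral>\<^sup>+z. F z \<partial>lborel)"
    by (rule nn_integral_shear_Re) measurable
  finally show ?thesis .
qed

lemma nn_integral_rotate: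
  assumes F [measurable]: "F \<in> borel_measurable borel"
  shows "(\<integral>\<^sup>+z. F (cis t * z) \<partial>lborel) = (\<integral>\<^sup>+z. F z \<partial>(lborel :: complex measure))"
proof (cases "cos t = - 1")
  case True
  \<comment> \<open>The excluded half turn is done as two quarter turns: the cosine of the half
    angle is 0, so the shear argument applies to each.\<close>
  have "2 * (cos (t / 2))\<^sup>2 - 1 = - 1" using True cos_double_cos[of "t / 2"] by simp
  then have half: "cos (t / 2) \<noteq> - 1" by auto
  have cont: "continuous_on UNIV (\<lambda>z. cis (t / 2) * z)" by (intro continuous_intros)
  have [measurable]: "(\<lambda>z. F (cis (t / 2) * z)) \<in> borel_measurable borel"
    by (rule measurable_compose[OF borel_measurable_continuous_onI[OF cont] F])
  have "cis t * z = cis (t / 2) * (cis (t / 2) * z)" for z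
    by (simp add: cis_mult flip: mult.assoc)
  then have "(\<integral>\<^sup>+z. F (cis t * z) \<partial>lborel) = (\<integral>\<^sup>+z. F (cis (t / 2) * (cis (t / 2) * z)) \<partial>lborel)"
    by (simp only:)
  also have "\<dots> = (\<integral>\<^sup>+z. F (cis (t / 2) * z) \<partial>lborel)"
    by (rule nn_integral_rotate_aux[where F = "\<lambda>z. F (cis (t / 2) * z)"]) (use half in simp_all)
  also have "\<dots> = (\<integral>\<^sup>+z. F z \<partial>lborel)"
    by (rule nn_integral_rotate_aux) (use half in simp_all)
  finally show ?thesis .
qed (rule nn_integral_rotate_aux[OF F])

section \<open>Radial moments of the weighted area measures\<close>

lemma emeasure_disc_area:
  assumes "A \<in> sets borel"
  shows "emeasure disc_area A = ennreal (1 / pi) * emeasure lborel (A \<inter> ball 0 1)"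
proof -
  have "emeasure disc_area A = (\<integral>\<^sup>+z. ennreal (1 / pi) * indicator (A \<inter> ball 0 1) z \<partial>lborel)"
    unfolding disc_area_def using assms
    by (subst emeasure_density) (auto simp: indicator_def intro!: nn_integral_cong)
  also have "\<dots> = ennreal (1 / pi) * emeasure lborel (A \<inter> ball 0 1)"
    using assms by (subst nn_integral_cmult_indicator) auto
  finally show ?thesis .
qed

lemma space_disc_area [simp]: "space disc_area = UNIV"
  and sets_disc_area [simp, measurable_cong]: "sets disc_area = sets borel"
  by (simp_all add: disc_area_def)

lemma prob_space_disc_area: "prob_space disc_area"
proof (rule prob_spaceI)
  show "emeasure disc_area (space disc_area) = 1"
    unfolding space_disc_area
    by (subst emeasure_disc_area) (simp_all add: emeasure_ball unit_ball_vol_2 ennreal_mult[symmetric])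
qed

lemma real_distributionI': "prob_space M \<Longrightarrow> sets M = sets borel \<Longrightarrow> space M = UNIV \<Longrightarrow> real_distribution M"
  by (simp add: real_distribution_def real_distribution_axioms_def)

text \<open>The disc of radius sqrt a has normalized area a, so the distribution functions agree.
  This takes the place of polar coordinates for radial integrands.\<close>

lemma distr_disc_area_norm_sq:
  "distr disc_area borel (\<lambda>z. (norm z)\<^sup>2) = uniform_measure lborel {0..1}"
proof (rule cdf_unique)
  have m [measurable]: "(\<lambda>z. (norm z)\<^sup>2) \<in> borel_measurable disc_area" by measurable
  show "real_distribution (distr disc_area borel (\<lambda>z. (norm z)\<^sup>2))"
    by (rule real_distributionI') (auto intro: prob_space.prob_space_distr[OF prob_space_disc_area m])
  show "real_distribution (uniform_measure lborel {0..1})"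
    by (rule real_distributionI') (auto intro: prob_space_uniform_measure)
  show "cdf (distr disc_area borel (\<lambda>z. (norm z)\<^sup>2)) = cdf (uniform_measure lborel {0..1})"
  proof
    fix a :: real
    have L: "cdf (distr disc_area borel (\<lambda>z. (norm z)\<^sup>2)) a =
        enn2real (ennreal (1 / pi) * emeasure lborel ({z :: complex. (norm z)\<^sup>2 \<le> a} \<inter> ball 0 1))"
      unfolding cdf_def measure_def
      by (subst emeasure_distr[OF m]) (simp_all add: emeasure_disc_area vimage_def)
    have R: "cdf (uniform_measure lborel {0..1}) a = measure lborel ({0..1} \<inter> {..a})"
      unfolding cdf_def by (subst measure_uniform_measure) simp_all
    consider "a < 0" | "0 \<le> a" "a < 1" | "1 \<le> a" by linarith
    then show "cdf (distr disc_area borel (\<lambda>z. (norm z)\<^sup>2)) a = cdf (uniform_measure lborel {0..1}) a"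
    proof cases
      case 1
      then have e: "{z :: complex. (norm z)\<^sup>2 \<le> a} = {}"
      proof -
        have "\<not> (norm z)\<^sup>2 \<le> a" for z :: complex using zero_le_power2[of "norm z"] 1 by linarith
        then show ?thesis by blast
      qed
      have "{0..1} \<inter> {..a} = {}" using 1 by auto
      then show ?thesis unfolding L R e by simp
    next
      case 2
      have sq: "(norm z)\<^sup>2 \<le> a \<longleftrightarrow> norm z \<le> sqrt a" for z :: complex
        using real_le_rsqrt[of "norm z" a] real_sqrt_le_iff[of "(norm z)\<^sup>2" a] by auto
      define r where "r = sqrt a"
      have "r < 1" using 2 by (simp add: r_def)
      then have e: "{z :: complex. (norm z)\<^sup>2 \<le> a} \<inter> ball 0 1 = cball 0 (sqrt a)"
        unfolding sq r_def[symmetric] by auto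
      have "emeasure lborel (cball 0 (sqrt a) :: complex set) = ennreal (pi * a)"
        using 2 by (subst emeasure_cball) (simp_all add: unit_ball_vol_2)
      then have "cdf (distr disc_area borel (\<lambda>z. (norm z)\<^sup>2)) a = a"
        unfolding L e using 2 by (simp add: ennreal_mult[symmetric])
      moreover have "{0..1} \<inter> {..a} = {0..a}" using 2 by auto
      ultimately show ?thesis unfolding R using 2 by simp
    next
      case 3
      have e: "{z :: complex. (norm z)\<^sup>2 \<le> a} \<inter> ball 0 1 = ball 0 1"
      proof -
        have "(norm z)\<^sup>2 \<le> a" if "norm z < 1" for z :: complex
          using power_le_one[of "norm z" 2] that 3 by simp
        then show ?thesis by auto
      qed
      have "cdf (distr disc_area borel (\<lambda>z. (norm z)\<^sup>2)) a = 1"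
        unfolding L e by (simp add: emeasure_ball unit_ball_vol_2 ennreal_mult[symmetric])
      moreover have "{0..1} \<inter> {..a} = {0..1}" using 3 by auto
      ultimately show ?thesis unfolding R by simp
    qed
  qed
qed

text \<open>For \<beta> > -1 this is the integral of |z|^(2k) against the weighted area measure,
  that is, the squared norm of z^k in one variable; the substitution t = |z|^2 makes it a Beta
  integral.\<close>

definition disc_moment :: "real \<Rightarrow> nat \<Rightarrow> real" where
  "disc_moment \<beta> k = (\<beta> + 1) * Beta (real k + 1) (\<beta> + 1)"

lemma sets_weighted_disc_area [simp, measurable_cong]: "sets (weighted_disc_area \<beta>) = sets borel"
  and space_weighted_disc_area [simp]: "space (weighted_disc_area \<beta>) = UNIV"
  by (simp_all add: weighted_disc_area_def)

lemma nn_integral_disc_moment: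
  assumes \<beta>: "\<beta> > -1"
  shows "(\<integral>\<^sup>+z. ennreal (norm z ^ (2 * k)) \<partial>weighted_disc_area \<beta>) = ennreal (disc_moment \<beta> k)"
proof -
  let ?h = "\<lambda>t. ennreal ((\<beta> + 1) * (1 - t) powr \<beta>) * ennreal (t ^ k)"
  have m [measurable]: "(\<lambda>z. (norm z)\<^sup>2) \<in> borel_measurable disc_area" by measurable
  have "(\<integral>\<^sup>+z. ennreal (norm z ^ (2 * k)) \<partial>weighted_disc_area \<beta>) =
     (\<integral>\<^sup>+z. ?h ((norm z)\<^sup>2) \<partial>disc_area)"
    unfolding weighted_disc_area_def by (subst nn_integral_density) (simp_all add: power_mult)
  also have "\<dots> = (\<integral>\<^sup>+t. ?h t \<partial>distr disc_area borel (\<lambda>z. (norm z)\<^sup>2))"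
    by (rule nn_integral_distr'[symmetric, OF m]) measurable
  also have "\<dots> = (\<integral>\<^sup>+t. ?h t * indicator {0..1} t \<partial>lborel)"
    unfolding distr_disc_area_norm_sq by (subst nn_integral_uniform_measure) (simp_all add: divide_ennreal_def)
  also have "\<dots> = (\<integral>\<^sup>+t. ennreal ((\<beta> + 1) * (t powr (real k + 1 - 1) * (1 - t) powr (\<beta> + 1 - 1))) * indicator {0..1} t \<partial>lborel)"
  proof (rule nn_integral_cong_AE)
    \<comment> \<open>The point t = 0 is set aside because \<open>0 powr 0 = 0\<close> while
      \<open>0 ^ 0 = 1\<close>, so for k = 0 the integrands differ there.\<close>
    have "AE t in lborel. (t::real) \<noteq> 0" by (rule AE_lborel_singleton)
    then show "AE t in lborel. ?h t * indicator {0..1} t =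
      ennreal ((\<beta> + 1) * (t powr (real k + 1 - 1) * (1 - t) powr (\<beta> + 1 - 1))) * indicator {0..1} t"
    proof eventually_elim
      case (elim t)
      show ?case
      proof (cases "t \<in> {0..1}")
        case True
        then have "0 < t" using elim by simp
        then have "t powr (real k + 1 - 1) = t ^ k" by (simp add: powr_realpow)
        then show ?thesis using \<beta> \<open>0 < t\<close> by (simp add: ennreal_mult[symmetric] mult_ac)
      qed simp
    qed
  qed
  also have "\<dots> = ennreal ((\<beta> + 1) * Beta (real k + 1) (\<beta> + 1))"
  proof (rule nn_integral_has_integral_lebesgue')
    show "((\<lambda>t. (\<beta> + 1) * (t powr (real k + 1 - 1) * (1 - t) powr (\<beta> + 1 - 1))) has_integral
       (\<beta> + 1) * Beta (real k + 1) (\<beta> + 1)) {0..1}"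
      by (rule has_integral_mult_right, rule has_integral_Beta_real) (use \<beta> in auto)
  qed (use \<beta> in auto)
  finally show ?thesis by (simp add: disc_moment_def)
qed

lemma disc_moment_pochhammer:
  assumes "\<beta> > -1"
  shows "disc_moment \<beta> k = (\<beta> + 1) * fact k / pochhammer (\<beta> + 1) (k + 1)"
proof -
  have np: "\<beta> + 1 \<notin> \<int>\<^sub>\<le>\<^sub>0" using assms by (auto elim!: nonpos_Ints_cases)
  have "Gamma (\<beta> + 1) \<noteq> 0" using np by (simp add: Gamma_eq_zero_iff)
  moreover have "pochhammer (\<beta> + 1) (k + 1) = Gamma (\<beta> + 1 + of_nat (k + 1)) / Gamma (\<beta> + 1)"
    by (rule pochhammer_Gamma[OF np])
  moreover have "Gamma (real k + 1) = fact k"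
    using Gamma_fact[of k] by (simp add: add.commute)
  ultimately show ?thesis by (simp add: disc_moment_def Beta_def add_ac)
qed

lemma bounded_of_positive_limit:
  fixes X :: "nat \<Rightarrow> real"
  assumes pos: "\<And>k. 0 < X k" and lim: "X \<longlonglongrightarrow> L" and L: "0 < L"
  shows "\<exists>a>0. \<exists>b>0. \<forall>k. a \<le> X k \<and> X k \<le> b"
proof -
  obtain b where b: "0 < b" "\<And>k. norm (X k) \<le> b"
    using convergent_imp_Bseq[OF convergentI[OF lim]] by (auto elim: BseqE)
  have "(\<lambda>k. inverse (X k)) \<longlonglongrightarrow> inverse L" using lim L by (intro tendsto_inverse) auto
  from convergent_imp_Bseq[OF convergentI[OF this]]
  obtain c where c: "0 < c" "\<And>k. norm (inverse (X k)) \<le> c" by (auto elim: BseqE)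
  have "inverse c \<le> X k" for k
  proof -
    have "inverse (X k) \<le> c" using c(2)[of k] pos[of k] by (simp add: abs_of_pos)
    then have "inverse c \<le> inverse (inverse (X k))" using pos[of k] by (intro le_imp_inverse_le) auto
    then show ?thesis by simp
  qed
  moreover have "X k \<le> b" for k using b(2)[of k] by simp
  ultimately show ?thesis using b(1) c(1) by (meson positive_imp_inverse_positive)
qed

text \<open>Multiplied by (k + 1)^s, with s = \<beta> + 1, the moments converge to s Gamma(s) by
  Euler's limit formula. A positive sequence with a positive limit is bounded and bounded away from
  zero.\<close>

lemma disc_moment_bounds:
  assumes \<beta>: "\<beta> > -1"
  shows "\<exists>a>0. \<exists>b>0. \<forall>k. a * real (k + 1) powr - (\<beta> + 1) \<le> disc_moment \<beta> k \<and>
     disc_moment \<beta> k \<le> b * real (k + 1) powr - (\<beta> + 1)"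
proof -
  define s where "s = \<beta> + 1"
  have s: "0 < s" using \<beta> by (simp add: s_def)
  have np: "s \<notin> \<int>\<^sub>\<le>\<^sub>0" using s by (auto elim!: nonpos_Ints_cases)
  define X where "X k = disc_moment \<beta> k * real (k + 1) powr s" for k
  have Xpos: "0 < X k" for k
  proof -
    have "0 < pochhammer s (k + 1)" by (rule pochhammer_pos[OF s])
    then show ?thesis using s disc_moment_pochhammer[OF \<beta>, of k]
      by (simp add: X_def s_def[symmetric])
  qed
  have G: "Gamma_series s \<longlonglongrightarrow> Gamma s" by (rule Gamma_series_LIMSEQ)
  \<comment> \<open>\<open>Gamma_series\<close> carries k^s where the weight has (k + 1)^s; this
    factor, which tends to 1, converts one into the other for k > 0.\<close>
  have q: "(\<lambda>k. (real (k + 1) / real k) powr s) \<longlonglongrightarrow> 1"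
    using s by real_asymp
  have "(\<lambda>k. s * Gamma_series s k * (real (k + 1) / real k) powr s) \<longlonglongrightarrow> s * Gamma s * 1"
    by (intro tendsto_mult tendsto_const G q)
  moreover have "\<forall>\<^sub>F k in sequentially. s * Gamma_series s k * (real (k + 1) / real k) powr s = X k"
    using eventually_gt_at_top[of 0]
  proof eventually_elim
    case (elim k)
    have "exp (s * ln (real k)) * (real (k + 1) / real k) powr s = real (k + 1) powr s"
    proof -
      have e: "exp (s * ln (real k)) = real k powr s" using elim by (simp add: powr_def)
      show ?thesis unfolding e powr_mult[symmetric] using elim by simp
    qed
    then show ?case
      unfolding X_def disc_moment_pochhammer[OF \<beta>] s_def[symmetric] Gamma_series_def
      by (simp add: field_simps)
  qed
  ultimately have "X \<longlonglongrightarrow> s * Gamma s" by (simp add: tendsto_cong)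
  moreover have "0 < s * Gamma s" using s Gamma_real_pos[OF s] by simp
  ultimately have "\<exists>a>0. \<exists>b>0. \<forall>k. a \<le> X k \<and> X k \<le> b"
    by (rule bounded_of_positive_limit[OF Xpos])
  then obtain a b where ab: "0 < a" "0 < b" "\<And>k. a \<le> X k" "\<And>k. X k \<le> b" by auto
  have "a * real (k + 1) powr - s \<le> disc_moment \<beta> k" "disc_moment \<beta> k \<le> b * real (k + 1) powr - s" for k
  proof -
    have p: "0 < real (k + 1) powr s" by simp
    show "a * real (k + 1) powr - s \<le> disc_moment \<beta> k"
      unfolding powr_minus divide_inverse[symmetric] pos_divide_le_eq[OF p] using ab(3)[of k] unfolding X_def .
    show "disc_moment \<beta> k \<le> b * real (k + 1) powr - s"
      unfolding powr_minus divide_inverse[symmetric] pos_le_divide_eq[OF p] using ab(4)[of k] unfolding X_def .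
  qed
  then show ?thesis using ab(1,2) unfolding s_def by blast
qed

lemma prob_space_weighted_disc_area:
  assumes "\<beta> > -1"
  shows "prob_space (weighted_disc_area \<beta>)"
proof (rule prob_spaceI)
  have "disc_moment \<beta> 0 = 1" using assms by (simp add: disc_moment_pochhammer[OF assms])
  then show "emeasure (weighted_disc_area \<beta>) (space (weighted_disc_area \<beta>)) = 1"
    using nn_integral_disc_moment[OF assms, of 0] by simp
qed

section \<open>Torus invariance on the polydisc and the Bergman norm\<close>

lemma nn_integral_weighted_rotate:
  assumes F: "F \<in> borel_measurable borel"
  shows "(\<integral>\<^sup>+z. F (cis t * z) \<partial>weighted_disc_area \<beta>) = (\<integral>\<^sup>+z. F z \<partial>weighted_disc_area \<beta>)"
proof -
  have [measurable]: "(ball 0 1 :: complex set) \<in> sets borel" by simp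
  let ?w = "\<lambda>z. (ennreal (1 / pi) * indicator (ball 0 1) z) * ennreal ((\<beta> + 1) * (1 - (norm z)\<^sup>2) powr \<beta>)"
  have dens: "(\<integral>\<^sup>+z. H z \<partial>weighted_disc_area \<beta>) = (\<integral>\<^sup>+z. ?w z * H z \<partial>lborel)"
    if H [measurable]: "H \<in> borel_measurable borel" for H
  proof -
    have "(\<integral>\<^sup>+z. H z \<partial>weighted_disc_area \<beta>) =
       (\<integral>\<^sup>+z. ennreal ((\<beta> + 1) * (1 - (norm z)\<^sup>2) powr \<beta>) * H z \<partial>disc_area)"
      unfolding weighted_disc_area_def by (rule nn_integral_density) measurable
    also have "\<dots> = (\<integral>\<^sup>+z. (ennreal (1 / pi) * indicator (ball 0 1) z) *
       (ennreal ((\<beta> + 1) * (1 - (norm z)\<^sup>2) powr \<beta>) * H z) \<partial>lborel)"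
      unfolding disc_area_def by (rule nn_integral_density) measurable
    finally show ?thesis by (simp only: mult.assoc)
  qed
  have cont: "continuous_on UNIV (\<lambda>z. cis t * z)" by (intro continuous_intros)
  have rot [measurable]: "(\<lambda>z. F (cis t * z)) \<in> borel_measurable borel"
    by (rule measurable_compose[OF borel_measurable_continuous_onI[OF cont] F])
  have w: "?w (cis t * z) = ?w z" for z
    by (simp add: norm_mult indicator_def)
  have [measurable]: "(\<lambda>z. ?w z * F z) \<in> borel_measurable borel" using F by measurable
  show ?thesis
    unfolding dens[OF rot] dens[OF F]
    by (subst nn_integral_rotate[symmetric, of "\<lambda>z. ?w z * F z" t]) (simp_all only: w, measurable)
qed

lemma product_prob_space_weighted:
  "\<beta> > -1 \<Longrightarrow> product_prob_space (\<lambda>_. weighted_disc_area \<beta>)"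
  by (rule product_prob_spaceI) (rule prob_space_weighted_disc_area)

lemma measurable_vec_lambda_weighted:
  "(vec_lambda :: _ \<Rightarrow> complex ^ 'd) \<in> measurable (Pi\<^sub>M UNIV (\<lambda>_::'d. weighted_disc_area \<beta>)) borel"
proof (rule borel_measurable_vecI)
  fix i :: 'd
  have "(\<lambda>x. x i) \<in> measurable (Pi\<^sub>M UNIV (\<lambda>_::'d. weighted_disc_area \<beta>)) (weighted_disc_area \<beta>)"
    by (rule measurable_component_singleton) simp
  then show "(\<lambda>x. (vec_lambda x :: complex ^ 'd) $ i) \<in> borel_measurable (Pi\<^sub>M UNIV (\<lambda>_::'d. weighted_disc_area \<beta>))"
    unfolding vec_lambda_inverse[OF UNIV_I] by (simp cong: measurable_cong_sets)
qed

text \<open>A product measure is determined by product sets, and on these the rotation acts factor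
  by factor. So invariance reduces to one variable, where the density depends on |z| only.\<close>

lemma nn_integral_vec_power_rotate:
  fixes g :: "complex ^ 'd \<Rightarrow> ennreal"
  assumes \<beta>: "\<beta> > -1" and g: "g \<in> borel_measurable borel"
  shows "(\<integral>\<^sup>+z. g (rot \<theta> z) \<partial>vec_power_measure (weighted_disc_area \<beta>)) =
     (\<integral>\<^sup>+z. g z \<partial>vec_power_measure (weighted_disc_area \<beta>))"
proof -
  let ?M = "weighted_disc_area \<beta>" and ?P = "Pi\<^sub>M UNIV (\<lambda>_::'d. weighted_disc_area \<beta>)"
  interpret P: product_prob_space "\<lambda>_::'d. weighted_disc_area \<beta>" UNIV
    by (rule product_prob_space_weighted[OF \<beta>])
  let ?T = "\<lambda>x. (\<lambda>i\<in>UNIV. cis (\<theta> i) * x i)"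
  have rot1: "(\<lambda>w. cis t * w) \<in> measurable ?M ?M" for t
    by (simp cong: measurable_cong_sets)
  have T: "?T \<in> measurable ?P ?P"
  proof (rule measurable_restrict)
    fix i :: 'd
    have "(\<lambda>x. x i) \<in> measurable ?P ?M" by (rule measurable_component_singleton) simp
    from measurable_compose[OF this rot1]
    show "(\<lambda>x. cis (\<theta> i) * x i) \<in> measurable ?P ?M" .
  qed
  have inv: "distr ?P ?P ?T = ?P"
  proof (rule P.PiM_eqI[OF finite])
    fix A :: "'d \<Rightarrow> complex set" assume A: "\<And>i. i \<in> UNIV \<Longrightarrow> A i \<in> sets ?M"
    have sA: "(\<lambda>w. cis (\<theta> i) * w) -` A i \<in> sets ?M" for i
      using measurable_sets[OF rot1 A[of i]] by simp
    have "emeasure (distr ?P ?P ?T) (PiE UNIV A) = emeasure ?P (?T -` (PiE UNIV A) \<inter> space ?P)"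
      by (rule emeasure_distr[OF T]) (intro sets_PiM_I_finite finite A)
    also have "?T -` (PiE UNIV A) \<inter> space ?P = PiE UNIV (\<lambda>i. (\<lambda>w. cis (\<theta> i) * w) -` A i)"
      by (auto simp: space_PiM PiE_UNIV_domain)
    also have "emeasure ?P \<dots> = (\<Prod>i\<in>UNIV. emeasure ?M ((\<lambda>w. cis (\<theta> i) * w) -` A i))"
      by (rule P.emeasure_PiM) (simp_all only: finite sA)
    also have "\<dots> = (\<Prod>i\<in>UNIV. emeasure ?M (A i))"
    proof (rule prod.cong[OF refl])
      fix i
      have "emeasure ?M ((\<lambda>w. cis (\<theta> i) * w) -` A i) = (\<integral>\<^sup>+w. indicator (A i) (cis (\<theta> i) * w) \<partial>?M)"
        by (subst nn_integral_indicator[OF sA, symmetric]) (auto intro!: nn_integral_cong simp: indicator_def)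
      also have "\<dots> = (\<integral>\<^sup>+w. indicator (A i) w \<partial>?M)"
        by (rule nn_integral_weighted_rotate) (use A[of i] in simp)
      also have "\<dots> = emeasure ?M (A i)" by (rule nn_integral_indicator) (use A[of i] in simp)
      finally show "emeasure ?M ((\<lambda>w. cis (\<theta> i) * w) -` A i) = emeasure ?M (A i)" .
    qed
    finally show "emeasure (distr ?P ?P ?T) (PiE UNIV A) = (\<Prod>i\<in>UNIV. emeasure ?M (A i))" .
  qed simp
  note vl = measurable_vec_lambda_weighted[where 'd = 'd, of \<beta>]
  have contR: "continuous_on UNIV (\<lambda>z :: complex ^ 'd. rot \<theta> z)"
    unfolding rot_def by (intro continuous_intros)
  have gR: "(\<lambda>z. g (rot \<theta> z)) \<in> borel_measurable borel"
    by (rule measurable_compose[OF borel_measurable_continuous_onI[OF contR] g])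
  have "(\<integral>\<^sup>+z. g (rot \<theta> z) \<partial>vec_power_measure ?M) = (\<integral>\<^sup>+x. g (rot \<theta> (vec_lambda x)) \<partial>?P)"
    unfolding vec_power_measure_def by (rule nn_integral_distr'[OF vl gR])
  also have "\<dots> = (\<integral>\<^sup>+x. g (vec_lambda (?T x)) \<partial>?P)"
    by (simp add: rot_def vec_lambda_inverse restrict_UNIV)
  also have "\<dots> = (\<integral>\<^sup>+x. g (vec_lambda x) \<partial>distr ?P ?P ?T)"
    by (rule nn_integral_distr'[symmetric, OF T measurable_compose[OF vl g]])
  also have "\<dots> = (\<integral>\<^sup>+z. g z \<partial>vec_power_measure ?M)"
    unfolding inv vec_power_measure_def by (rule nn_integral_distr'[symmetric, OF vl g])
  finally show ?thesis .
qed

lemma nn_integral_vec_power_mono: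
  assumes \<beta>: "\<beta> > -1"
  shows "(\<integral>\<^sup>+z. ennreal ((norm (zpow z n))\<^sup>2) * indicator polydisc z \<partial>vec_power_measure (weighted_disc_area \<beta>))
     = ennreal (\<Prod>i\<in>(UNIV :: 'd::finite set). disc_moment \<beta> (n i))"
proof -
  let ?M = "weighted_disc_area \<beta>" and ?P = "Pi\<^sub>M UNIV (\<lambda>_::'d. weighted_disc_area \<beta>)"
  interpret P: product_prob_space "\<lambda>_::'d. weighted_disc_area \<beta>" UNIV
    by (rule product_prob_space_weighted[OF \<beta>])
  let ?f = "\<lambda>i w. ennreal (norm w ^ (2 * n i)) * indicator (ball 0 1) w"
  have eq: "ennreal ((norm (zpow z n))\<^sup>2) * indicator polydisc z = (\<Prod>i\<in>UNIV. ?f i (z $ i))" for z :: "complex ^ 'd"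
  proof -
    have "indicator polydisc z = (\<Prod>i\<in>UNIV. indicator (ball 0 1) (z $ i) :: ennreal)"
    proof (cases "z \<in> polydisc")
      case False
      then obtain i where "\<not> norm (z $ i) < 1" by (auto simp: polydisc_def)
      then have "(\<Prod>i\<in>UNIV. indicator (ball 0 1) (z $ i) :: ennreal) = 0"
        by (intro prod_zero bexI[of _ i]) auto
      then show ?thesis using False by simp
    qed (simp add: polydisc_def)
    then show ?thesis
      unfolding norm_zpow_sq by (simp add: prod.distrib prod_ennreal)
  qed
  have [measurable]: "(ball 0 1 :: complex set) \<in> sets borel" by simp
  have meas: "(\<lambda>z :: complex ^ 'd. ennreal ((norm (zpow z n))\<^sup>2) * indicator polydisc z) \<in> borel_measurable borel"
    unfolding eq by measurable
  have "(\<integral>\<^sup>+z. ennreal ((norm (zpow z n))\<^sup>2) * indicator polydisc z \<partial>vec_power_measure ?M) =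
    (\<integral>\<^sup>+x. ennreal ((norm (zpow (vec_lambda x) n))\<^sup>2) * indicator polydisc (vec_lambda x :: complex ^ 'd) \<partial>?P)"
    unfolding vec_power_measure_def by (rule nn_integral_distr'[OF measurable_vec_lambda_weighted meas])
  also have "\<dots> = (\<integral>\<^sup>+x. (\<Prod>i\<in>UNIV. ?f i (x i)) \<partial>?P)"
    by (simp only: eq vec_lambda_inverse[OF UNIV_I])
  also have "\<dots> = (\<Prod>i\<in>UNIV. \<integral>\<^sup>+w. ?f i w \<partial>?M)"
    by (rule P.product_nn_integral_prod) simp_all
  also have "\<dots> = (\<Prod>i\<in>UNIV. ennreal (disc_moment \<beta> (n i)))"
  proof (rule prod.cong[OF refl])
    fix i
    have "AE w in ?M. w \<in> ball 0 1"
      unfolding weighted_disc_area_def disc_area_def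
      by (auto simp: AE_density indicator_def split: if_splits intro!: AE_I2)
    then have "(\<integral>\<^sup>+w. ?f i w \<partial>?M) = (\<integral>\<^sup>+w. ennreal (norm w ^ (2 * n i)) \<partial>?M)"
      by (intro nn_integral_cong_AE) (auto elim: eventually_mono)
    then show "(\<integral>\<^sup>+w. ?f i w \<partial>?M) = ennreal (disc_moment \<beta> (n i))"
      by (simp only: nn_integral_disc_moment[OF \<beta>])
  qed
  also have "\<dots> = ennreal (\<Prod>i\<in>UNIV. disc_moment \<beta> (n i))"
  proof (rule prod_ennreal)
    fix i
    show "0 \<le> disc_moment \<beta> (n i)"
      using disc_moment_bounds[OF \<beta>] by (meson less_imp_le mult_nonneg_nonneg order.trans powr_ge_zero)
  qed
  finally show ?thesis .
qed

lemma measurable_rot_pair: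
  "(\<lambda>(\<theta>, z). rot \<theta> z :: complex ^ 'd) \<in> borel_measurable (torus_measure UNIV \<Otimes>\<^sub>M borel)"
  unfolding case_prod_unfold
proof (rule borel_measurable_vecI)
  fix i :: 'd
  have 1 [measurable]: "(\<lambda>\<theta>. \<theta> i) \<in> borel_measurable (torus_measure UNIV)"
    using measurable_component_singleton[of i UNIV "\<lambda>_. borel :: real measure"]
    by (simp cong: measurable_cong_sets add: sets_torus_measure)
  have "(\<lambda>p. cis (fst p i) * snd p $ i) \<in> borel_measurable (torus_measure UNIV \<Otimes>\<^sub>M (borel :: (complex ^ 'd) measure))"
    by measurable
  then show "(\<lambda>p. rot (fst p) (snd p :: complex ^ 'd) $ i) \<in> borel_measurable (torus_measure UNIV \<Otimes>\<^sub>M borel)"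
    by (simp add: rot_def)
qed

text \<open>By invariance the integrand may be replaced by its average over the torus. After Tonelli
  the inner integral is given by Parseval, and integrating the resulting sum termwise leaves moments
  only. All integrands are nonnegative, so the identity holds for infinite norms as well.\<close>

lemma bergman_norm_sq_power_series:
  fixes f :: "complex ^ 'd \<Rightarrow> complex"
  assumes \<beta>: "\<beta> > -1" and f: "f holo_on polydisc" and c: "has_power_series f c"
  shows "bergman_norm_sq \<beta> f =
     (\<integral>\<^sup>+n. ennreal ((norm (c n))\<^sup>2 * (\<Prod>i\<in>UNIV. disc_moment \<beta> (n i))) \<partial>count_space UNIV)"
proof -
  let ?V = "vec_power_measure (weighted_disc_area \<beta>) :: (complex ^ 'd) measure"
  let ?S = "torus_measure (UNIV :: 'd set)"
  interpret P: product_prob_space "\<lambda>_::'d. weighted_disc_area \<beta>" UNIV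
    by (rule product_prob_space_weighted[OF \<beta>])
  interpret S: prob_space ?S by (rule prob_space_torus)
  interpret V: prob_space ?V
    unfolding vec_power_measure_def
    by (rule prob_space.prob_space_distr[OF P.prob_space_axioms measurable_vec_lambda_weighted])
  interpret SV: pair_sigma_finite ?S ?V ..
  have setsV [measurable_cong]: "sets ?V = sets borel" by (simp add: vec_power_measure_def)
  let ?f0 = "\<lambda>z. if z \<in> polydisc then f z else 0"
  define g where "g z = ennreal ((norm (?f0 z))\<^sup>2)" for z
  have g: "g \<in> borel_measurable borel"
    unfolding g_def using borel_measurable_holo[OF f] by measurable
  have gpair: "(\<lambda>(\<theta>, z). g (rot \<theta> z)) \<in> borel_measurable (?S \<Otimes>\<^sub>M ?V)"
  proof -
    have "(\<lambda>p. g (case p of (\<theta>, z) \<Rightarrow> rot \<theta> z)) \<in> borel_measurable (?S \<Otimes>\<^sub>M borel)"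
      by (rule measurable_compose[OF measurable_rot_pair g])
    moreover have "sets (?S \<Otimes>\<^sub>M ?V) = sets (?S \<Otimes>\<^sub>M (borel :: (complex ^ 'd) measure))"
      by (rule sets_pair_measure_cong) (simp_all add: setsV)
    ultimately show ?thesis
      by (simp add: case_prod_unfold cong: measurable_cong_sets)
  qed
  have inner: "(\<integral>\<^sup>+\<theta>. g (rot \<theta> z) \<partial>?S) =
     (\<integral>\<^sup>+n. ennreal ((norm (c n))\<^sup>2) * (ennreal ((norm (zpow z n))\<^sup>2) * indicator polydisc z) \<partial>count_space UNIV)" for z
  proof (cases "z \<in> polydisc")
    case True
    have "rot \<theta> z \<in> polydisc" for \<theta>
      using True unfolding polydisc_def by (simp add: rot_def norm_mult)
    then have "(\<integral>\<^sup>+\<theta>. g (rot \<theta> z) \<partial>?S) = (\<integral>\<^sup>+\<theta>. ennreal ((norm (f (rot \<theta> z)))\<^sup>2) \<partial>?S)"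
      by (simp add: g_def)
    also have "\<dots> = (\<integral>\<^sup>+n. ennreal ((norm (c n))\<^sup>2 * (norm (zpow z n))\<^sup>2) \<partial>count_space UNIV)"
      by (rule nn_integral_torus_power_series[OF f c True])
    finally show ?thesis using True by (simp add: ennreal_mult)
  next
    case False
    then have "rot \<theta> z \<notin> polydisc" for \<theta>
      unfolding polydisc_def by (simp add: rot_def norm_mult)
    then show ?thesis using False by (simp add: g_def)
  qed
  have zm: "(\<lambda>z :: complex ^ 'd. zpow z n) \<in> borel_measurable borel" for n
    unfolding zpow_def by measurable
  have pm: "(polydisc :: (complex ^ 'd) set) \<in> sets borel" by (rule borel_open[OF open_polydisc])
  have "bergman_norm_sq \<beta> f = (\<integral>\<^sup>+z. g z \<partial>?V)"
    unfolding bergman_norm_sq_def g_def by (rule nn_integral_cong) (simp add: indicator_def)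
  also have "\<dots> = (\<integral>\<^sup>+\<theta>. (\<integral>\<^sup>+z. g (rot \<theta> z) \<partial>?V) \<partial>?S)"
    unfolding nn_integral_vec_power_rotate[OF \<beta> g] by (simp add: S.emeasure_space_1)
  also have "\<dots> = (\<integral>\<^sup>+z. (\<integral>\<^sup>+\<theta>. g (rot \<theta> z) \<partial>?S) \<partial>?V)"
    by (rule SV.Fubini'[symmetric, OF gpair])
  also have "\<dots> = (\<integral>\<^sup>+n. (\<integral>\<^sup>+z. ennreal ((norm (c n))\<^sup>2) * (ennreal ((norm (zpow z n))\<^sup>2) * indicator polydisc z) \<partial>?V) \<partial>count_space UNIV)"
    unfolding inner
  proof (rule nn_integral_count_space_nn_integral)
    show "(\<lambda>z. ennreal ((norm (c n))\<^sup>2) * (ennreal ((norm (zpow z n))\<^sup>2) * indicator polydisc z)) \<in> borel_measurable ?V" for n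
      using zm[of n] pm by measurable
  qed simp
  also have "\<dots> = (\<integral>\<^sup>+n. ennreal ((norm (c n))\<^sup>2) * ennreal (\<Prod>i\<in>UNIV. disc_moment \<beta> (n i)) \<partial>count_space UNIV)"
  proof (rule nn_integral_cong)
    fix n
    have "(\<lambda>z. ennreal ((norm (zpow z n))\<^sup>2) * indicator polydisc z) \<in> borel_measurable ?V"
      using zm[of n] pm by measurable
    then show "(\<integral>\<^sup>+z. ennreal ((norm (c n))\<^sup>2) * (ennreal ((norm (zpow z n))\<^sup>2) * indicator polydisc z) \<partial>?V) =
       ennreal ((norm (c n))\<^sup>2) * ennreal (\<Prod>i\<in>UNIV. disc_moment \<beta> (n i))"
      by (subst nn_integral_cmult) (simp_all only: nn_integral_vec_power_mono[OF \<beta>])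
  qed
  also have "\<dots> = (\<integral>\<^sup>+n. ennreal ((norm (c n))\<^sup>2 * (\<Prod>i\<in>UNIV. disc_moment \<beta> (n i))) \<partial>count_space UNIV)"
    by (simp add: ennreal_mult')
  finally show ?thesis .
qed

definition coeff_norm_sq :: "real \<Rightarrow> (('d::finite \<Rightarrow> nat) \<Rightarrow> complex) \<Rightarrow> ennreal" where
  "coeff_norm_sq s c = (\<integral>\<^sup>+n. ennreal ((norm (c n))\<^sup>2 * wt n powr - s) \<partial>count_space UNIV)"

text \<open>The constants do not depend on f, which is what lets operator bounds and matrix bounds
  be exchanged. In the Hardy case the weight is 1 and equality holds; otherwise the one-variable
  moment bounds are multiplied over the coordinates, whence the powers with exponent
  \<open>CARD('d)\<close>.\<close>

lemma A2_norm_sq_equiv: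
  assumes \<beta>: "\<beta> \<ge> -1"
  shows "\<exists>a>0. \<exists>b>0. \<forall>(f :: complex ^ 'd \<Rightarrow> complex) c. f holo_on polydisc \<longrightarrow> has_power_series f c \<longrightarrow>
     ennreal a * coeff_norm_sq (\<beta> + 1) c \<le> A2_norm_sq \<beta> f \<and>
     A2_norm_sq \<beta> f \<le> ennreal b * coeff_norm_sq (\<beta> + 1) c"
proof (cases "\<beta> = -1")
  case True
  have "wt n powr - (\<beta> + 1) = 1" for n :: "'d \<Rightarrow> nat" using wt_pos[of n] True by simp
  then have "A2_norm_sq \<beta> f = coeff_norm_sq (\<beta> + 1) c"
    if "f holo_on polydisc" "has_power_series f c" for f :: "complex ^ 'd \<Rightarrow> complex" and c
    using hardy_norm_sq_power_series[OF that] True by (simp add: A2_norm_sq_def coeff_norm_sq_def)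
  then show ?thesis by (intro exI[of _ 1] conjI allI impI) simp_all
next
  case False
  then have b': "\<beta> > -1" using \<beta> by simp
  obtain a b where ab: "0 < a" "0 < b" and lo: "\<And>k. a * real (k + 1) powr - (\<beta> + 1) \<le> disc_moment \<beta> k"
    and up: "\<And>k. disc_moment \<beta> k \<le> b * real (k + 1) powr - (\<beta> + 1)"
    using disc_moment_bounds[OF b'] by blast
  have nn: "0 \<le> disc_moment \<beta> k" for k
    by (rule order.trans[OF _ lo]) (use ab in simp)
  have lo': "a ^ CARD('d) * wt n powr - (\<beta> + 1) \<le> (\<Prod>i\<in>UNIV. disc_moment \<beta> (n i))" for n :: "'d \<Rightarrow> nat"
  proof -
    have "a ^ CARD('d) * wt n powr - (\<beta> + 1) = (\<Prod>i\<in>UNIV. a * real (n i + 1) powr - (\<beta> + 1))"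
      by (simp only: wt_powr prod.distrib prod_constant)
    also have "\<dots> \<le> (\<Prod>i\<in>UNIV. disc_moment \<beta> (n i))"
      using ab by (intro prod_mono conjI lo) auto
    finally show ?thesis .
  qed
  have up': "(\<Prod>i\<in>UNIV. disc_moment \<beta> (n i)) \<le> b ^ CARD('d) * wt n powr - (\<beta> + 1)" for n :: "'d \<Rightarrow> nat"
  proof -
    have "(\<Prod>i\<in>UNIV. disc_moment \<beta> (n i)) \<le> (\<Prod>i\<in>UNIV. b * real (n i + 1) powr - (\<beta> + 1))"
      by (intro prod_mono conjI up nn)
    also have "\<dots> = b ^ CARD('d) * wt n powr - (\<beta> + 1)"
      by (simp only: wt_powr prod.distrib prod_constant)
    finally show ?thesis .
  qed
  have cmul: "ennreal r * coeff_norm_sq (\<beta> + 1) c =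
      (\<integral>\<^sup>+n. ennreal ((norm (c n))\<^sup>2 * (r * wt n powr - (\<beta> + 1))) \<partial>count_space UNIV)"
    if "0 \<le> r" for r and c :: "('d \<Rightarrow> nat) \<Rightarrow> complex"
    unfolding coeff_norm_sq_def
    by (subst nn_integral_cmult[symmetric]) (simp_all only: ennreal_mult'[OF that, symmetric] mult.left_commute, simp_all)
  show ?thesis
  proof (rule exI[of _ "a ^ CARD('d)"], intro conjI, goal_cases)
    case 2
    show ?case
    proof (rule exI[of _ "b ^ CARD('d)"], intro conjI allI impI)
    fix f :: "complex ^ 'd \<Rightarrow> complex" and c assume f: "f holo_on polydisc" and c: "has_power_series f c"
    have eq: "A2_norm_sq \<beta> f = (\<integral>\<^sup>+n. ennreal ((norm (c n))\<^sup>2 * (\<Prod>i\<in>UNIV. disc_moment \<beta> (n i))) \<partial>count_space UNIV)"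
      using bergman_norm_sq_power_series[OF b' f c] False by (simp add: A2_norm_sq_def)
    show "ennreal (a ^ CARD('d)) * coeff_norm_sq (\<beta> + 1) c \<le> A2_norm_sq \<beta> f"
      unfolding eq cmul[OF zero_le_power[OF less_imp_le[OF ab(1)]]]
      by (intro nn_integral_mono ennreal_leI mult_left_mono lo' zero_le_power2)
    show "A2_norm_sq \<beta> f \<le> ennreal (b ^ CARD('d)) * coeff_norm_sq (\<beta> + 1) c"
      unfolding eq cmul[OF zero_le_power[OF less_imp_le[OF ab(2)]]]
      by (intro nn_integral_mono ennreal_leI mult_left_mono up' zero_le_power2)
    qed (use ab in simp_all)
  qed (use ab in simp)
qed

section \<open>Composition operators\<close>

lemma coeff_norm_sq_finite_support:
  fixes x :: "('d::finite \<Rightarrow> nat) \<Rightarrow> complex"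
  assumes "finite F"
  shows "coeff_norm_sq s (\<lambda>n. if n \<in> F then x n else 0) = ennreal (\<Sum>n\<in>F. (norm (x n))\<^sup>2 * wt n powr - s)"
  unfolding coeff_norm_sq_def
proof (rule nn_integral_count_has_sum)
  show "((\<lambda>n. (norm (if n \<in> F then x n else 0))\<^sup>2 * wt n powr - s) has_sum
     (\<Sum>n\<in>F. (norm (x n))\<^sup>2 * wt n powr - s)) UNIV"
    by (rule has_sum_finite_neutralI[OF assms]) auto
qed simp

text \<open>The operator is tested on the polynomial with coefficients \<open>x\<close> on
  \<open>F\<close>. The coefficients of its image are the entries of the matrix product, and those
  with index in \<open>G\<close> contribute at most the full norm.\<close>

lemma composition_bounded_imp_matrix_bounded:
  fixes \<phi> :: "complex ^ 'd \<Rightarrow> complex ^ 'd"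
  assumes \<phi>: "holo_self_map \<phi>" and t: "\<And>n. has_power_series (\<lambda>z. zpow (\<phi> z) n) (t n)"
    and \<beta>: "\<beta>\<^sub>1 \<ge> -1" "\<beta>\<^sub>2 \<ge> -1" and cb: "composition_bounded \<phi> \<beta>\<^sub>1 \<beta>\<^sub>2"
  shows "matrix_bounded t (\<beta>\<^sub>1 + 1) (\<beta>\<^sub>2 + 1)"
proof -
  have hol: "(\<lambda>z. \<phi> z $ j) holo_on polydisc" for j using \<phi> unfolding holo_self_map_def by blast
  obtain b1 where b1: "0 < b1" and N1: "\<And>(f :: complex ^ 'd \<Rightarrow> complex) c. f holo_on polydisc \<Longrightarrow> has_power_series f c \<Longrightarrow>
      A2_norm_sq \<beta>\<^sub>1 f \<le> ennreal b1 * coeff_norm_sq (\<beta>\<^sub>1 + 1) c"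
    using A2_norm_sq_equiv[OF \<beta>(1)] by metis
  obtain a2 where a2: "0 < a2" and N2: "\<And>(f :: complex ^ 'd \<Rightarrow> complex) c. f holo_on polydisc \<Longrightarrow> has_power_series f c \<Longrightarrow>
      ennreal a2 * coeff_norm_sq (\<beta>\<^sub>2 + 1) c \<le> A2_norm_sq \<beta>\<^sub>2 f"
    using A2_norm_sq_equiv[OF \<beta>(2)] by metis
  obtain K where maps: "\<And>f. f \<in> A2 \<beta>\<^sub>1 \<Longrightarrow> f \<circ> \<phi> \<in> A2 \<beta>\<^sub>2"
    and K: "\<And>f. f \<in> A2 \<beta>\<^sub>1 \<Longrightarrow> A2_norm \<beta>\<^sub>2 (f \<circ> \<phi>) \<le> K * A2_norm \<beta>\<^sub>1 f"
    using cb unfolding composition_bounded_def by blast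
  show ?thesis unfolding matrix_bounded_def
  proof (intro exI[of _ "K\<^sup>2 * b1 / a2"] conjI allI impI)
    show "0 \<le> K\<^sup>2 * b1 / a2" using a2 b1 by simp
    fix F G :: "('d \<Rightarrow> nat) set" and x :: "('d \<Rightarrow> nat) \<Rightarrow> complex"
    assume F: "finite F" and G: "finite G"
    define P where "P z = (\<Sum>n\<in>F. x n * zpow z n)" for z :: "complex ^ 'd"
    define S where "S = (\<Sum>n\<in>F. (norm (x n))\<^sup>2 * wt n powr - (\<beta>\<^sub>1 + 1))"
    let ?y = "\<lambda>m. \<Sum>n\<in>F. x n * t n m"
    let ?L = "\<Sum>m\<in>G. (norm (?y m))\<^sup>2 * wt m powr - (\<beta>\<^sub>2 + 1)"
    have S: "0 \<le> S" unfolding S_def by (intro sum_nonneg) simp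
    have Pholo: "P holo_on polydisc"
      unfolding P_def[abs_def] by (rule holo_on_polynomial[OF F]) (rule holo_on_nth)
    have Pps: "has_power_series P (\<lambda>n. if n \<in> F then x n else 0)"
      unfolding P_def[abs_def] by (rule has_power_series_polynomial[OF F])
    have Pnorm: "A2_norm_sq \<beta>\<^sub>1 P \<le> ennreal (b1 * S)"
      using N1[OF Pholo Pps] b1 unfolding coeff_norm_sq_finite_support[OF F] S_def by (simp add: ennreal_mult')
    then have "A2_norm_sq \<beta>\<^sub>1 P < \<infinity>" by (rule le_less_trans) simp
    then have PA: "P \<in> A2 \<beta>\<^sub>1" using Pholo by (simp add: A2_def)
    have comp: "P \<circ> \<phi> = (\<lambda>z. \<Sum>n\<in>F. x n * zpow (\<phi> z) n)" by (auto simp: P_def)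
    have Cholo: "(P \<circ> \<phi>) holo_on polydisc" unfolding comp by (rule holo_on_polynomial[OF F hol])
    have Cps: "has_power_series (P \<circ> \<phi>) ?y" unfolding comp by (rule has_power_series_sum[OF F t])
    let ?X = "A2_norm_sq \<beta>\<^sub>2 (P \<circ> \<phi>)"
    have fin: "?X < \<infinity>" using maps[OF PA] by (simp add: A2_def)
    have "ennreal ?L = (\<Sum>m\<in>G. ennreal ((norm (?y m))\<^sup>2 * wt m powr - (\<beta>\<^sub>2 + 1)))"
      by (rule sum_ennreal[symmetric]) simp
    also have "\<dots> \<le> coeff_norm_sq (\<beta>\<^sub>2 + 1) ?y"
      unfolding coeff_norm_sq_def by (rule sum_le_nn_integral_count[OF G])
    finally have "ennreal a2 * ennreal ?L \<le> ennreal a2 * coeff_norm_sq (\<beta>\<^sub>2 + 1) ?y"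
      by (rule mult_left_mono) simp
    also have "\<dots> \<le> ?X" by (rule N2[OF Cholo Cps])
    \<comment> \<open>\<open>enn2real\<close> sends infinity to 0, so the real inequality between
      norms says nothing about an infinite norm. Finiteness comes from the separate clause that the
      image lies in the target space.\<close>
    also have "?X = ennreal (enn2real ?X)" using fin by (simp add: less_top)
    finally have "ennreal (a2 * ?L) \<le> ennreal (enn2real ?X)" using a2 by (simp only: ennreal_mult' less_imp_le)
    then have 1: "a2 * ?L \<le> enn2real ?X" by (simp only: ennreal_le_iff enn2real_nonneg)
    have "sqrt (enn2real ?X) \<le> K * sqrt (enn2real (A2_norm_sq \<beta>\<^sub>1 P))"
      using K[OF PA] by (simp only: A2_norm_def)
    from power_mono[OF this, of 2] have "enn2real ?X \<le> K\<^sup>2 * enn2real (A2_norm_sq \<beta>\<^sub>1 P)"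
      by (simp add: power_mult_distrib)
    also have "\<dots> \<le> K\<^sup>2 * (b1 * S)"
      by (intro mult_left_mono enn2real_leI Pnorm) (use b1 S in simp_all)
    finally have "a2 * ?L \<le> K\<^sup>2 * (b1 * S)" using 1 by linarith
    then show "?L \<le> K\<^sup>2 * b1 / a2 * (\<Sum>n\<in>F. (norm (x n))\<^sup>2 * wt n powr - (\<beta>\<^sub>1 + 1))"
      using a2 unfolding S_def[symmetric] by (simp add: field_simps)
  qed
qed

text \<open>Cubes are cofinal among finite sets of multi-indices. An unordered sum is thus the limit
  of a genuine sequence of partial sums, as Fatou's lemma requires.\<close>

lemma filterlim_boxes:
  "filterlim (\<lambda>k. {n :: 'd::finite \<Rightarrow> nat. n \<le> (\<lambda>_. k)}) (finite_subsets_at_top UNIV) sequentially"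
  unfolding filterlim_iff eventually_finite_subsets_at_top
proof (intro allI impI)
  fix P :: "('d \<Rightarrow> nat) set \<Rightarrow> bool"
  assume "\<exists>X. finite X \<and> X \<subseteq> UNIV \<and> (\<forall>Y. finite Y \<and> X \<subseteq> Y \<and> Y \<subseteq> UNIV \<longrightarrow> P Y)"
  then obtain X where X': "finite X \<and> X \<subseteq> UNIV \<and> (\<forall>Y. finite Y \<and> X \<subseteq> Y \<and> Y \<subseteq> UNIV \<longrightarrow> P Y)" ..
  then have X: "finite X" by simp
  from X' have P: "P Y" if "finite Y" "X \<subseteq> Y" for Y using that by simp
  let ?k = "\<Sum>n\<in>X. \<Sum>i\<in>UNIV. n i"
  have "n i \<le> ?k" if "n \<in> X" for n i
  proof -
    have "n i \<le> (\<Sum>i\<in>UNIV. n i)" by (rule member_le_sum[of i UNIV n]) simp_all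
    also have "\<dots> \<le> ?k" by (rule member_le_sum[of n X "\<lambda>n. \<Sum>i\<in>UNIV. n i"]) (use that X in simp_all)
    finally show ?thesis .
  qed
  note le = this
  have "P {n. n \<le> (\<lambda>_. k)}" if "?k \<le> k" for k
    by (rule P[OF finite_below]) (simp add: subset_eq le_fun_def order.trans[OF le that])
  then show "\<forall>\<^sub>F k in sequentially. P {n. n \<le> (\<lambda>_. k)}"
    by (rule eventually_mono[OF eventually_ge_at_top[of ?k]])
qed

text \<open>The partial sums of f \<circ> \<phi> in powers of \<phi> have norms bounded uniformly
  through the matrix and converge pointwise on the polydisc. With
  \<open>\<beta>\<^sub>2 > -1\<close> the target norm is a single integral, so Fatou's lemma
  transfers the bound to f \<circ> \<phi>.\<close>

lemma matrix_bounded_imp_composition_bounded: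
  fixes \<phi> :: "complex ^ 'd \<Rightarrow> complex ^ 'd"
  assumes \<phi>: "holo_self_map \<phi>" and t: "\<And>n. has_power_series (\<lambda>z. zpow (\<phi> z) n) (t n)"
    and \<beta>: "\<beta>\<^sub>1 \<ge> -1" "\<beta>\<^sub>2 > -1" and mb: "matrix_bounded t (\<beta>\<^sub>1 + 1) (\<beta>\<^sub>2 + 1)"
  shows "composition_bounded \<phi> \<beta>\<^sub>1 \<beta>\<^sub>2"
proof -
  have hol: "(\<lambda>z. \<phi> z $ j) holo_on polydisc" for j using \<phi> unfolding holo_self_map_def by blast
  have maps: "\<phi> z \<in> polydisc" if "z \<in> polydisc" for z using \<phi> that unfolding holo_self_map_def by blast
  obtain a1 where a1: "0 < a1" and N1: "\<And>(f :: complex ^ 'd \<Rightarrow> complex) c. f holo_on polydisc \<Longrightarrow> has_power_series f c \<Longrightarrow>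
      ennreal a1 * coeff_norm_sq (\<beta>\<^sub>1 + 1) c \<le> A2_norm_sq \<beta>\<^sub>1 f"
    using A2_norm_sq_equiv[OF \<beta>(1)] by metis
  obtain b2 where b2: "0 < b2" and N2: "\<And>(f :: complex ^ 'd \<Rightarrow> complex) c. f holo_on polydisc \<Longrightarrow> has_power_series f c \<Longrightarrow>
      A2_norm_sq \<beta>\<^sub>2 f \<le> ennreal b2 * coeff_norm_sq (\<beta>\<^sub>2 + 1) c"
    using A2_norm_sq_equiv[OF less_imp_le[OF \<beta>(2)]] by metis
  obtain C where C: "0 \<le> C" and bound: "\<And>F G x. finite F \<Longrightarrow> finite G \<Longrightarrow>
     (\<Sum>m\<in>G. (norm (\<Sum>n\<in>F. x n * t n m))\<^sup>2 * wt m powr - (\<beta>\<^sub>2 + 1))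
       \<le> C * (\<Sum>n\<in>F. (norm (x n))\<^sup>2 * wt n powr - (\<beta>\<^sub>1 + 1))"
    using mb unfolding matrix_bounded_def by blast
  define D where "D = b2 * C / a1"
  have D: "0 \<le> D" using a1 b2 C by (simp add: D_def)
  have A2_berg: "A2_norm_sq \<beta>\<^sub>2 = (bergman_norm_sq \<beta>\<^sub>2 :: (complex ^ 'd \<Rightarrow> complex) \<Rightarrow> ennreal)"
    using \<beta>(2) by (auto simp: A2_norm_sq_def fun_eq_iff)
  have main: "A2_norm_sq \<beta>\<^sub>2 (f \<circ> \<phi>) \<le> ennreal D * A2_norm_sq \<beta>\<^sub>1 f" if f: "f holo_on polydisc" for f
  proof -
    obtain c where c: "has_power_series f c" using holo_has_power_series[OF f] by blast
    define F where "F k = {n :: 'd \<Rightarrow> nat. n \<le> (\<lambda>_. k)}" for k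
    have F: "finite (F k)" for k unfolding F_def by (rule finite_below)
    define g where "g k z = (\<Sum>n\<in>F k. c n * zpow (\<phi> z) n)" for k z
    have gh: "g k holo_on polydisc" for k unfolding g_def[abs_def] by (rule holo_on_polynomial[OF F hol])
    have gps: "has_power_series (g k) (\<lambda>m. \<Sum>n\<in>F k. c n * t n m)" for k
      unfolding g_def[abs_def] by (rule has_power_series_sum[OF F t])
    have gbound: "A2_norm_sq \<beta>\<^sub>2 (g k) \<le> ennreal D * A2_norm_sq \<beta>\<^sub>1 f" for k
    proof -
      have cn: "coeff_norm_sq (\<beta>\<^sub>2 + 1) (\<lambda>m. \<Sum>n\<in>F k. c n * t n m) \<le> ennreal C * coeff_norm_sq (\<beta>\<^sub>1 + 1) c"
        unfolding coeff_norm_sq_def[of "\<beta>\<^sub>2 + 1"]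
      proof (rule nn_integral_count_le)
        fix G :: "('d \<Rightarrow> nat) set" assume G: "finite G"
        have "(\<Sum>m\<in>G. ennreal ((norm (\<Sum>n\<in>F k. c n * t n m))\<^sup>2 * wt m powr - (\<beta>\<^sub>2 + 1)))
          = ennreal (\<Sum>m\<in>G. (norm (\<Sum>n\<in>F k. c n * t n m))\<^sup>2 * wt m powr - (\<beta>\<^sub>2 + 1))"
          by (rule sum_ennreal) simp
        also have "\<dots> \<le> ennreal (C * (\<Sum>n\<in>F k. (norm (c n))\<^sup>2 * wt n powr - (\<beta>\<^sub>1 + 1)))"
          by (rule ennreal_leI[OF bound[OF F G]])
        also have "\<dots> = ennreal C * (\<Sum>n\<in>F k. ennreal ((norm (c n))\<^sup>2 * wt n powr - (\<beta>\<^sub>1 + 1)))"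
          unfolding ennreal_mult'[OF C] by (subst sum_ennreal) simp_all
        also have "\<dots> \<le> ennreal C * coeff_norm_sq (\<beta>\<^sub>1 + 1) c"
          unfolding coeff_norm_sq_def by (rule mult_left_mono[OF sum_le_nn_integral_count[OF F]]) simp
        finally show "(\<Sum>m\<in>G. ennreal ((norm (\<Sum>n\<in>F k. c n * t n m))\<^sup>2 * wt m powr - (\<beta>\<^sub>2 + 1)))
          \<le> ennreal C * coeff_norm_sq (\<beta>\<^sub>1 + 1) c" .
      qed
      have "coeff_norm_sq (\<beta>\<^sub>1 + 1) c = ennreal (1 / a1) * (ennreal a1 * coeff_norm_sq (\<beta>\<^sub>1 + 1) c)"
        using a1 by (simp add: mult.assoc[symmetric] ennreal_mult'[symmetric])
      also have "\<dots> \<le> ennreal (1 / a1) * A2_norm_sq \<beta>\<^sub>1 f"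
        by (rule mult_left_mono[OF N1[OF f c]]) simp
      finally have c1: "coeff_norm_sq (\<beta>\<^sub>1 + 1) c \<le> ennreal (1 / a1) * A2_norm_sq \<beta>\<^sub>1 f" .
      have "A2_norm_sq \<beta>\<^sub>2 (g k) \<le> ennreal b2 * (ennreal C * (ennreal (1 / a1) * A2_norm_sq \<beta>\<^sub>1 f))"
        by (rule order.trans[OF N2[OF gh gps]])
           (intro mult_left_mono order.trans[OF cn] c1, simp_all)
      also have "\<dots> = ennreal D * A2_norm_sq \<beta>\<^sub>1 f"
        using C b2 a1 by (simp add: mult.assoc[symmetric] ennreal_mult'[symmetric] D_def)
      finally show ?thesis .
    qed
    let ?V = "vec_power_measure (weighted_disc_area \<beta>\<^sub>2) :: (complex ^ 'd) measure"
    have setsV [measurable_cong]: "sets ?V = sets borel" by (simp add: vec_power_measure_def)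
    have um: "(\<lambda>z. ennreal ((norm (g k z))\<^sup>2) * indicator polydisc z) \<in> borel_measurable ?V" for k
    proof -
      have "(\<lambda>z. if z \<in> polydisc then g k z else 0) \<in> borel_measurable borel" by (rule borel_measurable_holo[OF gh])
      then have "(\<lambda>z. ennreal ((norm (if z \<in> polydisc then g k z else 0))\<^sup>2)) \<in> borel_measurable ?V" by measurable
      moreover have "ennreal ((norm (if z \<in> polydisc then g k z else 0))\<^sup>2) = ennreal ((norm (g k z))\<^sup>2) * indicator polydisc z" for z
        by simp
      ultimately show ?thesis by (simp only:)
    qed
    have lim: "liminf (\<lambda>k. ennreal ((norm (g k z))\<^sup>2) * indicator polydisc z) = ennreal ((norm ((f \<circ> \<phi>) z))\<^sup>2) * indicator polydisc z" for z
    proof (cases "z \<in> polydisc")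
      case True
      have "((\<lambda>n. c n * zpow (\<phi> z) n) has_sum f (\<phi> z)) UNIV"
        using c maps[OF True] unfolding has_power_series_def by blast
      then have "(\<lambda>k. g k z) \<longlonglongrightarrow> f (\<phi> z)"
        unfolding has_sum_def g_def F_def by (rule filterlim_compose[OF _ filterlim_boxes])
      then have "(\<lambda>k. ennreal ((norm (g k z))\<^sup>2)) \<longlonglongrightarrow> ennreal ((norm (f (\<phi> z)))\<^sup>2)"
        by (intro tendsto_ennrealI tendsto_intros)
      from lim_imp_Liminf[OF sequentially_bot this] show ?thesis using True by simp
    qed (simp add: Liminf_const)
    have "A2_norm_sq \<beta>\<^sub>2 (f \<circ> \<phi>) = (\<integral>\<^sup>+z. liminf (\<lambda>k. ennreal ((norm (g k z))\<^sup>2) * indicator polydisc z) \<partial>?V)"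
      unfolding A2_berg bergman_norm_sq_def lim ..
    also have "\<dots> \<le> liminf (\<lambda>k. \<integral>\<^sup>+z. ennreal ((norm (g k z))\<^sup>2) * indicator polydisc z \<partial>?V)"
      by (rule nn_integral_liminf[OF um])
    also have "\<dots> = liminf (\<lambda>k. A2_norm_sq \<beta>\<^sub>2 (g k))"
      unfolding A2_berg bergman_norm_sq_def ..
    also have "\<dots> \<le> liminf (\<lambda>k. ennreal D * A2_norm_sq \<beta>\<^sub>1 f)"
      by (intro Liminf_mono always_eventually allI gbound)
    also have "\<dots> = ennreal D * A2_norm_sq \<beta>\<^sub>1 f" by (rule Liminf_const) simp
    finally show ?thesis .
  qed
  show ?thesis unfolding composition_bounded_def
  proof (intro conjI ballI exI[of _ "sqrt D"])
    fix f :: "complex ^ 'd \<Rightarrow> complex" assume fA: "f \<in> A2 \<beta>\<^sub>1"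
    then have f: "f holo_on polydisc" and fin: "A2_norm_sq \<beta>\<^sub>1 f < \<infinity>" by (auto simp: A2_def)
    have "ennreal D * A2_norm_sq \<beta>\<^sub>1 f < \<infinity>" using fin by (simp add: ennreal_mult_less_top)
    then show "f \<circ> \<phi> \<in> A2 \<beta>\<^sub>2"
      using holo_on_compose[OF f \<phi>] le_less_trans[OF main[OF f]] by (simp add: A2_def)
    have "ennreal D * A2_norm_sq \<beta>\<^sub>1 f = ennreal (D * enn2real (A2_norm_sq \<beta>\<^sub>1 f))"
      using fin D by (simp add: ennreal_mult' less_top)
    with main[OF f] have "enn2real (A2_norm_sq \<beta>\<^sub>2 (f \<circ> \<phi>)) \<le> D * enn2real (A2_norm_sq \<beta>\<^sub>1 f)"
      by (intro enn2real_leI) (simp_all add: D)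
    then show "A2_norm \<beta>\<^sub>2 (f \<circ> \<phi>) \<le> sqrt D * A2_norm \<beta>\<^sub>1 f"
      unfolding A2_norm_def real_sqrt_mult[symmetric] by (rule real_sqrt_le_mono)
  qed
qed

lemma composition_bounded_shift:
  fixes \<phi> :: "complex ^ 'd \<Rightarrow> complex ^ 'd"
  assumes \<phi>: "holo_self_map \<phi>" and \<beta>: "\<beta>\<^sub>1 \<ge> -1" "\<beta>\<^sub>2 \<ge> -1"
    and cb: "composition_bounded \<phi> \<beta>\<^sub>1 \<beta>\<^sub>2" and \<beta>': "\<beta>\<^sub>1' \<ge> \<beta>\<^sub>1"
  shows "composition_bounded \<phi> \<beta>\<^sub>1' ((\<beta>\<^sub>1' * (\<beta>\<^sub>2 + 2) + 2 * (\<beta>\<^sub>2 - \<beta>\<^sub>1)) / (\<beta>\<^sub>1 + 2))"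
proof -
  define \<beta>\<^sub>2' where "\<beta>\<^sub>2' = (\<beta>\<^sub>1' * (\<beta>\<^sub>2 + 2) + 2 * (\<beta>\<^sub>2 - \<beta>\<^sub>1)) / (\<beta>\<^sub>1 + 2)"
  have pos: "0 < \<beta>\<^sub>1 + 2" "0 < \<beta>\<^sub>2 + 2" using \<beta> by simp_all
  \<comment> \<open>Shifted by 2, the formula for the new target exponent becomes proportionality,
    the equation of the ray.\<close>
  have e: "\<beta>\<^sub>2' + 2 = (\<beta>\<^sub>2 + 2) / (\<beta>\<^sub>1 + 2) * (\<beta>\<^sub>1' + 2)"
    using pos unfolding \<beta>\<^sub>2'_def by (simp add: field_simps)
  have "composition_bounded \<phi> \<beta>\<^sub>1' \<beta>\<^sub>2'"
  \<comment> \<open>Equality is split off because only a strict increase of the source exponent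
    guarantees a target exponent above -1, as the return from matrices to functions demands.\<close>
  proof (cases "\<beta>\<^sub>1' = \<beta>\<^sub>1")
    case True
    then have "\<beta>\<^sub>2' = \<beta>\<^sub>2" using e pos by simp
    then show ?thesis using cb True by simp
  next
    case False
    then have lt: "\<beta>\<^sub>1 < \<beta>\<^sub>1'" using \<beta>' by simp
    obtain t where t: "\<And>n. has_power_series (\<lambda>z. zpow (\<phi> z) n) (t n)"
      and mult: "\<And>a b. t (\<lambda>i. a i + b i) = cauchy_prod (t a) (t b)"
      using composition_matrix[OF \<phi>] by blast
    have mb: "matrix_bounded t (\<beta>\<^sub>1 + 1) (\<beta>\<^sub>2 + 1)"
      by (rule composition_bounded_imp_matrix_bounded[OF \<phi> t \<beta> cb])
    have "matrix_bounded t (\<beta>\<^sub>1' + 1) ((\<beta>\<^sub>2 + 1 + 1) / (\<beta>\<^sub>1 + 1 + 1) * (\<beta>\<^sub>1' + 1 + 1) - 1)"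
      by (rule matrix_bounded_extrapolate[OF mult mb]) (use \<beta> lt in simp_all)
    also have "(\<beta>\<^sub>2 + 1 + 1) / (\<beta>\<^sub>1 + 1 + 1) * (\<beta>\<^sub>1' + 1 + 1) - 1 = \<beta>\<^sub>2' + 1"
      using e by (simp add: add.assoc)
    finally have mb': "matrix_bounded t (\<beta>\<^sub>1' + 1) (\<beta>\<^sub>2' + 1)" .
    have "(\<beta>\<^sub>2 + 2) / (\<beta>\<^sub>1 + 2) * (\<beta>\<^sub>1 + 2) < (\<beta>\<^sub>2 + 2) / (\<beta>\<^sub>1 + 2) * (\<beta>\<^sub>1' + 2)"
      by (rule mult_strict_left_mono) (use pos lt in simp_all)
    then have "\<beta>\<^sub>2 + 2 < \<beta>\<^sub>2' + 2" unfolding e using pos by simp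
    then have "-1 < \<beta>\<^sub>2'" using \<beta> by simp
    moreover have "-1 \<le> \<beta>\<^sub>1'" using \<beta> lt by simp
    ultimately show ?thesis by (intro matrix_bounded_imp_composition_bounded[OF \<phi> t _ _ mb'])
  qed
  then show ?thesis by (simp only: \<beta>\<^sub>2'_def)
qed

theorem theorem2p13:
  fixes \<phi> :: "complex ^ 'd \<Rightarrow> complex ^ 'd" and \<beta>\<^sub>1 \<beta>\<^sub>2 :: real
  assumes "holo_self_map \<phi>" and "C1_closed_polydisc \<phi>"
    and "\<beta>\<^sub>1 \<ge> -1" and "\<beta>\<^sub>2 \<ge> -1"
  shows "(composition_bounded \<phi> \<beta>\<^sub>1 \<beta>\<^sub>2 \<longrightarrow>
            (\<forall>\<beta>\<^sub>1' \<ge> \<beta>\<^sub>1. composition_bounded \<phi> \<beta>\<^sub>1'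
               ((\<beta>\<^sub>1' * (\<beta>\<^sub>2 + 2) + 2 * (\<beta>\<^sub>2 - \<beta>\<^sub>1)) / (\<beta>\<^sub>1 + 2))))
       \<and> (composition_bounded \<phi> \<beta>\<^sub>1 \<beta>\<^sub>1 \<longrightarrow>
            (\<forall>\<beta>\<^sub>1' \<ge> \<beta>\<^sub>1. composition_bounded \<phi> \<beta>\<^sub>1' \<beta>\<^sub>1'))"
proof (intro conjI impI allI)
  fix \<beta>\<^sub>1' assume "composition_bounded \<phi> \<beta>\<^sub>1 \<beta>\<^sub>2" "\<beta>\<^sub>1 \<le> \<beta>\<^sub>1'"
  then show "composition_bounded \<phi> \<beta>\<^sub>1' ((\<beta>\<^sub>1' * (\<beta>\<^sub>2 + 2) + 2 * (\<beta>\<^sub>2 - \<beta>\<^sub>1)) / (\<beta>\<^sub>1 + 2))"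
    by (rule composition_bounded_shift[OF assms(1,3,4)])
next
  fix \<beta>\<^sub>1' assume "composition_bounded \<phi> \<beta>\<^sub>1 \<beta>\<^sub>1" "\<beta>\<^sub>1 \<le> \<beta>\<^sub>1'"
  then have "composition_bounded \<phi> \<beta>\<^sub>1' ((\<beta>\<^sub>1' * (\<beta>\<^sub>1 + 2) + 2 * (\<beta>\<^sub>1 - \<beta>\<^sub>1)) / (\<beta>\<^sub>1 + 2))"
    by (rule composition_bounded_shift[OF assms(1,3,3)])
  then show "composition_bounded \<phi> \<beta>\<^sub>1' \<beta>\<^sub>1'" using assms(3) by simp
qed

end
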